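(* Let $\gamma\in(1,2)$ and $\alpha,\beta\in(0,1)$. Let $\mu_N$ be the unique invariant measure of the boundary driven symmetric long jumps exclusion process on $\Lambda_N=\{1,\dots,N-1\}$ with left reservoir density $\alpha$ and right reservoir density $\beta$, and let $\bar\rho:[0,1]\to[0,1]$ be the unique weak solution of the stationary fractional heat equation $(-\Delta)^{\gamma/2}\bar\rho(q)=0$, $q\in(0,1)$, with $\bar\rho(0)=\alpha$, $\bar\rho(1)=\beta$. Then for any continuous function $H:[0,1]\to\mathbb{R}$, $$\lim_{N\to\infty}\frac{1}{N-1}\sum_{z=1}^{N-1}H\left(\tfrac zN\right)\eta_z=\int_0^1 H(q)\,\bar\rho(q)\,dq$$ in probability under $\mu_N$.
   Context: **The process.** Fix $\gamma\in(1,2)$, $\alpha,\beta\in(0,1)$. Let $p(z)=c_\gamma|z|^{-(1+\gamma)}$ for $z\in\mathbb{Z}$, $|z|\ge1$, and $p(0)=0$, where $c_\gamma>0$ is the constant making $p$ a probability on $\mathbb{Z}$. For $N\ge2$ let $\Lambda_N=\{1,\dots,N-1\}$ and $\Omega_N=\{0,1\}^{\Lambda_N}$. For $\eta\in\Omega_N$, $\eta^{xy}$ is obtained from $\eta$ by exchanging the values at $x$ and $y$, and $\eta^x$ is obtained by replacing $\eta_x$ by $1-\eta_x$. The boundary driven symmetric long jumps exclusion process is the continuous-time Markov chain on $\Omega_N$ with generator $L_N=L_N^0+L_N^r+L_N^\ell$, where for $f:\Omega_N\to\mathbb{R}$ $$(L_N^0f)(\eta)=\tfrac12\sum_{x,y\in\Lambda_N}p(x-y)[f(\eta^{xy})-f(\eta)],$$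 $$(L_N^rf)(\eta)=\sum_{x\in\Lambda_N,\,y\ge N}p(x-y)[\eta_x(1-\beta)+(1-\eta_x)\beta][f(\eta^x)-f(\eta)],$$ $$(L_N^\ell f)(\eta)=\sum_{x\in\Lambda_N,\,y\le0}p(x-y)[\eta_x(1-\alpha)+(1-\eta_x)\alpha][f(\eta^x)-f(\eta)].$$ **Fractional Laplacian.** For $H:\mathbb{R}\to\mathbb{R}$ with $\int_{\mathbb{R}}|H(q)|(1+|q|)^{-1-\gamma}dq<\infty$, $$(-\Delta)^{\gamma/2}H(q)=c_\gamma\lim_{\varepsilon\to0}\int_{\mathbb{R}}\mathbf{1}_{|y-q|\ge\varepsilon}\frac{H(q)-H(y)}{|y-q|^{1+\gamma}}dy$$ whenever the limit exists (here $c_\gamma$ is the same constant that makes $p(z)=c_\gamma|z|^{-(1+\gamma)}$, $|z|\ge1$, $p(0)=0$, a probability on $\mathbb{Z}$). **Weak solution.** For $q\in(0,1)$ put $r^-(q)=c_\gamma\gamma^{-1}q^{-\gamma}$, $r^+(q)=c_\gamma\gamma^{-1}(1-q)^{-\gamma}$. Let $C_c^2([0,1])$ be the set of $C^2$ functions with compact support included in $(0,1)$ (extended by $0$ to $\mathbb{R}$). A weak solution of the stationary fractional heat equation with boundary values $\alpha,\beta$ is a continuous function $\rho:[0,1]\to[0,1]$ with $\rho(0)=\alpha$, $\rho(1)=\beta$ and, for all $H\in C_c^2([0,1])$, $$-\langle\rho,(-\Delta)^{\gamma/2}H\rangle+\langle\alpha r^-+\beta r^+,H\rangle=0,$$ where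 $\langle\cdot,\cdot\rangle$ is the scalar product of $L^2([0,1])$. There is exactly one weak solution, denoted $\bar\rho$; for $q\in(0,1)$ it is given by $$\bar\rho(q)=\int_{|y-\frac12|>\frac12}g(y)\,\frac{\sin(\pi\gamma/2)}{\pi}\left[\frac{\frac14-(q-\frac12)^2}{(y-\frac12)^2-\frac14}\right]^{\gamma/2}\frac{dy}{|q-y|},$$ with $g(y)=\alpha$ for $y<0$ and $g(y)=\beta$ for $y>1$. *)

theory Defs
  imports "HOL-Probability.Probability"
begin

section \<open>The jump rate\<close>

definition c_const :: "real \<Rightarrow> real" where
  "c_const \<gamma> = 1 / (\<Sum>\<^sub>\<infinity>z\<in>{z::int. z \<noteq> 0}. \<bar>real_of_int z\<bar> powr (- (1 + \<gamma>)))"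

definition jump :: "real \<Rightarrow> int \<Rightarrow> real" where
  "jump \<gamma> z = (if z = 0 then 0 else c_const \<gamma> * \<bar>real_of_int z\<bar> powr (- (1 + \<gamma>)))"

lemma summable_abs_powr_int:
  assumes "\<gamma> > 0"
  shows "(\<lambda>z::int. \<bar>real_of_int z\<bar> powr (- (1 + \<gamma>))) summable_on {z. z \<noteq> 0}"
proof -
  let ?f = "\<lambda>z::int. \<bar>real_of_int z\<bar> powr (- (1 + \<gamma>))"
  have "summable (\<lambda>n. real n powr (- (1 + \<gamma>)))"
    using assms by (simp add: summable_real_powr_iff)
  then have s: "(\<lambda>n. real n powr (- (1 + \<gamma>))) summable_on UNIV"
    by (intro norm_summable_imp_summable_on) simp
  have "?f summable_on range int"
    using s by (subst summable_on_reindex) (auto simp: o_def)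
  moreover have "?f summable_on range (\<lambda>n. - int n)"
    using s by (subst summable_on_reindex) (auto simp: o_def inj_on_def)
  ultimately have "?f summable_on (range int \<union> range (\<lambda>n. - int n))"
    by (rule summable_on_union)
  then show ?thesis
    by (rule summable_on_subset_banach) (auto, metis int_cases2 rangeI)
qed

lemma c_const_pos:
  assumes "\<gamma> > 0"
  shows "c_const \<gamma> > 0"
proof -
  let ?f = "\<lambda>z::int. \<bar>real_of_int z\<bar> powr (- (1 + \<gamma>))"
  have "infsum ?f {1} \<le> infsum ?f {z. z \<noteq> 0}"
    using summable_abs_powr_int[OF assms] by (intro infsum_mono_neutral) auto
  then show ?thesis
    by (simp add: c_const_def)
qed

lemma jump_has_sum_1:
  assumes "\<gamma> > 0"
  shows "(jump \<gamma> has_sum 1) UNIV"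
proof -
  let ?f = "\<lambda>z::int. \<bar>real_of_int z\<bar> powr (- (1 + \<gamma>))"
  have "((\<lambda>z. c_const \<gamma> * ?f z) has_sum (c_const \<gamma> * infsum ?f {z. z \<noteq> 0})) {z. z \<noteq> 0}"
    using summable_abs_powr_int[OF assms] by (intro has_sum_cmult_right has_sum_infsum)
  moreover have "c_const \<gamma> * infsum ?f {z. z \<noteq> 0} = 1"
    using c_const_pos[OF assms] by (auto simp: c_const_def)
  ultimately show ?thesis
    by (subst has_sum_cong_neutral[where T = "{z. z \<noteq> 0}" and g = "\<lambda>z. c_const \<gamma> * ?f z"])
       (auto simp: jump_def)
qed


section \<open>The boundary driven symmetric long jumps exclusion process\<close>

definition bulk :: "nat \<Rightarrow> int set" where
  "bulk N = {1..int N - 1}"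

type_synonym config = "int \<Rightarrow> real"

text \<open>Configurations are extensional functions, so that \<open>configs N\<close> is a copy of the finite
  set of 0-1-valued functions on \<open>bulk N\<close>.\<close>

definition configs :: "nat \<Rightarrow> config set" where
  "configs N = bulk N \<rightarrow>\<^sub>E {0, 1}"

definition exchange :: "int \<Rightarrow> int \<Rightarrow> config \<Rightarrow> config" where
  "exchange x y \<eta> = \<eta>(x := \<eta> y, y := \<eta> x)"

definition flip :: "int \<Rightarrow> config \<Rightarrow> config" where
  "flip x \<eta> = \<eta>(x := 1 - \<eta> x)"

definition gen_bulk :: "real \<Rightarrow> nat \<Rightarrow> (config \<Rightarrow> real) \<Rightarrow> config \<Rightarrow> real" where
  "gen_bulk \<gamma> N f \<eta> =
     1/2 * (\<Sum>x\<in>bulk N. \<Sum>y\<in>bulk N. jump \<gamma> (x - y) * (f (exchange x y \<eta>) - f \<eta>))"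

definition gen_right :: "real \<Rightarrow> real \<Rightarrow> nat \<Rightarrow> (config \<Rightarrow> real) \<Rightarrow> config \<Rightarrow> real" where
  "gen_right \<gamma> \<beta> N f \<eta> =
     (\<Sum>x\<in>bulk N. \<Sum>\<^sub>\<infinity>y\<in>{int N..}.
        jump \<gamma> (x - y) * (\<eta> x * (1 - \<beta>) + (1 - \<eta> x) * \<beta>) * (f (flip x \<eta>) - f \<eta>))"

definition gen_left :: "real \<Rightarrow> real \<Rightarrow> nat \<Rightarrow> (config \<Rightarrow> real) \<Rightarrow> config \<Rightarrow> real" where
  "gen_left \<gamma> \<alpha> N f \<eta> =
     (\<Sum>x\<in>bulk N. \<Sum>\<^sub>\<infinity>y\<in>{..0}.
        jump \<gamma> (x - y) * (\<eta> x * (1 - \<alpha>) + (1 - \<eta> x) * \<alpha>) * (f (flip x \<eta>) - f \<eta>))"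

definition generator ::
    "real \<Rightarrow> real \<Rightarrow> real \<Rightarrow> nat \<Rightarrow> (config \<Rightarrow> real) \<Rightarrow> config \<Rightarrow> real" where
  "generator \<gamma> \<alpha> \<beta> N f \<eta> = gen_bulk \<gamma> N f \<eta> + gen_right \<gamma> \<beta> N f \<eta> + gen_left \<gamma> \<alpha> N f \<eta>"

text \<open>The state space is finite, so the transition semigroup of the Markov chain is the
  exponential of the generator.\<close>

definition semigroup ::
    "real \<Rightarrow> real \<Rightarrow> real \<Rightarrow> nat \<Rightarrow> real \<Rightarrow> (config \<Rightarrow> real) \<Rightarrow> config \<Rightarrow> real" where
  "semigroup \<gamma> \<alpha> \<beta> N t f \<eta> = (\<Sum>n. t ^ n / fact n * (generator \<gamma> \<alpha> \<beta> N ^^ n) f \<eta>)"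

definition invariant_measure :: "real \<Rightarrow> real \<Rightarrow> real \<Rightarrow> nat \<Rightarrow> config pmf \<Rightarrow> bool" where
  "invariant_measure \<gamma> \<alpha> \<beta> N \<mu> \<longleftrightarrow>
     set_pmf \<mu> \<subseteq> configs N \<and>
     (\<forall>t\<ge>0. \<forall>f. measure_pmf.expectation \<mu> (semigroup \<gamma> \<alpha> \<beta> N t f) =
                measure_pmf.expectation \<mu> f)"


section \<open>The stationary fractional heat equation\<close>

text \<open>Principal value form; only meaningful where the limit exists and \<open>H\<close> is integrable
  against \<open>(1 + \<bar>q\<bar>) powr (- 1 - \<gamma>)\<close>. Both hold everywhere for \<open>H \<in> C2c\<close>.\<close>

definition frac_Laplacian :: "real \<Rightarrow> (real \<Rightarrow> real) \<Rightarrow> real \<Rightarrow> real" where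
  "frac_Laplacian \<gamma> H q =
     c_const \<gamma> *
     Lim (at_right 0) (\<lambda>\<epsilon>. LINT y:{y. \<bar>y - q\<bar> \<ge> \<epsilon>}|lborel. (H q - H y) / \<bar>y - q\<bar> powr (1 + \<gamma>))"

definition C2c :: "(real \<Rightarrow> real) set" where
  "C2c = {H. (\<exists>H' H''. (\<forall>q. (H has_real_derivative H' q) (at q)) \<and>
                        (\<forall>q. (H' has_real_derivative H'' q) (at q)) \<and>
                        continuous_on UNIV H'') \<and>
             compact (closure {q. H q \<noteq> 0}) \<and> closure {q. H q \<noteq> 0} \<subseteq> {0<..<1}}"

definition r_minus :: "real \<Rightarrow> real \<Rightarrow> real" where
  "r_minus \<gamma> q = c_const \<gamma> / \<gamma> * q powr (- \<gamma>)"

definition r_plus :: "real \<Rightarrow> real \<Rightarrow> real" where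
  "r_plus \<gamma> q = c_const \<gamma> / \<gamma> * (1 - q) powr (- \<gamma>)"

definition L2_prod :: "(real \<Rightarrow> real) \<Rightarrow> (real \<Rightarrow> real) \<Rightarrow> real" where
  "L2_prod f g = (LINT q:{0..1}|lborel. f q * g q)"

definition weak_solution :: "real \<Rightarrow> real \<Rightarrow> real \<Rightarrow> (real \<Rightarrow> real) \<Rightarrow> bool" where
  "weak_solution \<gamma> \<alpha> \<beta> \<rho> \<longleftrightarrow>
     continuous_on {0..1} \<rho> \<and> \<rho> \<in> {0..1} \<rightarrow> {0..1} \<and> \<rho> 0 = \<alpha> \<and> \<rho> 1 = \<beta> \<and>
     (\<forall>H\<in>C2c. - L2_prod \<rho> (frac_Laplacian \<gamma> H)
                + L2_prod (\<lambda>q. \<alpha> * r_minus \<gamma> q + \<beta> * r_plus \<gamma> q) H = 0)"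


section \<open>Convergence in probability\<close>

text \<open>Convergence of \<open>X N\<close> to a constant, where each \<open>X N\<close> lives on its own probability space.\<close>

definition tendsto_in_prob :: "(nat \<Rightarrow> 'a pmf) \<Rightarrow> (nat \<Rightarrow> 'a \<Rightarrow> real) \<Rightarrow> real \<Rightarrow> bool" where
  "tendsto_in_prob \<mu> X c \<longleftrightarrow>
     (\<forall>\<epsilon>>0. (\<lambda>N. measure_pmf.prob (\<mu> N) {\<omega>. \<bar>X N \<omega> - c\<bar> > \<epsilon>}) \<longlonglongrightarrow> 0)"

end

theory Submission
  imports Defs "HOL-Real_Asymp.Real_Asymp"
begin

text \<open>
  The mean occupation \<open>u\<close> of the invariant measure, extended by \<open>\<alpha>\<close> to the left and by \<open>\<beta>\<close> to the
  right of the bulk, is discrete harmonic for the jump kernel. Bernoulli's inequality makes a small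
  power of the distance to the reservoir a superharmonic barrier (here \<open>\<gamma> > 1\<close> enters), so \<open>u\<close> takes
  its boundary values uniformly in \<open>N\<close>. Mollifying the weak solution turns it into a function that is
  discrete harmonic away from the boundary up to an error \<open>o(N powr - \<gamma>)\<close>: the discrete operator is
  moved onto the mollifier, where it converges uniformly to the fractional Laplacian. The maximum
  principle, with killing rate of order \<open>N powr - \<gamma>\<close>, then compares \<open>u\<close> with the weak solution;
  uniqueness of the weak solution and its explicit formula are not needed.

  For the fluctuations, the two-point covariances solve a closed equation with a sign, so they are
  nonpositive, and summing that equation bounds their total mass by \<open>N powr \<gamma>\<close> times the energy
  of \<open>u\<close>. Testing the harmonic equation against \<open>u\<close> itself bounds the energy by the total rate of
  the reservoirs, which is \<open>O(1)\<close> as \<open>\<gamma> > 1\<close>. The variance of the empirical density is therefore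
  \<open>O(N powr (\<gamma> - 2))\<close>, and Chebyshev's inequality concludes.
\<close>

section \<open>Power sums and the jump kernel\<close>

text \<open>A weak solution is merely continuous, so the lattice operator cannot be compared
  pointwise with its fractional Laplacian, and only smooth functions supported inside the interval
  may be tested. Mollifying at a fixed scale \<open>r\<close> makes every translate of the kernel
  centred at distance at least \<open>2 * r\<close> from the ends an admissible test function; the
  remaining strip is left to the barrier, which is why a boundary estimate uniform in
  \<open>N\<close> is indispensable. The order of choices is tolerance, then \<open>r\<close>, then
  the kernel with its derivative bounds, and only then \<open>N\<close>, so the growth of these
  bounds as \<open>r\<close> shrinks is harmless. Means and covariances are controlled on the same
  scale: from every bulk site, long jumps reach the reservoirs at rate at least a multiple of
  \<open>N powr (- \<gamma>)\<close>. This pays for a consistency error of smaller order in the mean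
  and for the source in the covariance equation. That source comes from the single bond joining the
  two sites, whose exchange leaves the product of the occupations unchanged; summed over all pairs
  it is the Dirichlet energy.\<close>

lemma powr_neg_diff_bounds:
  fixes a b s :: real
  assumes "0 < a" "a \<le> b" "0 < s"
  shows "s * (b - a) * b powr (- (1 + s)) \<le> a powr (- s) - b powr (- s)"
    and "a powr (- s) - b powr (- s) \<le> s * (b - a) * a powr (- (1 + s))"
proof -
  have "\<exists>\<xi>\<ge>a. \<xi> \<le> b \<and> a powr (- s) - b powr (- s) = s * (b - a) * \<xi> powr (- (1 + s))"
  proof (cases "a = b")
    case False
    then have "a < b" using assms by simp
    moreover have "\<And>x. a \<le> x \<Longrightarrow> x \<le> b \<Longrightarrow>
        ((\<lambda>x. x powr (- s)) has_real_derivative (- s) * x powr (- s - 1)) (at x)"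
      using assms by (intro has_real_derivative_powr) auto
    ultimately obtain \<xi> where "a < \<xi>" "\<xi> < b"
        "b powr (- s) - a powr (- s) = (b - a) * ((- s) * \<xi> powr (- s - 1))"
      using MVT2[of a b "\<lambda>x. x powr (- s)" "\<lambda>x. (- s) * x powr (- s - 1)"] by blast
    moreover have "- s - 1 = - (1 + s)" by simp
    ultimately show ?thesis
      by (intro exI[of _ \<xi>]) (auto simp: algebra_simps)
  qed auto
  then obtain \<xi> where \<xi>: "a \<le> \<xi>" "\<xi> \<le> b"
      "a powr (- s) - b powr (- s) = s * (b - a) * \<xi> powr (- (1 + s))" by blast
  have "b powr (- (1 + s)) \<le> \<xi> powr (- (1 + s))" "\<xi> powr (- (1 + s)) \<le> a powr (- (1 + s))"
    using \<xi> assms by (intro powr_mono2'; simp)+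
  then show "s * (b - a) * b powr (- (1 + s)) \<le> a powr (- s) - b powr (- s)"
    and "a powr (- s) - b powr (- s) \<le> s * (b - a) * a powr (- (1 + s))"
    using \<xi> assms by (auto intro!: mult_left_mono)
qed

lemma summable_shift_powr:
  assumes "e < -1"
  shows "summable (\<lambda>n. real (n + m) powr e)"
  using assms summable_ignore_initial_segment[of "\<lambda>n. real n powr e" m]
  by (simp add: summable_real_powr_iff)

lemma powr_telescope_sums:
  assumes "s > 0"
  shows "(\<lambda>n. real (n + m) powr (- s) - real (Suc n + m) powr (- s)) sums (real m powr (- s))"
proof -
  have "(\<lambda>n. real (n + m) powr (- s)) \<longlonglongrightarrow> 0"
    using assms
    by (intro tendsto_neg_powr filterlim_compose[OF filterlim_real_sequentially]
        filterlim_add_const_nat_at_top) auto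
  from telescope_sums'[OF this] show ?thesis by simp
qed

text \<open>Comparison with the telescoping series of \<open>real n powr (- s)\<close> replaces the
  integral test. The upper bound carries an additional first term because the mean value bound
  controls each increment from below only through its right endpoint.\<close>

lemma powr_tail_bounds:
  assumes "s > 0" "m > 0"
  shows "real m powr (- s) / s \<le> (\<Sum>n. real (n + m) powr (- (1 + s)))"
    and "(\<Sum>n. real (n + m) powr (- (1 + s))) \<le> real m powr (- s) / s + real m powr (- (1 + s))"
proof -
  let ?t = "\<lambda>n. real (n + m) powr (- s) - real (Suc n + m) powr (- s)"
  let ?f = "\<lambda>n. real (n + m) powr (- (1 + s))"
  note tel = powr_telescope_sums[OF assms(1), of m]
  have sm: "summable ?f" using assms by (intro summable_shift_powr) auto
  have le: "?t n \<le> s * ?f n" and ge: "s * ?f (Suc n) \<le> ?t n" for n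
    using powr_neg_diff_bounds[of "real (n + m)" "real (Suc n + m)" s] assms by auto
  have "real m powr (- s) = (\<Sum>n. ?t n)" using tel by (simp add: sums_iff)
  also have "\<dots> \<le> (\<Sum>n. s * ?f n)"
    using le tel sm by (intro suminf_le) (auto simp: sums_iff intro: summable_mult)
  also have "\<dots> = s * (\<Sum>n. ?f n)" using sm by (rule suminf_mult)
  finally show "real m powr (- s) / s \<le> (\<Sum>n. ?f n)"
    using assms by (simp add: field_simps)
  have sm': "summable (\<lambda>n. ?f (Suc n))" using sm by (subst summable_Suc_iff)
  have "s * (\<Sum>n. ?f (Suc n)) = (\<Sum>n. s * ?f (Suc n))"
    using sm' by (rule suminf_mult[symmetric])
  also have "\<dots> \<le> (\<Sum>n. ?t n)"
    using ge tel sm' by (intro suminf_le) (auto simp: sums_iff intro!: summable_mult)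
  also have "\<dots> = real m powr (- s)" using tel by (simp add: sums_iff)
  finally have "(\<Sum>n. ?f (Suc n)) \<le> real m powr (- s) / s"
    using assms by (simp add: field_simps)
  moreover have "(\<Sum>n. ?f (Suc n)) = (\<Sum>n. ?f n) - ?f 0" by (rule suminf_split_head[OF sm])
  ultimately show "(\<Sum>n. ?f n) \<le> real m powr (- s) / s + real m powr (- (1 + s))" by simp
qed

lemma jump_Suc: "jump \<gamma> (int (Suc n)) = c_const \<gamma> * real (Suc n) powr (- (1 + \<gamma>))"
  by (simp add: jump_def)

lemma jump_minus: "jump \<gamma> (- z) = jump \<gamma> z"
  by (simp add: jump_def)

lemma jump_nonneg: "\<gamma> > 0 \<Longrightarrow> 0 \<le> jump \<gamma> z"
  using c_const_pos[of \<gamma>] by (simp add: jump_def)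

text \<open>The jump kernel applied to \<open>g\<close>, with the jumps \<open>n\<close> and \<open>- n\<close> paired so that it is a series
  over the natural numbers.\<close>

definition avg :: "real \<Rightarrow> (int \<Rightarrow> real) \<Rightarrow> int \<Rightarrow> real" where
  "avg \<gamma> g x = (\<Sum>n. jump \<gamma> (int (Suc n)) * (g (x + int (Suc n)) + g (x - int (Suc n))))"

lemma summable_jump: "\<gamma> > 0 \<Longrightarrow> summable (\<lambda>n. jump \<gamma> (int (Suc n)))"
  unfolding jump_Suc using summable_shift_powr[of "- (1 + \<gamma>)" 1] by (auto intro!: summable_mult)

lemma summable_jump_mult:
  assumes "\<gamma> > 0" "\<And>n. \<bar>b n\<bar> \<le> B"
  shows "summable (\<lambda>n. jump \<gamma> (int (Suc n)) * b n)"
proof (rule summable_comparison_test')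
  show "summable (\<lambda>n. jump \<gamma> (int (Suc n)) * B)"
    using summable_jump[OF assms(1)] by (rule summable_mult2)
  show "norm (jump \<gamma> (int (Suc n)) * b n) \<le> jump \<gamma> (int (Suc n)) * B" for n
    using assms jump_nonneg[OF assms(1)] by (auto simp: abs_mult intro!: mult_left_mono)
qed

lemma summable_avg:
  assumes "\<gamma> > 0" "\<And>y. \<bar>g y\<bar> \<le> B"
  shows "summable (\<lambda>n. jump \<gamma> (int (Suc n)) * (g (x + int (Suc n)) + g (x - int (Suc n))))"
  using assms(2) by (intro summable_jump_mult[OF assms(1), of _ "2 * B"])
    (smt (verit, best))

text \<open>Absolute convergence allows the unordered sum over the integers to be regrouped into the
  pairs of \<open>avg\<close>; the site \<open>x\<close> itself belongs to neither half, but its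
  weight \<open>jump \<gamma> 0\<close> is zero. This is the bridge between the generator, written
  with unordered sums, and the series estimates.\<close>

lemma has_sum_avg:
  assumes "\<gamma> > 0" "\<And>y. \<bar>g y\<bar> \<le> B"
  shows "((\<lambda>y. jump \<gamma> (x - y) * g y) has_sum avg \<gamma> g x) UNIV"
proof -
  let ?F = "\<lambda>y. jump \<gamma> (x - y) * g y"
  let ?a = "\<lambda>n. jump \<gamma> (int (Suc n)) * g (x + int (Suc n))"
  let ?b = "\<lambda>n. jump \<gamma> (int (Suc n)) * g (x - int (Suc n))"
  have sa: "summable ?a" "summable ?b" using assms by (auto intro!: summable_jump_mult simp del: of_nat_Suc)
  have na: "summable (\<lambda>n. norm (?a n))" "summable (\<lambda>n. norm (?b n))"
    using jump_nonneg[OF assms(1)] assms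
    by (auto simp: abs_mult simp del: of_nat_Suc intro!: summable_jump_mult[where B = B])
  have ha: "(?a has_sum suminf ?a) UNIV" and hb: "(?b has_sum suminf ?b) UNIV"
    using sa na by (auto intro!: norm_summable_imp_has_sum simp: summable_sums)
  have "(?F has_sum suminf ?a) (range (\<lambda>n. x + int (Suc n)))"
    using ha by (subst has_sum_reindex) (auto simp: inj_on_def o_def jump_minus simp del: of_nat_Suc)
  moreover have "(?F has_sum suminf ?b) (range (\<lambda>n. x - int (Suc n)))"
    using hb by (subst has_sum_reindex) (auto simp: inj_on_def o_def simp del: of_nat_Suc)
  moreover have "range (\<lambda>n. x + int (Suc n)) \<inter> range (\<lambda>n. x - int (Suc n)) = {}" by auto
  ultimately have *: "(?F has_sum (suminf ?a + suminf ?b))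
      (range (\<lambda>n. x + int (Suc n)) \<union> range (\<lambda>n. x - int (Suc n)))"
    by (rule has_sum_Un_disjoint)
  have "y \<in> range (\<lambda>n. x + int (Suc n)) \<union> range (\<lambda>n. x - int (Suc n))" if "y \<noteq> x" for y
  proof (cases "y > x")
    case True then have "y = x + int (Suc (nat (y - x - 1)))" by simp
    then show ?thesis by blast
  next
    case False then have "y = x - int (Suc (nat (x - y - 1)))" using that by simp
    then show ?thesis by blast
  qed
  then have "?F y = 0" if "y \<notin> range (\<lambda>n. x + int (Suc n)) \<union> range (\<lambda>n. x - int (Suc n))" for y
    using that by (cases "y = x") (auto simp: jump_def)
  then have "(?F has_sum (suminf ?a + suminf ?b)) UNIV"
    using * by (subst has_sum_cong_neutral[where T = "range (\<lambda>n. x + int (Suc n)) \<union> range (\<lambda>n. x - int (Suc n))" and g = ?F])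
      (auto simp del: of_nat_Suc)
  also have "suminf ?a + suminf ?b = avg \<gamma> g x"
    unfolding avg_def suminf_add[OF sa] by (simp add: distrib_left)
  finally show ?thesis .
qed

lemma avg_const:
  assumes "\<gamma> > 0"
  shows "avg \<gamma> (\<lambda>_. a) x = a"
proof -
  have "(jump \<gamma> has_sum 1) UNIV" by (rule jump_has_sum_1[OF assms])
  then have "((\<lambda>y. jump \<gamma> (x - y)) has_sum 1) UNIV"
    by (subst has_sum_reindex_bij_betw[of "\<lambda>y. x - y" UNIV UNIV "jump \<gamma>"])
       (auto intro!: bij_betwI[of _ _ _ "\<lambda>y. x - y"])
  then have "((\<lambda>y. jump \<gamma> (x - y) * a) has_sum 1 * a) UNIV" by (rule has_sum_cmult_left)
  with has_sum_avg[OF assms, of "\<lambda>_. a" "\<bar>a\<bar>" x] show ?thesis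
    using has_sum_unique by fastforce
qed

text \<open>The positive jumps alone carry half of the probability mass, hence the factor 2.\<close>

lemma sums_jump: "\<gamma> > 0 \<Longrightarrow> (\<lambda>n. jump \<gamma> (int (Suc n)) * (2 * a)) sums a"
  using avg_const[of \<gamma> a 0] summable_jump_mult[of \<gamma> "\<lambda>_. 2 * a" "\<bar>2 * a\<bar>"]
  unfolding avg_def by (simp add: sums_iff del: of_nat_Suc)

lemma avg_diff:
  assumes "\<gamma> > 0" "\<And>y. \<bar>g y\<bar> \<le> B" "\<And>y. \<bar>h y\<bar> \<le> B'"
  shows "avg \<gamma> (\<lambda>y. g y - h y) x = avg \<gamma> g x - avg \<gamma> h x"
  unfolding avg_def
  using suminf_diff[OF summable_avg[OF assms(1), of g B x] summable_avg[OF assms(1), of h B' x]] assms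
  by (simp add: algebra_simps)

lemma avg_minus_self:
  assumes "\<gamma> > 0" "\<And>y. \<bar>g y\<bar> \<le> B"
  shows "(\<lambda>n. jump \<gamma> (int (Suc n)) * (g (x + int (Suc n)) + g (x - int (Suc n)) - 2 * g x)) sums (avg \<gamma> g x - g x)"
proof -
  have "(\<lambda>n. jump \<gamma> (int (Suc n)) * (g (x + int (Suc n)) + g (x - int (Suc n)))) sums avg \<gamma> g x"
    using summable_avg[OF assms] unfolding avg_def by (rule summable_sums)
  from sums_diff[OF this sums_jump[OF assms(1), of "g x"]] show ?thesis
    by (simp add: right_diff_distrib)
qed

text \<open>\<open>kill \<gamma> * N powr - \<gamma>\<close> bounds from below the rate of leaving the bulk on one side.\<close>

definition kill :: "real \<Rightarrow> real" where
  "kill \<gamma> = c_const \<gamma> * 2 powr (- (1 + \<gamma>))"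

lemma kill_pos: "\<gamma> > 0 \<Longrightarrow> kill \<gamma> > 0"
  by (simp add: kill_def c_const_pos)

section \<open>Maximum principle with killing\<close>

lemma sum_jump_ge_kill:
  assumes "\<gamma> > 0" "N > 0"
  shows "kill \<gamma> * real N powr (- \<gamma>) \<le> (\<Sum>n\<in>{N..<2*N}. jump \<gamma> (int (Suc n)))"
proof -
  have "(\<Sum>n\<in>{N..<2*N}. c_const \<gamma> * (2 * real N) powr (- (1 + \<gamma>))) \<le> (\<Sum>n\<in>{N..<2*N}. jump \<gamma> (int (Suc n)))"
    unfolding jump_Suc using assms c_const_pos[of \<gamma>]
    by (intro sum_mono mult_left_mono powr_mono2') (auto simp: le_less)
  also have "(\<Sum>n\<in>{N..<2*N}. c_const \<gamma> * (2 * real N) powr (- (1 + \<gamma>))) =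
      kill \<gamma> * (real N * real N powr (- (1 + \<gamma>)))"
    using assms by (simp add: kill_def powr_mult)
  also have "real N * real N powr (- (1 + \<gamma>)) = real N powr (- \<gamma>)"
    using assms powr_mult_base[of "real N" "- (1 + \<gamma>)"] by simp
  finally show ?thesis .
qed

lemma finite_bulk [simp]: "finite (bulk N)" by (simp add: bulk_def)

text \<open>Suppose the maximum, attained at a site \<open>z\<close> of \<open>S\<close>, exceeds
  \<open>M\<close>. No jump can raise the value and a jump out of the bulk lowers it to at most
  \<open>M\<close>, so \<open>avg\<close> falls below \<open>w z\<close> by at least the excess
  times the killing rate; hypothesis \<open>sub\<close> lets it fall by at most
  \<open>\<kappa>\<close>.\<close>

lemma avg_max_principle:
  assumes "\<gamma> > 0" "N > 0" "S \<subseteq> bulk N" "\<kappa> \<ge> 0"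
    and bd: "\<And>y. \<bar>w y\<bar> \<le> B"
    and sub: "\<And>x. x \<in> S \<Longrightarrow> w x - \<kappa> \<le> avg \<gamma> w x"
    and out: "\<And>y. y \<notin> S \<Longrightarrow> w y \<le> M"
  shows "w x \<le> M + \<kappa> * real N powr \<gamma> / kill \<gamma>"
proof -
  have e: "\<kappa> * real N powr \<gamma> / kill \<gamma> \<ge> 0" using kill_pos[of \<gamma>] assms by auto
  show ?thesis
  proof (cases "w x \<le> M")
    case False
    then have "x \<in> S" using out by force
    have fin: "finite S" using finite_subset[OF assms(3)] by simp
    have "Max (w ` S) \<in> w ` S" using fin \<open>x \<in> S\<close> by (intro Max_in) auto
    then obtain z where "z \<in> S" "w z = Max (w ` S)" by (metis imageE)
    then have z: "z \<in> S" "\<And>y. y \<in> S \<Longrightarrow> w y \<le> w z" using fin by auto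
    then have zM: "M < w z" using False \<open>x \<in> S\<close> by force
    have wz: "w y \<le> w z" for y using z out[of y] zM by (cases "y \<in> S") auto
    \<comment> \<open>Leftward jumps of length \<open>Suc n > N\<close> leave the bulk from every
      site; their weight alone already gives the killing rate.\<close>
    let ?I = "{N..<2*N}"
    let ?j = "\<lambda>n. jump \<gamma> (int (Suc n))"
    have term_le: "?j n * (w (z + int (Suc n)) + w (z - int (Suc n)) - 2 * w z) \<le>
        (if n \<in> ?I then ?j n * (M - w z) else 0)" for n
    proof (cases "n \<in> ?I")
      case True
      have "z - int (Suc n) \<notin> bulk N" using z(1) assms(3) True by (auto simp: bulk_def)
      then have "w (z - int (Suc n)) \<le> M" using out assms(3) by blast
      then show ?thesis using True wz[of "z + int (Suc n)"] jump_nonneg[OF assms(1)]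
        by (auto intro!: mult_left_mono simp del: of_nat_Suc)
    next
      case False
      then show ?thesis using wz[of "z + int (Suc n)"] wz[of "z - int (Suc n)"] jump_nonneg[OF assms(1)]
        by (auto intro!: mult_nonneg_nonpos simp del: of_nat_Suc)
    qed
    have "avg \<gamma> w z - w z \<le> (\<Sum>n\<in>?I. ?j n * (M - w z))"
      by (rule sums_le[OF term_le avg_minus_self[OF assms(1) bd] sums_If_finite_set]) simp
    also have "\<dots> = - (w z - M) * (\<Sum>n\<in>?I. ?j n)"
      by (simp only: sum_distrib_right[symmetric]) (simp add: algebra_simps)
    also have "\<dots> \<le> - (w z - M) * (kill \<gamma> * real N powr (- \<gamma>))"
      using zM sum_jump_ge_kill[OF assms(1,2)] by (intro mult_left_mono_neg) auto
    finally have "(w z - M) * (kill \<gamma> * real N powr (- \<gamma>)) \<le> \<kappa>"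
      using sub[OF z(1)] by (simp only: mult_minus_left)
    then have "w z - M \<le> \<kappa> * real N powr \<gamma> / kill \<gamma>"
      using kill_pos[of \<gamma>] assms by (simp add: powr_minus field_simps)
    then show ?thesis using wz[of x] by simp
  qed (use e in simp)
qed

text \<open>Concavity of \<open>ln\<close> at the points \<open>1 + t\<close> and \<open>1\<close>
  with weights \<open>a\<close> and \<open>1 - a\<close>.\<close>

lemma powr_Bernoulli:
  fixes t a :: real
  assumes "0 < a" "a \<le> 1" "-1 \<le> t"
  shows "(1 + t) powr a \<le> 1 + a * t"
proof (cases "t = -1")
  case False
  have "a * ln (1 + t) + (1 - a) * ln 1 \<le> ln (a * (1 + t) + (1 - a) * 1)"
    using assms False concave_onD[OF ln_concave, of "1 - a" "1 + t" 1] by auto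
  then have "(1 + t) powr a \<le> exp (ln (a * (1 + t) + (1 - a)))"
    using False assms by (simp add: powr_def)
  also have "a * (1 + t) + (1 - a) > 0"
    using False assms by (cases "a = 1") (auto intro!: add_nonneg_pos)
  then have "exp (ln (a * (1 + t) + (1 - a))) = 1 + a * t" by (simp add: algebra_simps)
  finally show ?thesis .
qed (use assms in auto)


section \<open>Boundary regularity\<close>

text \<open>The exponent is small enough for the loss from jumps into the reservoir to beat the linear
  gain from jumps longer than the distance to it.\<close>

definition barrier :: "real \<Rightarrow> nat \<Rightarrow> int \<Rightarrow> real" where
  "barrier \<gamma> N y = (min 1 (max 0 (real_of_int y / real N))) powr ((\<gamma> - 1) / \<gamma>\<^sup>2)"

lemma barrier_nonneg: "0 \<le> barrier \<gamma> N y"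
  by (simp add: barrier_def)

lemma barrier_exponent:
  fixes \<gamma> :: real
  assumes "\<gamma> > 1"
  shows "0 < (\<gamma> - 1) / \<gamma>\<^sup>2" "(\<gamma> - 1) / \<gamma>\<^sup>2 \<le> 1"
proof -
  have "\<gamma> * 1 \<le> \<gamma> * \<gamma>" using assms by (intro mult_left_mono) auto
  then have "\<gamma> - 1 \<le> \<gamma> * \<gamma>" by linarith
  then show "(\<gamma> - 1) / \<gamma>\<^sup>2 \<le> 1" "0 < (\<gamma> - 1) / \<gamma>\<^sup>2"
    using assms by (auto simp: power2_eq_square)
qed

lemma barrier_le_1:
  assumes "\<gamma> > 1"
  shows "barrier \<gamma> N y \<le> 1"
  using barrier_exponent[OF assms] unfolding barrier_def by (intro powr_le1) auto

lemma abs_barrier_le_1: "\<gamma> > 1 \<Longrightarrow> \<bar>barrier \<gamma> N y\<bar> \<le> 1"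
  using barrier_nonneg[of \<gamma> N y] barrier_le_1[of \<gamma> N y] by simp

text \<open>With \<open>m\<close> the distance to the left reservoir and \<open>a\<close> the
  exponent, Bernoulli bounds the values at distance \<open>k\<close> by the linearisation of the
  power at \<open>m\<close>. For \<open>k < m\<close> the linear terms cancel; for
  \<open>k \<ge> m\<close> the left value is 0, leaving at most \<open>?G * (a * k / m - 1)\<close>.
  Summed against the kernel and up to the factor \<open>c_const \<gamma> * ?G\<close>, the gain is
  at most \<open>a * \<gamma> / (\<gamma> - 1) * m powr (- \<gamma>)\<close> and the loss at least
  \<open>m powr (- \<gamma>) / \<gamma>\<close>; the exponent is the value at which these
  agree.\<close>

lemma avg_barrier_le:
  assumes \<gamma>: "\<gamma> > 1" and "N > 0" and x: "x \<in> bulk N"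
  shows "avg \<gamma> (barrier \<gamma> N) x \<le> barrier \<gamma> N x"
proof -
  define a where "a = (\<gamma> - 1) / \<gamma>\<^sup>2"
  have a: "0 < a" "a \<le> 1" using barrier_exponent[OF \<gamma>] by (auto simp: a_def)
  define m where "m = nat x"
  have m: "x = int m" "m > 0" "m < N" using x by (auto simp: bulk_def m_def)
  let ?g = "barrier \<gamma> N"
  let ?G = "(real m / real N) powr a"
  have gx: "?g x = ?G" using m by (simp add: barrier_def a_def)
  have up: "?g (x + int k) \<le> ?G * (1 + a * (real k / real m))" for k
  proof -
    have "?g (x + int k) \<le> ((real m + real k) / real N) powr a"
      unfolding barrier_def a_def[symmetric] using a m by (intro powr_mono2) auto
    also have "(real m + real k) / real N = (real m / real N) * (1 + real k / real m)"
      using m by (simp add: field_simps)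
    also have "\<dots> powr a = ?G * (1 + real k / real m) powr a"
      by (subst powr_mult) auto
    also have "\<dots> \<le> ?G * (1 + a * (real k / real m))"
    proof (intro mult_left_mono powr_Bernoulli a)
      have "0 \<le> real k / real m" by simp
      then show "-1 \<le> real k / real m" by linarith
    qed auto
    finally show ?thesis .
  qed
  have down: "?g (x - int k) \<le> ?G * (1 - a * (real k / real m))" if "k < m" for k
  proof -
    have "?g (x - int k) \<le> ((real m - real k) / real N) powr a"
      unfolding barrier_def a_def[symmetric] using a m that by (intro powr_mono2) auto
    also have "(real m - real k) / real N = (real m / real N) * (1 + - (real k / real m))"
      using m by (simp add: field_simps)
    also have "\<dots> powr a = ?G * (1 + - (real k / real m)) powr a"
      using that m by (subst powr_mult) auto
    also have "\<dots> \<le> ?G * (1 + a * (- (real k / real m)))"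
      using a m that by (intro mult_left_mono powr_Bernoulli) auto
    finally show ?thesis by simp
  qed
  have far: "?g (x - int k) = 0" if "k \<ge> m" for k
  proof -
    have "real_of_int (x - int k) / real N \<le> 0" using that m by (intro divide_nonpos_pos) auto
    then show ?thesis by (simp add: barrier_def)
  qed
  let ?b = "\<lambda>n. if Suc n < m then 0 else ?G * (a * (real (Suc n) / real m) - 1)"
  have le: "jump \<gamma> (int (Suc n)) * (?g (x + int (Suc n)) + ?g (x - int (Suc n)) - 2 * ?g x)
      \<le> jump \<gamma> (int (Suc n)) * ?b n" for n
    using up[of "Suc n"] down[of "Suc n"] far[of "Suc n"] jump_nonneg[of \<gamma>] \<gamma> gx
    by (intro mult_left_mono) (auto simp: algebra_simps simp del: of_nat_Suc)
  \<comment> \<open>The exponent equals \<open>- \<gamma>\<close> and is spelt so that the tail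
    bound applies with \<open>s = \<gamma> - 1\<close>.\<close>
  let ?S1 = "\<Sum>i. real (i + m) powr (- (1 + (\<gamma> - 1)))"
  let ?S2 = "\<Sum>i. real (i + m) powr (- (1 + \<gamma>))"
  have "(\<lambda>i. c_const \<gamma> * ?G * (a / real m * real (i + m) powr (- (1 + (\<gamma> - 1))) - real (i + m) powr (- (1 + \<gamma>))))
      sums (c_const \<gamma> * ?G * (a / real m * ?S1 - ?S2))"
    using \<gamma> by (intro sums_mult sums_diff summable_sums summable_shift_powr) auto
  moreover have "c_const \<gamma> * ?G * (a / real m * real (i + m) powr (- (1 + (\<gamma> - 1))) - real (i + m) powr (- (1 + \<gamma>)))
     = jump \<gamma> (int (Suc (i + (m - 1)))) * ?b (i + (m - 1))" for i
  proof -
    have S: "Suc (i + (m - 1)) = i + m" using m by simp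
    have "real (i + m) powr (- (1 + (\<gamma> - 1))) = real (i + m) * real (i + m) powr (- (1 + \<gamma>))"
      using powr_mult_base[of "real (i + m)" "- (1 + \<gamma>)"] m by simp
    moreover have "jump \<gamma> (int (i + m)) = c_const \<gamma> * real (i + m) powr (- (1 + \<gamma>))"
      using jump_Suc[of \<gamma> "i + (m - 1)"] unfolding S .
    ultimately show ?thesis unfolding S using m by (simp add: field_simps)
  qed
  ultimately have "(\<lambda>i. jump \<gamma> (int (Suc (i + (m - 1)))) * ?b (i + (m - 1)))
      sums (c_const \<gamma> * ?G * (a / real m * ?S1 - ?S2))" by simp
  \<comment> \<open>The first \<open>m - 1\<close> coefficients \<open>?b n\<close> vanish, so the
    series starts at \<open>n = m - 1\<close>, that is, at jump length \<open>m\<close>.\<close>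
  then have s: "(\<lambda>n. jump \<gamma> (int (Suc n)) * ?b n) sums (c_const \<gamma> * ?G * (a / real m * ?S1 - ?S2))"
    by (subst (asm) sums_zero_iff_shift) auto
  have p1: "real m powr (- \<gamma>) \<le> real m powr (- (\<gamma> - 1))" using m \<gamma> by (intro powr_mono) auto
  have "?S1 \<le> real m powr (- (\<gamma> - 1)) / (\<gamma> - 1) + real m powr (- (1 + (\<gamma> - 1)))"
    using powr_tail_bounds(2)[of "\<gamma> - 1" m] \<gamma> m by simp
  also have "\<dots> \<le> real m powr (- (\<gamma> - 1)) / (\<gamma> - 1) + real m powr (- (\<gamma> - 1))"
    using p1 by simp
  also have "\<dots> = real m powr (- (\<gamma> - 1)) * (\<gamma> / (\<gamma> - 1))"
    using \<gamma> by (simp add: field_simps)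
  also have "real m powr (- (\<gamma> - 1)) = real m * real m powr (- \<gamma>)"
    using powr_mult_base[of "real m" "- \<gamma>"] m by simp
  finally have "a / real m * ?S1 \<le> a / real m * (real m * real m powr (- \<gamma>) * (\<gamma> / (\<gamma> - 1)))"
    using a by (intro mult_left_mono) auto
  also have "\<dots> = real m powr (- \<gamma>) / \<gamma>"
    using m \<gamma> by (simp add: a_def power2_eq_square)
  also have "\<dots> \<le> ?S2" using powr_tail_bounds(1)[of \<gamma> m] \<gamma> m by simp
  finally have "c_const \<gamma> * ?G * (a / real m * ?S1 - ?S2) \<le> 0"
    using c_const_pos[of \<gamma>] \<gamma> by (intro mult_nonneg_nonpos) auto
  moreover have "avg \<gamma> ?g x - ?g x \<le> c_const \<gamma> * ?G * (a / real m * ?S1 - ?S2)"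
    using abs_barrier_le_1[OF \<gamma>] \<gamma> by (intro sums_le[OF le avg_minus_self s]) auto
  ultimately show ?thesis by simp
qed

text \<open>Maximum principle without error for \<open>u - a - barrier\<close>: outside the bulk the
  barrier is nonnegative on the left, where \<open>u = a\<close>, and equals 1 on the right, which
  absorbs a gap of up to 1 between the reservoirs. The bound is the same power of
  \<open>x / N\<close> for every \<open>N\<close>.\<close>

lemma harmonic_le_barrier:
  assumes \<gamma>: "\<gamma> > 1" and N: "N > 0"
    and bd: "\<And>y. \<bar>u y\<bar> \<le> B"
    and harm: "\<And>x. x \<in> bulk N \<Longrightarrow> avg \<gamma> u x = u x"
    and left: "\<And>y. y \<le> 0 \<Longrightarrow> u y = a" and right: "\<And>y. y \<ge> int N \<Longrightarrow> u y \<le> a + 1"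
  shows "u x - a \<le> barrier \<gamma> N x"
proof -
  have \<gamma>0: "\<gamma> > 0" using \<gamma> by simp
  \<comment> \<open>The double minus writes a sum as a difference, so that \<open>avg_diff\<close>
    serves as the linearity rule throughout.\<close>
  let ?w = "\<lambda>y. u y - (a - - barrier \<gamma> N y)"
  have av: "avg \<gamma> ?w y = avg \<gamma> u y - (a + avg \<gamma> (barrier \<gamma> N) y)" for y
  proof -
    have b1: "\<bar>a - - barrier \<gamma> N y\<bar> \<le> \<bar>a\<bar> + 1" for y using abs_barrier_le_1[OF \<gamma>, of N y] by simp
    have b2: "\<bar>- barrier \<gamma> N y\<bar> \<le> 1" for y using abs_barrier_le_1[OF \<gamma>, of N y] by simp
    have "avg \<gamma> (\<lambda>y. 0 - barrier \<gamma> N y) y = 0 - avg \<gamma> (barrier \<gamma> N) y"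
      using avg_diff[OF \<gamma>0, of "\<lambda>_. 0" 0 "barrier \<gamma> N" 1 y] abs_barrier_le_1[OF \<gamma>] avg_const[OF \<gamma>0] by simp
    moreover have "avg \<gamma> (\<lambda>y. a - - barrier \<gamma> N y) y = a - avg \<gamma> (\<lambda>y. - barrier \<gamma> N y) y"
      using avg_diff[OF \<gamma>0, of "\<lambda>_. a" "\<bar>a\<bar>" "\<lambda>y. - barrier \<gamma> N y" 1 y] b2 avg_const[OF \<gamma>0] by simp
    ultimately show ?thesis using avg_diff[OF \<gamma>0 bd b1, where x = y] by simp
  qed
  have out: "?w y \<le> 0" if "y \<notin> bulk N" for y
  proof (cases "y \<le> 0")
    case True
    then show ?thesis using left barrier_nonneg[of \<gamma> N y] by simp
  next
    case False
    then have "y \<ge> int N" using that by (auto simp: bulk_def)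
    moreover from this have "1 \<le> real_of_int y / real N" using N by simp
    then have "barrier \<gamma> N y = 1" by (simp add: barrier_def)
    ultimately show ?thesis using right[of y] by simp
  qed
  have "?w x \<le> 0 + 0 * real N powr \<gamma> / kill \<gamma>"
  proof (rule avg_max_principle[OF \<gamma>0 N, of "bulk N" 0 ?w "B + \<bar>a\<bar> + 1"])
    show "\<bar>?w y\<bar> \<le> B + \<bar>a\<bar> + 1" for y using bd[of y] abs_barrier_le_1[OF \<gamma>, of N y] by linarith
    show "?w y - 0 \<le> avg \<gamma> ?w y" if "y \<in> bulk N" for y
      using harm[OF that] avg_barrier_le[OF \<gamma> N that] unfolding av by simp
  qed (use out in auto)
  then show ?thesis by simp
qed

lemma harmonic_near_left:
  assumes \<gamma>: "\<gamma> > 1" and N: "N > 0"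
    and bd: "\<And>y. \<bar>u y\<bar> \<le> B"
    and harm: "\<And>x. x \<in> bulk N \<Longrightarrow> avg \<gamma> u x = u x"
    and left: "\<And>y. y \<le> 0 \<Longrightarrow> u y = a" and right: "\<And>y. y \<ge> int N \<Longrightarrow> \<bar>u y - a\<bar> \<le> 1"
  shows "\<bar>u x - a\<bar> \<le> barrier \<gamma> N x"
proof -
  have \<gamma>0: "\<gamma> > 0" using \<gamma> by simp
  have "avg \<gamma> (\<lambda>y. 0 - u y) x = 0 - avg \<gamma> u x" for x
    using avg_diff[OF \<gamma>0, of "\<lambda>_. 0" 0 u B x] bd avg_const[OF \<gamma>0] by simp
  then have neg: "avg \<gamma> (\<lambda>y. - u y) x = - avg \<gamma> u x" for x by simp
  have "- u x - (- a) \<le> barrier \<gamma> N x"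
  proof (rule harmonic_le_barrier[OF \<gamma> N, where B = B])
    show "- u y \<le> - a + 1" if "int N \<le> y" for y using right[OF that] by linarith
  qed (use bd harm left neg in auto)
  moreover have "u x - a \<le> barrier \<gamma> N x"
  proof (rule harmonic_le_barrier[OF \<gamma> N, where B = B])
    show "u y \<le> a + 1" if "int N \<le> y" for y using right[OF that] by linarith
  qed (use bd harm left in auto)
  ultimately show ?thesis by linarith
qed

lemma avg_reflect: "avg \<gamma> (\<lambda>y. u (c - y)) x = avg \<gamma> u (c - x)"
  unfolding avg_def by (intro suminf_cong) (simp add: algebra_simps)

text \<open>Reflection \<open>y \<mapsto> int N - y\<close> exchanges the reservoirs, and the kernel
  is even.\<close>

lemma harmonic_near_right:
  assumes \<gamma>: "\<gamma> > 1" and N: "N > 0"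
    and bd: "\<And>y. \<bar>u y\<bar> \<le> B"
    and harm: "\<And>x. x \<in> bulk N \<Longrightarrow> avg \<gamma> u x = u x"
    and left: "\<And>y. y \<le> 0 \<Longrightarrow> \<bar>u y - b\<bar> \<le> 1" and right: "\<And>y. y \<ge> int N \<Longrightarrow> u y = b"
  shows "\<bar>u x - b\<bar> \<le> barrier \<gamma> N (int N - x)"
proof -
  have "\<bar>u (int N - (int N - x)) - b\<bar> \<le> barrier \<gamma> N (int N - x)"
  proof (rule harmonic_near_left[OF \<gamma> N, where B = B and u = "\<lambda>y. u (int N - y)"])
    show "avg \<gamma> (\<lambda>y. u (int N - y)) y = u (int N - y)" if "y \<in> bulk N" for y
      unfolding avg_reflect using that by (intro harm) (auto simp: bulk_def)
  qed (use bd left right in auto)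
  then show ?thesis by simp
qed


section \<open>Reservoir rates\<close>

lemma jump_tail_sums:
  assumes "\<gamma> > 0" "m > 0"
  shows "(\<lambda>n. jump \<gamma> (int (Suc n)) * (if m \<le> Suc n then 1 else 0)) sums
    (c_const \<gamma> * (\<Sum>i. real (i + m) powr (- (1 + \<gamma>))))"
proof -
  have S: "Suc (i + (m - 1)) = i + m" for i using assms by simp
  have "(\<lambda>i. c_const \<gamma> * real (i + m) powr (- (1 + \<gamma>))) sums
      (c_const \<gamma> * (\<Sum>i. real (i + m) powr (- (1 + \<gamma>))))"
    using assms by (intro sums_mult summable_sums summable_shift_powr) auto
  moreover have "c_const \<gamma> * real (i + m) powr (- (1 + \<gamma>)) =
      jump \<gamma> (int (Suc (i + (m - 1)))) * (if m \<le> Suc (i + (m - 1)) then 1 else 0)" for i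
    using jump_Suc[of \<gamma> "i + (m - 1)"] unfolding S by simp
  ultimately have "(\<lambda>i. jump \<gamma> (int (Suc (i + (m - 1)))) * (if m \<le> Suc (i + (m - 1)) then 1 else 0))
      sums (c_const \<gamma> * (\<Sum>i. real (i + m) powr (- (1 + \<gamma>))))" by simp
  then show ?thesis by (subst (asm) sums_zero_iff_shift) auto
qed

text \<open>Total jump rate from \<open>x\<close> into the left reservoir; in the equations for
  means and covariances it acts as a killing rate.\<close>

definition rate_left :: "real \<Rightarrow> int \<Rightarrow> real" where
  "rate_left \<gamma> x = (\<Sum>\<^sub>\<infinity>y\<in>{..0}. jump \<gamma> (x - y))"

definition rate_right :: "real \<Rightarrow> nat \<Rightarrow> int \<Rightarrow> real" where
  "rate_right \<gamma> N x = (\<Sum>\<^sub>\<infinity>y\<in>{int N..}. jump \<gamma> (x - y))"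

lemma jump_summable_on:
  assumes "\<gamma> > 0"
  shows "(\<lambda>y. jump \<gamma> (x - y)) summable_on A"
proof -
  have "(\<lambda>y. jump \<gamma> (x - y) * 1) summable_on UNIV"
    using has_sum_avg[OF assms, of "\<lambda>_. 1" 1 x] by (auto intro: has_sum_imp_summable)
  then show ?thesis by (auto intro: summable_on_subset_banach)
qed

lemma rate_right_reflect: "rate_right \<gamma> N x = rate_left \<gamma> (int N - x)"
proof -
  have "bij_betw (\<lambda>y. int N - y) {..0} {int N..}"
    by (rule bij_betwI[of _ _ _ "\<lambda>y. int N - y"]) auto
  from infsum_reindex_bij_betw[OF this, of "\<lambda>y. jump \<gamma> (x - y)"]
  have "rate_right \<gamma> N x = (\<Sum>\<^sub>\<infinity>y\<in>{..0}. jump \<gamma> (x - (int N - y)))"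
    by (simp add: rate_right_def)
  also have "\<dots> = rate_left \<gamma> (int N - x)"
    unfolding rate_left_def using jump_minus[of \<gamma> "int N - x - _"]
    by (intro infsum_cong) (simp add: algebra_simps)
  finally show ?thesis .
qed

text \<open>The \<open>N\<close> reservoir sites nearest the boundary lie within distance
  \<open>2 * N\<close> of \<open>x\<close>, so each contributes at least the kernel at
  \<open>2 * N\<close>.\<close>

lemma rate_left_ge:
  assumes "\<gamma> > 0" "x \<in> bulk N"
  shows "kill \<gamma> * real N powr (- \<gamma>) \<le> rate_left \<gamma> x"
proof -
  have N: "N > 0" using assms by (auto simp: bulk_def)
  have "kill \<gamma> * real N powr (- \<gamma>) = kill \<gamma> * (real N * real N powr (- (1 + \<gamma>)))"
    using N powr_mult_base[of "real N" "- (1 + \<gamma>)"] by simp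
  also have "\<dots> = (\<Sum>y\<in>{1 - int N..0}. c_const \<gamma> * (2 * real N) powr (- (1 + \<gamma>)))"
    using N by (simp add: kill_def powr_mult)
  also have "\<dots> \<le> (\<Sum>y\<in>{1 - int N..0}. jump \<gamma> (x - y))"
  proof (rule sum_mono)
    fix y assume "y \<in> {1 - int N..0}"
    then have "0 < x - y" "x - y \<le> 2 * int N" using assms by (auto simp: bulk_def)
    then have "0 < real_of_int (x - y)" "real_of_int (x - y) \<le> 2 * real N" by linarith+
    then show "c_const \<gamma> * (2 * real N) powr (- (1 + \<gamma>)) \<le> jump \<gamma> (x - y)"
      using c_const_pos[OF assms(1)] assms(1) unfolding jump_def
      by (auto intro!: mult_left_mono powr_mono2')
  qed
  also have "\<dots> \<le> rate_left \<gamma> x"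
    unfolding rate_left_def using jump_nonneg[OF assms(1)] jump_summable_on[OF assms(1)]
    by (intro finite_sum_le_infsum) auto
  finally show ?thesis .
qed

text \<open>Jumps into the reservoir from distance \<open>m\<close> have length at least
  \<open>m\<close>, so the rate is a kernel tail. The factor 2 merges the two terms of the tail
  bound, using \<open>1 / \<gamma> \<le> 1\<close>.\<close>

lemma rate_left_le:
  assumes "\<gamma> > 1" "m > 0"
  shows "rate_left \<gamma> (int m) \<le> 2 * c_const \<gamma> * real m powr (- \<gamma>)"
proof -
  have \<gamma>: "\<gamma> > 0" using assms by simp
  have "((\<lambda>y. jump \<gamma> (int m - y)) has_sum rate_left \<gamma> (int m)) {..0}"
    unfolding rate_left_def using jump_summable_on[OF \<gamma>] by (rule has_sum_infsum)
  then have "((\<lambda>y. jump \<gamma> (int m - y) * (if y \<le> 0 then 1 else 0)) has_sum rate_left \<gamma> (int m)) UNIV"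
    by (subst has_sum_cong_neutral[where T = "{..0}" and g = "\<lambda>y. jump \<gamma> (int m - y)"]) auto
  moreover have "((\<lambda>y. jump \<gamma> (int m - y) * (if y \<le> 0 then 1 else 0)) has_sum
      avg \<gamma> (\<lambda>y. if y \<le> 0 then 1 else 0) (int m)) UNIV"
    by (rule has_sum_avg[OF \<gamma>, of _ 1]) auto
  ultimately have "rate_left \<gamma> (int m) = avg \<gamma> (\<lambda>y. if y \<le> 0 then 1 else 0) (int m)"
    by (rule has_sum_unique)
  also have "\<dots> = (\<Sum>n. jump \<gamma> (int (Suc n)) * (if m \<le> Suc n then 1 else 0))"
    unfolding avg_def by (intro suminf_cong) auto
  also have "\<dots> = c_const \<gamma> * (\<Sum>i. real (i + m) powr (- (1 + \<gamma>)))"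
    using jump_tail_sums[OF \<gamma> assms(2)] by (simp add: sums_iff)
  also have "\<dots> \<le> c_const \<gamma> * (2 * real m powr (- \<gamma>))"
  proof (intro mult_left_mono)
    have "(\<Sum>i. real (i + m) powr (- (1 + \<gamma>))) \<le> real m powr (- \<gamma>) / \<gamma> + real m powr (- (1 + \<gamma>))"
      using powr_tail_bounds(2)[OF \<gamma> assms(2)] .
    also have "\<dots> \<le> real m powr (- \<gamma>) / 1 + real m powr (- \<gamma>)"
      using assms by (intro add_mono divide_left_mono powr_mono) auto
    finally show "(\<Sum>i. real (i + m) powr (- (1 + \<gamma>))) \<le> 2 * real m powr (- \<gamma>)" by simp
  qed (use c_const_pos[OF \<gamma>] in simp)
  finally show ?thesis by simp
qed

text \<open>The rate at distance \<open>m\<close> is of order \<open>m powr (- \<gamma>)\<close>,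
  summable uniformly in \<open>N\<close>; the 4 collects the factor 2 from each of the two
  sides.\<close>

lemma rate_sum_le:
  assumes "\<gamma> > 1"
  shows "(\<Sum>x\<in>bulk N. rate_left \<gamma> x + rate_right \<gamma> N x) \<le> 4 * c_const \<gamma> * (\<Sum>n. real (n + 1) powr (- \<gamma>))"
proof -
  have \<gamma>: "\<gamma> > 0" using assms by simp
  have "bij_betw (\<lambda>x. int N - x) (bulk N) (bulk N)"
    by (rule bij_betwI[of _ _ _ "\<lambda>x. int N - x"]) (auto simp: bulk_def)
  from sum.reindex_bij_betw[OF this, of "rate_left \<gamma>"]
  have "(\<Sum>x\<in>bulk N. rate_right \<gamma> N x) = (\<Sum>x\<in>bulk N. rate_left \<gamma> x)"
    by (simp add: rate_right_reflect)
  moreover have "(\<Sum>x\<in>bulk N. rate_left \<gamma> x) \<le> 2 * c_const \<gamma> * (\<Sum>n. real (n + 1) powr (- \<gamma>))"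
  proof -
    have "bij_betw (\<lambda>n. int (Suc n)) {..<N - 1} (bulk N)"
      by (rule bij_betwI[of _ _ _ "\<lambda>x. nat (x - 1)"]) (auto simp: bulk_def)
    from sum.reindex_bij_betw[OF this, of "rate_left \<gamma>"]
    have "(\<Sum>x\<in>bulk N. rate_left \<gamma> x) = (\<Sum>n<N-1. rate_left \<gamma> (int (Suc n)))" by simp
    also have "\<dots> \<le> (\<Sum>n<N-1. 2 * c_const \<gamma> * real (n + 1) powr (- \<gamma>))"
      using rate_left_le[OF assms, of "Suc _"] by (intro sum_mono) (simp del: of_nat_Suc)
    also have "\<dots> = 2 * c_const \<gamma> * (\<Sum>n<N-1. real (n + 1) powr (- \<gamma>))"
      by (simp add: sum_distrib_left)
    also have "\<dots> \<le> 2 * c_const \<gamma> * (\<Sum>n. real (n + 1) powr (- \<gamma>))"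
      using summable_shift_powr[of "-\<gamma>" 1] assms c_const_pos[OF \<gamma>]
      by (intro mult_left_mono sum_le_suminf) auto
    finally show ?thesis .
  qed
  ultimately show ?thesis by (simp add: sum.distrib)
qed

text \<open>Since \<open>u\<close> is constant on each reservoir, the jumps leaving the bulk
  collapse to the two total rates. This identifies harmonicity of the extended function with the
  one-site equation produced by the generator.\<close>

lemma avg_minus_self_reservoirs:
  assumes "\<gamma> > 0" "N > 0" "\<And>y. \<bar>u y\<bar> \<le> B"
    and "\<And>y. y \<le> 0 \<Longrightarrow> u y = a" and "\<And>y. y \<ge> int N \<Longrightarrow> u y = b"
  shows "avg \<gamma> u x - u x = (\<Sum>y\<in>bulk N. jump \<gamma> (x - y) * (u y - u x)) +
    rate_right \<gamma> N x * (b - u x) + rate_left \<gamma> x * (a - u x)"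
proof -
  let ?v = "\<lambda>y. u y - u x"
  let ?F = "\<lambda>y. jump \<gamma> (x - y) * ?v y"
  have "((\<lambda>y. jump \<gamma> (x - y)) has_sum rate_left \<gamma> x) {..0}"
    unfolding rate_left_def using jump_summable_on[OF assms(1)] by (rule has_sum_infsum)
  from has_sum_cmult_left[OF this, of "a - u x"]
  have l: "(?F has_sum (rate_left \<gamma> x * (a - u x))) {..0}"
    using assms(4) by (subst (asm) has_sum_cong) auto
  have "((\<lambda>y. jump \<gamma> (x - y)) has_sum rate_right \<gamma> N x) {int N..}"
    unfolding rate_right_def using jump_summable_on[OF assms(1)] by (rule has_sum_infsum)
  from has_sum_cmult_left[OF this, of "b - u x"]
  have r: "(?F has_sum (rate_right \<gamma> N x * (b - u x))) {int N..}"
    using assms(5) by (subst (asm) has_sum_cong) auto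
  have m: "(?F has_sum (\<Sum>y\<in>bulk N. ?F y)) (bulk N)" by (rule has_sum_finite) simp
  have "(?F has_sum ((\<Sum>y\<in>bulk N. ?F y) + rate_right \<gamma> N x * (b - u x) + rate_left \<gamma> x * (a - u x)))
      ((bulk N \<union> {int N..}) \<union> {..0})"
    using assms(2) by (intro has_sum_Un_disjoint m l r) (auto simp: bulk_def)
  also have "(bulk N \<union> {int N..}) \<union> {..0} = UNIV" by (auto simp: bulk_def)
  finally have 1: "(?F has_sum ((\<Sum>y\<in>bulk N. ?F y) + rate_right \<gamma> N x * (b - u x) + rate_left \<gamma> x * (a - u x))) UNIV" .
  have b': "\<bar>?v y\<bar> \<le> 2 * B" for y using assms(3)[of y] assms(3)[of x] by linarith
  have "(?F has_sum avg \<gamma> ?v x) UNIV" by (rule has_sum_avg[OF assms(1) b'])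
  moreover have "avg \<gamma> ?v x = avg \<gamma> u x - u x"
    using avg_diff[OF assms(1,3), where h = "\<lambda>_. u x" and x = x and B' = B] assms(3) avg_const[OF assms(1)] by simp
  ultimately show ?thesis using has_sum_unique[OF 1] by simp
qed

section \<open>The generator on coordinates and pairs\<close>

lemma finite_configs [simp]: "finite (configs N)"
  by (simp add: configs_def finite_PiE)

lemma configs_01: "\<eta> \<in> configs N \<Longrightarrow> x \<in> bulk N \<Longrightarrow> \<eta> x = 0 \<or> \<eta> x = 1"
  by (auto simp: configs_def PiE_iff)

lemma exchange_configs: "\<eta> \<in> configs N \<Longrightarrow> x \<in> bulk N \<Longrightarrow> y \<in> bulk N \<Longrightarrow> exchange x y \<eta> \<in> configs N"
  by (auto simp: configs_def exchange_def PiE_iff extensional_def)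

lemma flip_configs: "\<eta> \<in> configs N \<Longrightarrow> x \<in> bulk N \<Longrightarrow> flip x \<eta> \<in> configs N"
  by (auto simp: configs_def flip_def PiE_iff extensional_def)

lemma gen_right_eq: "gen_right \<gamma> b N f \<eta> =
    (\<Sum>x\<in>bulk N. rate_right \<gamma> N x * ((\<eta> x * (1 - b) + (1 - \<eta> x) * b) * (f (flip x \<eta>) - f \<eta>)))"
  unfolding gen_right_def rate_right_def
  by (simp add: mult.assoc infsum_cmult_left')

lemma gen_left_eq: "gen_left \<gamma> a N f \<eta> =
    (\<Sum>x\<in>bulk N. rate_left \<gamma> x * ((\<eta> x * (1 - a) + (1 - \<eta> x) * a) * (f (flip x \<eta>) - f \<eta>)))"
  unfolding gen_left_def rate_left_def
  by (simp add: mult.assoc infsum_cmult_left')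

text \<open>Exchanges and flips stay inside the finite set of configurations, so the generator is
  bounded in the sup norm there; the constant is uniform in \<open>f\<close> so that the bound can
  be iterated.\<close>

lemma generator_bound:
  assumes "0 < a" "a < 1" "0 < b" "b < 1"
  obtains K where "K \<ge> 0" "\<And>f M \<eta>. (\<And>\<zeta>. \<zeta> \<in> configs N \<Longrightarrow> \<bar>f \<zeta>\<bar> \<le> M) \<Longrightarrow> \<eta> \<in> configs N \<Longrightarrow>
    \<bar>generator \<gamma> a b N f \<eta>\<bar> \<le> K * M"
proof -
  define K where "K = (\<Sum>x\<in>bulk N. \<Sum>y\<in>bulk N. \<bar>jump \<gamma> (x - y)\<bar> * 2) +
    (\<Sum>x\<in>bulk N. \<bar>rate_right \<gamma> N x\<bar> * 2) + (\<Sum>x\<in>bulk N. \<bar>rate_left \<gamma> x\<bar> * 2)"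
  show ?thesis
  proof
    show "K \<ge> 0" unfolding K_def by (intro add_nonneg_nonneg sum_nonneg) auto
    fix f :: "config \<Rightarrow> real" and M \<eta>
    assume f: "\<And>\<zeta>. \<zeta> \<in> configs N \<Longrightarrow> \<bar>f \<zeta>\<bar> \<le> M" and \<eta>: "\<eta> \<in> configs N"
    have M: "M \<ge> 0" using f[OF \<eta>] by linarith
    have d: "\<bar>f \<zeta> - f \<eta>\<bar> \<le> 2 * M" if "\<zeta> \<in> configs N" for \<zeta>
      using f[OF that] f[OF \<eta>] by linarith
    have r: "\<bar>(\<eta> x * (1 - c) + (1 - \<eta> x) * c) * (f (flip x \<eta>) - f \<eta>)\<bar> \<le> 2 * M"
      if "x \<in> bulk N" "0 < c" "c < 1" for x c
    proof -
      have "\<bar>\<eta> x * (1 - c) + (1 - \<eta> x) * c\<bar> \<le> 1"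
        using configs_01[OF \<eta> that(1)] that by auto
      then have "\<bar>(\<eta> x * (1 - c) + (1 - \<eta> x) * c) * (f (flip x \<eta>) - f \<eta>)\<bar> \<le> 1 * (2 * M)"
        unfolding abs_mult using d[OF flip_configs[OF \<eta> that(1)]] by (intro mult_mono) auto
      then show ?thesis by simp
    qed
    have "\<bar>gen_bulk \<gamma> N f \<eta>\<bar> \<le> \<bar>\<Sum>x\<in>bulk N. \<Sum>y\<in>bulk N. jump \<gamma> (x - y) * (f (exchange x y \<eta>) - f \<eta>)\<bar>"
      unfolding gen_bulk_def by simp
    also have "\<dots> \<le> (\<Sum>x\<in>bulk N. \<Sum>y\<in>bulk N. \<bar>jump \<gamma> (x - y)\<bar> * (2 * M))"
      using d exchange_configs[OF \<eta>]
      by (intro order_trans[OF sum_abs] sum_mono) (auto simp: abs_mult intro!: mult_left_mono)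
    finally have 1: "\<bar>gen_bulk \<gamma> N f \<eta>\<bar> \<le> (\<Sum>x\<in>bulk N. \<Sum>y\<in>bulk N. \<bar>jump \<gamma> (x - y)\<bar> * (2 * M))" .
    have 2: "\<bar>gen_right \<gamma> b N f \<eta>\<bar> \<le> (\<Sum>x\<in>bulk N. \<bar>rate_right \<gamma> N x\<bar> * (2 * M))"
      unfolding gen_right_eq using r assms
      by (intro order_trans[OF sum_abs] sum_mono) (subst abs_mult, auto intro!: mult_left_mono)
    have 3: "\<bar>gen_left \<gamma> a N f \<eta>\<bar> \<le> (\<Sum>x\<in>bulk N. \<bar>rate_left \<gamma> x\<bar> * (2 * M))"
      unfolding gen_left_eq using r assms
      by (intro order_trans[OF sum_abs] sum_mono) (subst abs_mult, auto intro!: mult_left_mono)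
    have "K * M = (\<Sum>x\<in>bulk N. \<Sum>y\<in>bulk N. \<bar>jump \<gamma> (x - y)\<bar> * (2 * M)) +
       (\<Sum>x\<in>bulk N. \<bar>rate_right \<gamma> N x\<bar> * (2 * M)) + (\<Sum>x\<in>bulk N. \<bar>rate_left \<gamma> x\<bar> * (2 * M))"
      unfolding K_def by (simp add: distrib_right sum_distrib_right mult.assoc)
    then show "\<bar>generator \<gamma> a b N f \<eta>\<bar> \<le> K * M"
      unfolding generator_def using 1 2 3 by linarith
  qed
qed

text \<open>For a bounded generator the expectation of the semigroup is a power series in
  \<open>t\<close>. Invariance makes it constant for \<open>t \<ge> 0\<close>, so its first
  coefficient, the expectation of the generator, vanishes.\<close>

lemma invariant_generator:
  assumes ab: "0 < a" "a < 1" "0 < b" "b < 1" and inv: "invariant_measure \<gamma> a b N \<mu>"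
  shows "measure_pmf.expectation \<mu> (generator \<gamma> a b N f) = 0"
proof -
  have sub: "set_pmf \<mu> \<subseteq> configs N" using inv by (simp add: invariant_measure_def)
  have E: "measure_pmf.expectation \<mu> h = (\<Sum>\<eta>\<in>configs N. h \<eta> * pmf \<mu> \<eta>)" for h :: "config \<Rightarrow> real"
    using sub by (intro integral_measure_pmf_real) auto
  obtain K where K: "K \<ge> 0" "\<And>f M \<eta>. (\<And>\<zeta>. \<zeta> \<in> configs N \<Longrightarrow> \<bar>f \<zeta>\<bar> \<le> M) \<Longrightarrow> \<eta> \<in> configs N \<Longrightarrow>
    \<bar>generator \<gamma> a b N f \<eta>\<bar> \<le> K * M" using generator_bound[OF ab] by metis
  let ?G = "\<lambda>n. (generator \<gamma> a b N ^^ n) f"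
  define M where "M = (\<Sum>\<eta>\<in>configs N. \<bar>f \<eta>\<bar>)"
  have Gb: "\<eta> \<in> configs N \<Longrightarrow> \<bar>?G n \<eta>\<bar> \<le> K ^ n * M" for n \<eta>
  proof (induction n arbitrary: \<eta>)
    case 0
    then show ?case unfolding M_def by (auto intro!: member_le_sum[where f = "\<lambda>\<eta>. \<bar>f \<eta>\<bar>"])
  next
    case (Suc n)
    show ?case using K(2)[of "?G n" "K ^ n * M" \<eta>] Suc by (simp add: mult.assoc)
  qed
  have sm: "summable (\<lambda>n. t ^ n / fact n * ?G n \<eta>)" if "\<eta> \<in> configs N" for t \<eta>
  proof (rule summable_comparison_test')
    show "summable (\<lambda>n. inverse (fact n) * (\<bar>t\<bar> * K) ^ n * M)"
      by (intro summable_mult2 summable_exp)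
    show "norm (t ^ n / fact n * ?G n \<eta>) \<le> inverse (fact n) * (\<bar>t\<bar> * K) ^ n * M" for n
      using mult_left_mono[OF Gb[OF that, of n], of "\<bar>t\<bar> ^ n / fact n"]
      by (simp add: abs_mult power_abs power_mult_distrib field_simps)
  qed
  define c where "c n = measure_pmf.expectation \<mu> (?G n) / fact n" for n
  have c: "(\<lambda>n. c n * t ^ n) sums measure_pmf.expectation \<mu> (semigroup \<gamma> a b N t f)" for t
  proof -
    have "(\<lambda>n. \<Sum>\<eta>\<in>configs N. t ^ n / fact n * ?G n \<eta> * pmf \<mu> \<eta>) sums
        (\<Sum>\<eta>\<in>configs N. semigroup \<gamma> a b N t f \<eta> * pmf \<mu> \<eta>)"
      unfolding semigroup_def by (intro sums_sum sums_mult2 summable_sums sm)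
    moreover have "(\<Sum>\<eta>\<in>configs N. t ^ n / fact n * ?G n \<eta> * pmf \<mu> \<eta>) = c n * t ^ n" for n
      unfolding c_def E by (simp add: sum_distrib_left mult_ac sum_divide_distrib)
    ultimately show ?thesis unfolding E by simp
  qed
  let ?g = "\<lambda>t. \<Sum>n. c n * t ^ n"
  have const: "?g t = measure_pmf.expectation \<mu> f" if "t \<ge> 0" for t
    using c[of t] inv that by (auto simp: invariant_measure_def sums_iff)
  have "(?g has_real_derivative (\<Sum>n. diffs c n * 0 ^ n)) (at 0)"
    using c by (intro termdiffs_strong_converges_everywhere) (auto simp: sums_iff)
  \<comment> \<open>Invariance is known only for \<open>t \<ge> 0\<close>, hence the passage to the
    one-sided derivative.\<close>
  then have "(?g has_real_derivative c 1) (at 0 within {0..})"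
    by (auto simp: diffs_def powser_zero intro: has_field_derivative_at_within)
  then have lim: "((\<lambda>t. (?g t - ?g 0) / (t - 0)) \<longlongrightarrow> c 1) (at 0 within {0..})"
    unfolding has_field_derivative_iff .
  have "((\<lambda>t. 0) \<longlongrightarrow> c 1) (at (0::real) within {0..})"
    by (rule Lim_transform_eventually[OF lim]) (use const const[of 0] in \<open>auto simp: eventually_at_filter\<close>)
  moreover have "at (0::real) within {0..} \<noteq> bot"
    by (simp add: at_within_Ici_at_right)
  ultimately have "c 1 = 0" using tendsto_unique tendsto_const by blast
  then show ?thesis by (simp add: c_def)
qed

lemma sum_sum_delta:
  fixes h :: "'a \<Rightarrow> real"
  assumes "finite A" "x \<in> A"
  shows "(\<Sum>p\<in>A. \<Sum>q\<in>A. if q = x then h p else 0) = sum h A"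
    and "(\<Sum>p\<in>A. \<Sum>q\<in>A. if p = x then h q else 0) = sum h A"
proof -
  show *: "(\<Sum>p\<in>A. \<Sum>q\<in>A. if q = x then h p else 0) = sum h A"
    using assms by simp
  show "(\<Sum>p\<in>A. \<Sum>q\<in>A. if p = x then h q else 0) = sum h A"
    by (subst sum.swap) (rule *)
qed

text \<open>An exchange only transports the value at another site to \<open>x\<close>, so symmetric
  exclusion acts linearly on coordinates; each pair occurs in both orders, which absorbs the factor
  1/2. At a reservoir of density \<open>c\<close>, rate times change equals
  \<open>c - \<eta> x\<close> for both values of the occupation.\<close>

lemma generator_coord:
  assumes \<eta>: "\<eta> \<in> configs N" and x: "x \<in> bulk N"
  shows "generator \<gamma> a b N (\<lambda>\<eta>. \<eta> x) \<eta> =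
    (\<Sum>z\<in>bulk N. jump \<gamma> (x - z) * (\<eta> z - \<eta> x)) + rate_right \<gamma> N x * (b - \<eta> x) + rate_left \<gamma> x * (a - \<eta> x)"
proof -
  have "(\<Sum>p\<in>bulk N. \<Sum>q\<in>bulk N. jump \<gamma> (p - q) * (exchange p q \<eta> x - \<eta> x)) =
    (\<Sum>p\<in>bulk N. \<Sum>q\<in>bulk N. (if q = x then jump \<gamma> (x - p) * (\<eta> p - \<eta> x) else 0) +
       (if p = x then jump \<gamma> (x - q) * (\<eta> q - \<eta> x) else 0))"
    using jump_minus[of \<gamma> "x - _"]
    by (intro sum.cong refl) (auto simp: exchange_def)
  also have "\<dots> = 2 * (\<Sum>z\<in>bulk N. jump \<gamma> (x - z) * (\<eta> z - \<eta> x))"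
    using x by (simp only: sum.distrib sum_sum_delta finite_bulk)
  finally have 1: "gen_bulk \<gamma> N (\<lambda>\<eta>. \<eta> x) \<eta> = (\<Sum>z\<in>bulk N. jump \<gamma> (x - z) * (\<eta> z - \<eta> x))"
    by (simp add: gen_bulk_def)
  have res: "(\<Sum>y\<in>bulk N. R y * ((\<eta> y * (1 - c) + (1 - \<eta> y) * c) * (flip y \<eta> x - \<eta> x))) = R x * (c - \<eta> x)"
    for R :: "int \<Rightarrow> real" and c
  proof -
    have "(\<Sum>y\<in>bulk N. R y * ((\<eta> y * (1 - c) + (1 - \<eta> y) * c) * (flip y \<eta> x - \<eta> x))) =
      (\<Sum>y\<in>bulk N. if y = x then R x * (c - \<eta> x) else 0)"
      using configs_01[OF \<eta> x] by (intro sum.cong refl) (auto simp: flip_def)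
    then show ?thesis using x by simp
  qed
  show ?thesis unfolding generator_def 1 gen_right_eq gen_left_eq res by simp
qed


text \<open>Products of two coordinates close as well: an exchange of \<open>x\<close> with a third
  site moves one factor, while the exchange of \<open>x\<close> with \<open>y\<close> leaves the
  product unchanged. This is why \<open>y\<close> and \<open>x\<close> are left out of the two sums,
  and this omission is the source of the correlations.\<close>

lemma generator_pair:
  assumes \<eta>: "\<eta> \<in> configs N" and x: "x \<in> bulk N" and y: "y \<in> bulk N" and xy: "x \<noteq> y"
  shows "generator \<gamma> a b N (\<lambda>\<eta>. \<eta> x * \<eta> y) \<eta> =
    (\<Sum>z\<in>bulk N - {y}. jump \<gamma> (x - z) * (\<eta> z * \<eta> y - \<eta> x * \<eta> y)) +
    (\<Sum>z\<in>bulk N - {x}. jump \<gamma> (y - z) * (\<eta> x * \<eta> z - \<eta> x * \<eta> y)) +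
    rate_right \<gamma> N x * (b * \<eta> y - \<eta> x * \<eta> y) + rate_left \<gamma> x * (a * \<eta> y - \<eta> x * \<eta> y) +
    rate_right \<gamma> N y * (b * \<eta> x - \<eta> x * \<eta> y) + rate_left \<gamma> y * (a * \<eta> x - \<eta> x * \<eta> y)"
proof -
  let ?h = "\<lambda>z. if z = y then 0 else jump \<gamma> (x - z) * (\<eta> z * \<eta> y - \<eta> x * \<eta> y)"
  let ?k = "\<lambda>z. if z = x then 0 else jump \<gamma> (y - z) * (\<eta> x * \<eta> z - \<eta> x * \<eta> y)"
  have sym: "jump \<gamma> (p - q) = jump \<gamma> (q - p)" for p q using jump_minus[of \<gamma> "p - q"] by simp
  have "(\<Sum>p\<in>bulk N. \<Sum>q\<in>bulk N. jump \<gamma> (p - q) * (exchange p q \<eta> x * exchange p q \<eta> y - \<eta> x * \<eta> y)) =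
    (\<Sum>p\<in>bulk N. \<Sum>q\<in>bulk N. (if q = x then ?h p else 0) + (if p = x then ?h q else 0)
      + (if q = y then ?k p else 0) + (if p = y then ?k q else 0))"
    using sym xy by (intro sum.cong refl) (auto simp: exchange_def)
  also have "\<dots> = 2 * (sum ?h (bulk N) + sum ?k (bulk N))"
    unfolding sum.distrib sum_sum_delta[OF finite_bulk x] sum_sum_delta[OF finite_bulk y] by simp
  also have "sum ?h (bulk N) = (\<Sum>z\<in>bulk N - {y}. jump \<gamma> (x - z) * (\<eta> z * \<eta> y - \<eta> x * \<eta> y))"
    by (intro sum.mono_neutral_cong_right) auto
  also have "sum ?k (bulk N) = (\<Sum>z\<in>bulk N - {x}. jump \<gamma> (y - z) * (\<eta> x * \<eta> z - \<eta> x * \<eta> y))"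
    by (intro sum.mono_neutral_cong_right) auto
  finally have 1: "gen_bulk \<gamma> N (\<lambda>\<eta>. \<eta> x * \<eta> y) \<eta> =
     (\<Sum>z\<in>bulk N - {y}. jump \<gamma> (x - z) * (\<eta> z * \<eta> y - \<eta> x * \<eta> y)) +
     (\<Sum>z\<in>bulk N - {x}. jump \<gamma> (y - z) * (\<eta> x * \<eta> z - \<eta> x * \<eta> y))"
    by (simp add: gen_bulk_def)
  have res: "(\<Sum>p\<in>bulk N. R p * ((\<eta> p * (1 - c) + (1 - \<eta> p) * c) * (flip p \<eta> x * flip p \<eta> y - \<eta> x * \<eta> y)))
     = R x * (c * \<eta> y - \<eta> x * \<eta> y) + R y * (c * \<eta> x - \<eta> x * \<eta> y)"
    for R :: "int \<Rightarrow> real" and c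
  proof -
    have "(\<Sum>p\<in>bulk N. R p * ((\<eta> p * (1 - c) + (1 - \<eta> p) * c) * (flip p \<eta> x * flip p \<eta> y - \<eta> x * \<eta> y))) =
      (\<Sum>p\<in>bulk N. (if p = x then R x * (c * \<eta> y - \<eta> x * \<eta> y) else 0) +
          (if p = y then R y * (c * \<eta> x - \<eta> x * \<eta> y) else 0))"
      using configs_01[OF \<eta> x] configs_01[OF \<eta> y] xy by (intro sum.cong refl) (auto simp: flip_def)
    then show ?thesis using x y by (simp add: sum.distrib)
  qed
  show ?thesis unfolding generator_def 1 gen_right_eq gen_left_eq res by simp
qed

lemma antisym_sum_zero:
  fixes F :: "'a \<Rightarrow> 'a \<Rightarrow> real"
  assumes "\<And>x z. F x z = - F z x"
  shows "(\<Sum>x\<in>A. \<Sum>z\<in>A. F x z) = 0"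
proof -
  have "(\<Sum>x\<in>A. \<Sum>z\<in>A. F x z) = (\<Sum>x\<in>A. \<Sum>z\<in>A. F z x)" by (rule sum.swap)
  also have "\<dots> = - (\<Sum>x\<in>A. \<Sum>z\<in>A. F x z)" by (subst assms) (simp add: sum_negf)
  finally show ?thesis by simp
qed

section \<open>Mean and covariance under the invariant measure\<close>

locale stationary_exclusion =
  fixes \<gamma> a b :: real and N :: nat and \<mu> :: "config pmf"
  assumes \<gamma>: "1 < \<gamma>" and a: "0 < a" "a < 1" and b: "0 < b" "b < 1" and N: "N > 0"
    and inv: "invariant_measure \<gamma> a b N \<mu>"
begin

abbreviation "E \<equiv> measure_pmf.expectation \<mu>"

definition mean :: "int \<Rightarrow> real" where "mean x = E (\<lambda>\<eta>. \<eta> x)"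

definition cov :: "int \<Rightarrow> int \<Rightarrow> real" where "cov x y = E (\<lambda>\<eta>. \<eta> x * \<eta> y) - mean x * mean y"

text \<open>The reservoir values are built in so that stationarity of the means becomes plain
  harmonicity on the bulk.\<close>

definition profile :: "int \<Rightarrow> real" where
  "profile y = (if y \<le> 0 then a else if y \<ge> int N then b else mean y)"

abbreviation "rate x \<equiv> rate_right \<gamma> N x + rate_left \<gamma> x"

lemma \<gamma>0: "\<gamma> > 0" using \<gamma> by simp

lemma set_pmf_configs: "set_pmf \<mu> \<subseteq> configs N" using inv by (simp add: invariant_measure_def)

lemma integrable [simp]: "integrable (measure_pmf \<mu>) (f :: config \<Rightarrow> real)"
  using finite_subset[OF set_pmf_configs] by (intro integrable_measure_pmf_finite) simp

lemma E_cong: "(\<And>\<eta>. \<eta> \<in> configs N \<Longrightarrow> f \<eta> = g \<eta>) \<Longrightarrow> E f = (E g :: real)"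
  using set_pmf_configs by (intro integral_cong_AE) (auto simp: AE_measure_pmf_iff)

lemma E_mono: "(\<And>\<eta>. \<eta> \<in> configs N \<Longrightarrow> f \<eta> \<le> g \<eta>) \<Longrightarrow> E f \<le> (E g :: real)"
  using set_pmf_configs by (intro integral_mono_AE) (auto simp: AE_measure_pmf_iff)

lemma mean_bounds: "x \<in> bulk N \<Longrightarrow> 0 \<le> mean x \<and> mean x \<le> 1"
  using E_mono[of "\<lambda>_. 0" "\<lambda>\<eta>. \<eta> x"] E_mono[of "\<lambda>\<eta>. \<eta> x" "\<lambda>_. 1"] configs_01[of _ N x]
  unfolding mean_def by force

lemma mean_equation:
  assumes x: "x \<in> bulk N"
  shows "(\<Sum>z\<in>bulk N. jump \<gamma> (x - z) * (mean z - mean x)) + rate_right \<gamma> N x * (b - mean x) +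
    rate_left \<gamma> x * (a - mean x) = 0"
proof -
  have "0 = E (generator \<gamma> a b N (\<lambda>\<eta>. \<eta> x))" using invariant_generator[OF a b inv] by simp
  also have "\<dots> = E (\<lambda>\<eta>. (\<Sum>z\<in>bulk N. jump \<gamma> (x - z) * (\<eta> z - \<eta> x)) + rate_right \<gamma> N x * (b - \<eta> x) +
    rate_left \<gamma> x * (a - \<eta> x))"
    using generator_coord x by (intro E_cong)
  also have "\<dots> = (\<Sum>z\<in>bulk N. jump \<gamma> (x - z) * (mean z - mean x)) + rate_right \<gamma> N x * (b - mean x) +
    rate_left \<gamma> x * (a - mean x)"
    by (simp add: mean_def)
  finally show ?thesis by simp
qed

lemma profile_bounded: "\<bar>profile y\<bar> \<le> 1"
  using mean_bounds[of y] a b by (auto simp: profile_def bulk_def)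

lemma profile_harmonic:
  assumes x: "x \<in> bulk N"
  shows "avg \<gamma> profile x = profile x"
proof -
  have bulk: "profile z = mean z" if "z \<in> bulk N" for z using that by (auto simp: profile_def bulk_def)
  have "avg \<gamma> profile x - profile x = (\<Sum>z\<in>bulk N. jump \<gamma> (x - z) * (profile z - profile x)) +
    rate_right \<gamma> N x * (b - profile x) + rate_left \<gamma> x * (a - profile x)"
    using N by (intro avg_minus_self_reservoirs[OF \<gamma>0 N profile_bounded]) (auto simp: profile_def)
  also have "\<dots> = 0" using mean_equation[OF x] by (simp add: bulk x)
  finally show ?thesis by simp
qed

text \<open>The product of the means obeys the same pair equation, except that its one-site sums
  include the bond joining \<open>x\<close> and \<open>y\<close>, which is absent for the pair. The
  two extra terms combine to the square on the right. The left side is the generator of two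
  exclusion particles, killed at the reservoirs, and never involves the diagonal
  \<open>cov x x\<close>.\<close>

lemma cov_equation:
  assumes x: "x \<in> bulk N" and y: "y \<in> bulk N" and xy: "x \<noteq> y"
  shows "(\<Sum>z\<in>bulk N - {y}. jump \<gamma> (x - z) * (cov z y - cov x y)) +
    (\<Sum>z\<in>bulk N - {x}. jump \<gamma> (y - z) * (cov x z - cov x y)) - (rate x + rate y) * cov x y
    = jump \<gamma> (x - y) * (mean x - mean y)\<^sup>2"
proof -
  let ?P = "\<lambda>x y. E (\<lambda>\<eta>. \<eta> x * \<eta> y)"
  have "0 = E (generator \<gamma> a b N (\<lambda>\<eta>. \<eta> x * \<eta> y))" using invariant_generator[OF a b inv] by simp
  also have "\<dots> = E (\<lambda>\<eta>. (\<Sum>z\<in>bulk N - {y}. jump \<gamma> (x - z) * (\<eta> z * \<eta> y - \<eta> x * \<eta> y)) +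
    (\<Sum>z\<in>bulk N - {x}. jump \<gamma> (y - z) * (\<eta> x * \<eta> z - \<eta> x * \<eta> y)) +
    rate_right \<gamma> N x * (b * \<eta> y - \<eta> x * \<eta> y) + rate_left \<gamma> x * (a * \<eta> y - \<eta> x * \<eta> y) +
    rate_right \<gamma> N y * (b * \<eta> x - \<eta> x * \<eta> y) + rate_left \<gamma> y * (a * \<eta> x - \<eta> x * \<eta> y))"
    using generator_pair x y xy by (intro E_cong)
  also have "\<dots> = (\<Sum>z\<in>bulk N - {y}. jump \<gamma> (x - z) * (?P z y - ?P x y)) +
    (\<Sum>z\<in>bulk N - {x}. jump \<gamma> (y - z) * (?P x z - ?P x y)) +
    rate_right \<gamma> N x * (b * mean y - ?P x y) + rate_left \<gamma> x * (a * mean y - ?P x y) +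
    rate_right \<gamma> N y * (b * mean x - ?P x y) + rate_left \<gamma> y * (a * mean x - ?P x y)"
    by (simp add: mean_def)
  also have "(\<Sum>z\<in>bulk N - {y}. jump \<gamma> (x - z) * (?P z y - ?P x y)) =
     (\<Sum>z\<in>bulk N - {y}. jump \<gamma> (x - z) * (cov z y - cov x y)) +
     (\<Sum>z\<in>bulk N - {y}. jump \<gamma> (x - z) * (mean z - mean x)) * mean y"
    unfolding sum_distrib_right sum.distrib[symmetric]
    by (intro sum.cong refl) (simp add: cov_def algebra_simps)
  also have "(\<Sum>z\<in>bulk N - {x}. jump \<gamma> (y - z) * (?P x z - ?P x y)) =
     (\<Sum>z\<in>bulk N - {x}. jump \<gamma> (y - z) * (cov x z - cov x y)) +
     (\<Sum>z\<in>bulk N - {x}. jump \<gamma> (y - z) * (mean z - mean y)) * mean x"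
    unfolding sum_distrib_right sum.distrib[symmetric]
    by (intro sum.cong refl) (simp add: cov_def algebra_simps)
  also have "(\<Sum>z\<in>bulk N - {y}. jump \<gamma> (x - z) * (mean z - mean x)) =
    - (rate_right \<gamma> N x * (b - mean x) + rate_left \<gamma> x * (a - mean x)) - jump \<gamma> (x - y) * (mean y - mean x)"
    using mean_equation[OF x] y by (simp add: sum_diff1)
  also have "(\<Sum>z\<in>bulk N - {x}. jump \<gamma> (y - z) * (mean z - mean y)) =
    - (rate_right \<gamma> N y * (b - mean y) + rate_left \<gamma> y * (a - mean y)) - jump \<gamma> (x - y) * (mean x - mean y)"
    using mean_equation[OF y] x jump_minus[of \<gamma> "x - y"] by (simp add: sum_diff1)
  finally show ?thesis
    by (simp add: cov_def algebra_simps power2_eq_square)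
qed

lemma rate_pos: "x \<in> bulk N \<Longrightarrow> kill \<gamma> * real N powr (- \<gamma>) \<le> rate x"
proof -
  assume x: "x \<in> bulk N"
  then have "int N - x \<in> bulk N" by (auto simp: bulk_def)
  then have "kill \<gamma> * real N powr (- \<gamma>) \<le> rate_right \<gamma> N x"
    unfolding rate_right_reflect by (rule rate_left_ge[OF \<gamma>0])
  moreover have "0 \<le> rate_left \<gamma> x"
    unfolding rate_left_def using jump_nonneg[OF \<gamma>0] by (intro infsum_nonneg)
  ultimately show ?thesis by simp
qed

lemma kill_N_pos: "kill \<gamma> * real N powr (- \<gamma>) > 0"
  using kill_pos[OF \<gamma>0] N by simp

section \<open>Sign and total mass of the covariances\<close>

text \<open>At a positive maximum over distinct pairs the exchange terms are nonpositive and the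
  killing term is strictly negative, against a nonnegative right side.\<close>

lemma cov_nonpos:
  assumes x: "x \<in> bulk N" and y: "y \<in> bulk N" and xy: "x \<noteq> y"
  shows "cov x y \<le> 0"
proof (rule ccontr)
  assume pos: "\<not> cov x y \<le> 0"
  define S where "S = {(p, q). p \<in> bulk N \<and> q \<in> bulk N \<and> p \<noteq> q}"
  have "S \<subseteq> bulk N \<times> bulk N" by (auto simp: S_def)
  then have fin: "finite S" by (rule finite_subset) simp
  let ?c = "\<lambda>(p, q). cov p q"
  have xyS: "(x, y) \<in> S" using assms by (simp add: S_def)
  then have "Max (?c ` S) \<in> ?c ` S" using fin by (intro Max_in) auto
  then obtain p q where pq: "(p, q) \<in> S" "cov p q = Max (?c ` S)" by force
  then have mx: "cov p' q' \<le> cov p q" if "(p', q') \<in> S" for p' q'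
    using fin that by (auto intro!: Max_ge)
  have pqS: "p \<in> bulk N" "q \<in> bulk N" "p \<noteq> q" using pq by (auto simp: S_def)
  have c: "cov p q > 0" using mx[OF xyS] pos by simp
  have "(\<Sum>z\<in>bulk N - {q}. jump \<gamma> (p - z) * (cov z q - cov p q)) \<le> 0"
    using mx pqS jump_nonneg[OF \<gamma>0] by (intro sum_nonpos mult_nonneg_nonpos) (auto simp: S_def)
  moreover have "(\<Sum>z\<in>bulk N - {p}. jump \<gamma> (q - z) * (cov p z - cov p q)) \<le> 0"
    using mx pqS jump_nonneg[OF \<gamma>0] by (intro sum_nonpos mult_nonneg_nonpos) (auto simp: S_def)
  moreover have "(rate p + rate q) * cov p q > 0"
    using rate_pos[OF pqS(1)] rate_pos[OF pqS(2)] kill_N_pos c by (intro mult_pos_pos) linarith+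
  moreover have "0 \<le> jump \<gamma> (p - q) * (mean p - mean q)\<^sup>2" using jump_nonneg[OF \<gamma>0] by simp
  ultimately show False using cov_equation[OF pqS] by linarith
qed

text \<open>The bound of \<open>rate_sum_le\<close> for the total reservoir rate; it depends on
  \<gamma> alone.\<close>

definition "total_rate = 4 * c_const \<gamma> * (\<Sum>n. real (n + 1) powr (- \<gamma>))"

text \<open>Summation by parts:
  \<open>(mean x - mean y)\<^sup>2 + 2 * (mean y - mean x) * mean x\<close> is antisymmetric in
  \<open>x\<close> and \<open>y\<close>, so the energy is twice the sum of \<open>mean x\<close>
  times the reservoir terms of the mean equation. Each such term is at most the corresponding rate,
  since all densities lie in the unit interval.\<close>

lemma energy_le: "(\<Sum>x\<in>bulk N. \<Sum>y\<in>bulk N. jump \<gamma> (x - y) * (mean x - mean y)\<^sup>2) \<le> 2 * total_rate"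
proof -
  have sym: "jump \<gamma> (p - q) = jump \<gamma> (q - p)" for p q using jump_minus[of \<gamma> "p - q"] by simp
  have "(\<Sum>x\<in>bulk N. \<Sum>y\<in>bulk N. jump \<gamma> (x - y) * (mean x - mean y)\<^sup>2) +
      2 * (\<Sum>x\<in>bulk N. \<Sum>y\<in>bulk N. jump \<gamma> (x - y) * (mean y - mean x) * mean x)
    = (\<Sum>x\<in>bulk N. \<Sum>y\<in>bulk N. jump \<gamma> (x - y) * ((mean y)\<^sup>2 - (mean x)\<^sup>2))"
    unfolding sum_distrib_left sum.distrib[symmetric]
    by (intro sum.cong refl) (simp add: algebra_simps power2_eq_square)
  also have "\<dots> = 0"
    by (rule antisym_sum_zero, subst sym) (simp add: algebra_simps)
  finally have "(\<Sum>x\<in>bulk N. \<Sum>y\<in>bulk N. jump \<gamma> (x - y) * (mean x - mean y)\<^sup>2) =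
      2 * (\<Sum>x\<in>bulk N. - (\<Sum>y\<in>bulk N. jump \<gamma> (x - y) * (mean y - mean x)) * mean x)"
    by (simp add: sum_negf sum_distrib_right)
  also have "\<dots> \<le> 2 * (\<Sum>x\<in>bulk N. rate_left \<gamma> x + rate_right \<gamma> N x)"
  proof (intro mult_left_mono sum_mono)
    fix x assume x: "x \<in> bulk N"
    have r: "0 \<le> rate_left \<gamma> x" "0 \<le> rate_right \<gamma> N x"
      unfolding rate_left_def rate_right_def using jump_nonneg[OF \<gamma>0] by (auto intro!: infsum_nonneg)
    have "(\<Sum>y\<in>bulk N. jump \<gamma> (x - y) * (mean y - mean x)) =
       - (rate_right \<gamma> N x * (b - mean x) + rate_left \<gamma> x * (a - mean x))"
      using mean_equation[OF x] by linarith
    then have "- (\<Sum>y\<in>bulk N. jump \<gamma> (x - y) * (mean y - mean x)) * mean x =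
       rate_left \<gamma> x * ((a - mean x) * mean x) + rate_right \<gamma> N x * ((b - mean x) * mean x)"
      by (simp only:) (simp add: algebra_simps)
    moreover have "(c - mean x) * mean x \<le> 1" if "0 < c" "c < 1" for c
    proof (cases "c \<le> mean x")
      case True
      then have "(c - mean x) * mean x \<le> 0" using mean_bounds[OF x] by (intro mult_nonpos_nonneg) auto
      then show ?thesis by simp
    next
      case False
      then show ?thesis using mean_bounds[OF x] that by (intro mult_le_one) auto
    qed
    ultimately show "- (\<Sum>y\<in>bulk N. jump \<gamma> (x - y) * (mean y - mean x)) * mean x \<le>
        rate_left \<gamma> x + rate_right \<gamma> N x"
      using r a b mult_left_mono[of "(a - mean x) * mean x" 1 "rate_left \<gamma> x"]
        mult_left_mono[of "(b - mean x) * mean x" 1 "rate_right \<gamma> N x"] by fastforce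
  qed simp
  also have "\<dots> \<le> 2 * total_rate" unfolding total_rate_def by (intro mult_left_mono rate_sum_le[OF \<gamma>]) simp
  finally show ?thesis .
qed

text \<open>Summed over distinct pairs, the exchange terms of the covariance equation cancel, so the
  killed mass equals the total source. As all these covariances have one sign, killing at rate at
  least \<open>?\<kappa>\<close> per coordinate bounds the sum of their absolute values.\<close>

lemma sum_cov_le:
  "(\<Sum>x\<in>bulk N. \<Sum>y\<in>bulk N - {x}. \<bar>cov x y\<bar>) \<le> total_rate * real N powr \<gamma> / kill \<gamma>"
proof -
  let ?\<kappa> = "kill \<gamma> * real N powr (- \<gamma>)"
  let ?S = "\<lambda>F. \<Sum>x\<in>bulk N. \<Sum>y\<in>bulk N - {x}. F x y"
  have swap: "?S F = (\<Sum>y\<in>bulk N. \<Sum>x\<in>bulk N - {y}. F x y)" for F :: "int \<Rightarrow> int \<Rightarrow> real"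
  proof -
    have "?S F = (\<Sum>x\<in>bulk N. \<Sum>y\<in>bulk N. if x = y then 0 else F x y)"
      by (intro sum.cong sum.mono_neutral_cong_left refl) auto
    also have "\<dots> = (\<Sum>y\<in>bulk N. \<Sum>x\<in>bulk N. if x = y then 0 else F x y)" by (rule sum.swap)
    also have "\<dots> = (\<Sum>y\<in>bulk N. \<Sum>x\<in>bulk N - {y}. F x y)"
      by (intro sum.cong sum.mono_neutral_cong_right refl) auto
    finally show ?thesis .
  qed
  have sym: "jump \<gamma> (p - q) = jump \<gamma> (q - p)" for p q using jump_minus[of \<gamma> "p - q"] by simp
  have anti: "jump \<gamma> (x - z) * (u - v) = - (jump \<gamma> (z - x) * (v - u))" for x z u v
    by (subst sym) (simp add: algebra_simps)
  \<comment> \<open>With \<open>y\<close> fixed, \<open>x\<close> and \<open>z\<close> range over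
    the same set \<open>bulk N - {y}\<close> and the summand is antisymmetric in them; so the sum
    over \<open>y\<close> is first moved outside.\<close>
  have z1: "?S (\<lambda>x y. \<Sum>z\<in>bulk N - {y}. jump \<gamma> (x - z) * (cov z y - cov x y)) = 0"
    by (subst swap) (intro sum.neutral ballI antisym_sum_zero anti)
  have z2: "?S (\<lambda>x y. \<Sum>z\<in>bulk N - {x}. jump \<gamma> (y - z) * (cov x z - cov x y)) = 0"
    by (intro sum.neutral ballI antisym_sum_zero anti)
  have "2 * ?\<kappa> * ?S (\<lambda>x y. \<bar>cov x y\<bar>) = ?S (\<lambda>x y. (?\<kappa> + ?\<kappa>) * - cov x y)"
    using cov_nonpos by (simp add: sum_distrib_left abs_of_nonpos algebra_simps)
  also have "\<dots> \<le> ?S (\<lambda>x y. (rate x + rate y) * - cov x y)"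
    using rate_pos cov_nonpos by (intro sum_mono mult_right_mono add_mono) auto
  also have "\<dots> = ?S (\<lambda>x y. (\<Sum>z\<in>bulk N - {y}. jump \<gamma> (x - z) * (cov z y - cov x y)) +
    (\<Sum>z\<in>bulk N - {x}. jump \<gamma> (y - z) * (cov x z - cov x y)) - (rate x + rate y) * cov x y)"
    unfolding sum.distrib sum_subtractf z1 z2 by (simp add: sum_negf)
  also have "\<dots> = ?S (\<lambda>x y. jump \<gamma> (x - y) * (mean x - mean y)\<^sup>2)"
    by (intro sum.cong refl cov_equation) auto
  also have "\<dots> \<le> (\<Sum>x\<in>bulk N. \<Sum>y\<in>bulk N. jump \<gamma> (x - y) * (mean x - mean y)\<^sup>2)"
    using jump_nonneg[OF \<gamma>0] by (intro sum_mono sum_mono2) auto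
  also have "\<dots> \<le> 2 * total_rate" by (rule energy_le)
  finally have "?\<kappa> * ?S (\<lambda>x y. \<bar>cov x y\<bar>) \<le> total_rate" by simp
  then show ?thesis using kill_pos[OF \<gamma>0] N by (simp add: powr_minus field_simps)
qed

text \<open>On the diagonal each covariance is a Bernoulli variance, at most 1, which gives the term
  \<open>real N\<close>; off the diagonal only the total mass enters.\<close>

lemma variance_le:
  assumes h: "\<And>x. x \<in> bulk N \<Longrightarrow> \<bar>h x\<bar> \<le> B"
  shows "E (\<lambda>\<eta>. ((\<Sum>x\<in>bulk N. h x * \<eta> x) - (\<Sum>x\<in>bulk N. h x * mean x))\<^sup>2) \<le>
    B\<^sup>2 * (real N + total_rate * real N powr \<gamma> / kill \<gamma>)"
proof -
  have "E (\<lambda>\<eta>. ((\<Sum>x\<in>bulk N. h x * \<eta> x) - (\<Sum>x\<in>bulk N. h x * mean x))\<^sup>2) =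
     E (\<lambda>\<eta>. \<Sum>x\<in>bulk N. \<Sum>y\<in>bulk N. h x * h y * ((\<eta> x - mean x) * (\<eta> y - mean y)))"
    unfolding power2_eq_square sum_subtractf[symmetric] sum_product
    by (intro E_cong sum.cong refl) (simp add: algebra_simps)
  also have "\<dots> = (\<Sum>x\<in>bulk N. \<Sum>y\<in>bulk N. h x * h y * E (\<lambda>\<eta>. (\<eta> x - mean x) * (\<eta> y - mean y)))"
    by simp
  also have "\<dots> = (\<Sum>x\<in>bulk N. \<Sum>y\<in>bulk N. h x * h y * cov x y)"
  proof (intro sum.cong refl arg_cong2[where f = "(*)"])
    fix x y
    show "E (\<lambda>\<eta>. (\<eta> x - mean x) * (\<eta> y - mean y)) = cov x y"
      by (simp add: left_diff_distrib right_diff_distrib cov_def mean_def[symmetric])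
  qed
  also have "\<dots> \<le> (\<Sum>x\<in>bulk N. \<Sum>y\<in>bulk N. B\<^sup>2 * \<bar>cov x y\<bar>)"
  proof (intro sum_mono)
    fix x y assume xy: "x \<in> bulk N" "y \<in> bulk N"
    have "h x * h y * cov x y \<le> \<bar>h x\<bar> * \<bar>h y\<bar> * \<bar>cov x y\<bar>"
      by (metis abs_ge_self abs_mult)
    also have "\<dots> \<le> B * B * \<bar>cov x y\<bar>"
      using h[OF xy(1)] h[OF xy(2)] by (intro mult_mono) auto
    finally show "h x * h y * cov x y \<le> B\<^sup>2 * \<bar>cov x y\<bar>" by (simp add: power2_eq_square)
  qed
  also have "\<dots> = B\<^sup>2 * (\<Sum>x\<in>bulk N. \<bar>cov x x\<bar> + (\<Sum>y\<in>bulk N - {x}. \<bar>cov x y\<bar>))"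
    by (simp add: sum_distrib_left[symmetric] sum.remove[of "bulk N" _ "\<lambda>y. \<bar>cov _ y\<bar>"])
  also have "\<dots> \<le> B\<^sup>2 * (real N + total_rate * real N powr \<gamma> / kill \<gamma>)"
  proof (intro mult_left_mono)
    have "\<bar>cov x x\<bar> \<le> 1" if "x \<in> bulk N" for x
    proof -
      have "E (\<lambda>\<eta>. \<eta> x * \<eta> x) = mean x"
        unfolding mean_def using configs_01[of _ N x] that by (intro E_cong) auto
      then have "cov x x = mean x * (1 - mean x)" by (simp add: cov_def algebra_simps)
      then show ?thesis using mean_bounds[OF that] by (auto simp: abs_mult intro!: mult_le_one)
    qed
    then have "(\<Sum>x\<in>bulk N. \<bar>cov x x\<bar>) \<le> (\<Sum>x\<in>bulk N. 1)" by (intro sum_mono) auto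
    also have "\<dots> \<le> real N" by (simp add: bulk_def)
    finally show "(\<Sum>x\<in>bulk N. \<bar>cov x x\<bar> + (\<Sum>y\<in>bulk N - {x}. \<bar>cov x y\<bar>)) \<le>
        real N + total_rate * real N powr \<gamma> / kill \<gamma>"
      using sum_cov_le by (simp add: sum.distrib)
  qed simp
  finally show ?thesis .
qed

end

section \<open>Discretisation of the fractional Laplacian\<close>

text \<open>Transfers the gauge integrals of powers to Lebesgue integrals; nonnegativity makes the
  convergence absolute.\<close>

lemma nonneg_has_integral_lborel:
  fixes f :: "real \<Rightarrow> real"
  assumes [measurable]: "f \<in> borel_measurable borel" "S \<in> sets borel"
    and "\<And>x. x \<in> S \<Longrightarrow> 0 \<le> f x" and "(f has_integral I) S"
  shows "set_integrable lborel S f" "(LINT x:S|lborel. f x) = I"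
proof -
  have I: "I \<ge> 0" using has_integral_nonneg[OF assms(4,3)] .
  have "(\<integral>\<^sup>+x. ennreal (indicator S x * f x) \<partial>lborel) = ennreal I"
    using nn_integral_has_integral_lebesgue[OF assms(3,4)] .
  moreover have "(\<lambda>x. indicator S x * f x) \<in> borel_measurable lborel" by measurable
  moreover have "AE x in lborel. 0 \<le> indicator S x * f x"
    using assms(3) by (auto simp: indicator_def)
  ultimately have "integrable lborel (\<lambda>x. indicator S x * f x) \<and> (\<integral>x. indicator S x * f x \<partial>lborel) = I"
    using nn_integral_eq_integrable I by blast
  then show "set_integrable lborel S f" "(LINT x:S|lborel. f x) = I"
    by (auto simp: set_integrable_def set_lebesgue_integral_def)
qed

lemma powr_integral_from_0:
  fixes a c :: real
  assumes "a > -1" "c \<ge> 0"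
  shows "set_integrable lborel {0<..c} (\<lambda>x. x powr a)"
    "(LINT x:{0<..c}|lborel. x powr a) = c powr (a + 1) / (a + 1)"
proof -
  have "((\<lambda>x. x powr a) has_integral (c powr (a + 1) / (a + 1))) {0..c}"
    using assms by (rule has_integral_powr_from_0)
  then have "((\<lambda>x. x powr a) has_integral (c powr (a + 1) / (a + 1))) {0<..c}"
    by (subst has_integral_spike_set_eq[where T = "{0..c}"])
      (rule negligible_subset[of "{0}"]; auto)+
  then show "set_integrable lborel {0<..c} (\<lambda>x. x powr a)"
    "(LINT x:{0<..c}|lborel. x powr a) = c powr (a + 1) / (a + 1)"
    using nonneg_has_integral_lborel[of "\<lambda>x. x powr a" "{0<..c}"] by auto
qed

lemma powr_integrable_to_inf:
  fixes a c :: real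
  assumes "a < -1" "c > 0"
  shows "set_integrable lborel {c..} (\<lambda>x. x powr a)"
  using nonneg_has_integral_lborel(1)[OF _ _ _ has_integral_powr_to_inf[OF assms]] by auto

lemma square_mult_powr: "s > 0 \<Longrightarrow> s\<^sup>2 * s powr e = s powr (2 + e)" for s :: real
  by (simp add: powr_add)

locale bounded_C2 =
  fixes h h' h'' :: "real \<Rightarrow> real" and C B :: real
  assumes deriv: "\<And>q. (h has_real_derivative h' q) (at q)"
    and deriv2: "\<And>q. (h' has_real_derivative h'' q) (at q)"
    and bound: "\<And>q. \<bar>h q\<bar> \<le> B" and bound2: "\<And>q. \<bar>h'' q\<bar> \<le> C"
begin

text \<open>The symmetric second difference turns the principal value into an absolutely convergent
  integral: it is at most \<open>C * s\<^sup>2\<close> near 0 and at most \<open>4 * B\<close> far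
  away.\<close>

definition sdiff :: "real \<Rightarrow> real \<Rightarrow> real" where "sdiff y s = h (y + s) + h (y - s) - 2 * h y"

lemma C_nonneg: "0 \<le> C" using bound2[of 0] by linarith

lemma B_nonneg: "0 \<le> B" using bound[of 0] by linarith

lemma h'_lipschitz: "\<bar>h' (y + s) - h' (y - s)\<bar> \<le> 2 * C * s" if "s \<ge> 0"
proof (cases "s = 0")
  case False
  then have "y - s < y + s" using that by simp
  from MVT2[OF this, of h' h''] deriv2 obtain z where
    "h' (y + s) - h' (y - s) = ((y + s) - (y - s)) * h'' z" by auto
  then have "\<bar>h' (y + s) - h' (y - s)\<bar> = 2 * s * \<bar>h'' z\<bar>" using that by (simp add: abs_mult)
  also have "\<dots> \<le> 2 * s * C" using bound2[of z] that by (intro mult_left_mono) auto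
  finally show ?thesis by (simp only: mult_ac)
qed simp

lemma sdiff_deriv: "(sdiff y has_real_derivative (h' (y + s) - h' (y - s))) (at s)"
proof -
  have "((\<lambda>s. h (y + s)) has_real_derivative h' (y + s) * 1) (at s)"
    by (rule DERIV_chain2[OF deriv]) (auto intro!: derivative_eq_intros)
  moreover have "((\<lambda>s. h (y - s)) has_real_derivative h' (y - s) * (-1)) (at s)"
    by (rule DERIV_chain2[OF deriv]) (auto intro!: derivative_eq_intros)
  ultimately show ?thesis unfolding sdiff_def
    by (auto intro!: derivative_eq_intros)
qed

text \<open>\<open>C * s\<^sup>2\<close> plus or minus \<open>sdiff y s\<close> vanishes at
  \<open>s = 0\<close> and is nondecreasing, by the Lipschitz bound for \<open>h'\<close>.\<close>

lemma sdiff_bound: "\<bar>sdiff y s\<bar> \<le> C * s\<^sup>2" if s: "s \<ge> 0"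
proof -
  have "(\<lambda>s. C * s\<^sup>2 + \<sigma> * sdiff y s) 0 \<le> (\<lambda>s. C * s\<^sup>2 + \<sigma> * sdiff y s) s"
    if \<sigma>: "\<bar>\<sigma>\<bar> = 1" for \<sigma>
  proof (rule DERIV_nonneg_imp_nondecreasing[OF s])
    fix x :: real assume x: "0 \<le> x" "x \<le> s"
    have "((\<lambda>s. C * s\<^sup>2 + \<sigma> * sdiff y s) has_real_derivative
        C * (2 * x) + \<sigma> * (h' (y + x) - h' (y - x))) (at x)"
      by (auto intro!: derivative_eq_intros sdiff_deriv)
    moreover have "\<bar>\<sigma> * (h' (y + x) - h' (y - x))\<bar> \<le> 2 * C * x"
      using h'_lipschitz[OF x(1), of y] \<sigma> by (simp add: abs_mult)
    then have "0 \<le> C * (2 * x) + \<sigma> * (h' (y + x) - h' (y - x))" by linarith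
    ultimately show "\<exists>y'. ((\<lambda>s. C * s\<^sup>2 + \<sigma> * sdiff y s) has_real_derivative y') (at x) \<and> 0 \<le> y'"
      by blast
  qed
  from this[of 1] this[of "-1"] show ?thesis by (simp add: sdiff_def)
qed

lemma sdiff_bound': "\<bar>sdiff y s\<bar> \<le> 4 * B"
  using bound[of "y + s"] bound[of "y - s"] bound[of y] unfolding sdiff_def by linarith

lemma h_continuous: "continuous_on A h"
  using deriv by (meson DERIV_isCont continuous_at_imp_continuous_on)

lemma h_measurable [measurable]: "h \<in> borel_measurable borel"
  by (intro borel_measurable_continuous_onI h_continuous)

lemma sdiff_measurable [measurable]: "sdiff y \<in> borel_measurable borel"
  unfolding sdiff_def[abs_def] by measurable

text \<open>Integrand of minus the fractional Laplacian up to \<open>c_const \<gamma>\<close>, with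
  the points \<open>y + s\<close> and \<open>y - s\<close> folded together.\<close>

definition G :: "real \<Rightarrow> real \<Rightarrow> real \<Rightarrow> real" where
  "G \<gamma> y s = sdiff y s * s powr (- (1 + \<gamma>))"

lemma G_measurable [measurable]: "G \<gamma> y \<in> borel_measurable borel"
  unfolding G_def[abs_def] by measurable

lemma G_bound: "\<bar>G \<gamma> y s\<bar> \<le> C * s powr (1 - \<gamma>)" if "s > 0"
proof -
  have "\<bar>G \<gamma> y s\<bar> \<le> (C * s\<^sup>2) * s powr (- (1 + \<gamma>))"
    unfolding G_def abs_mult using sdiff_bound[of s y] that by (intro mult_mono) auto
  also have "\<dots> = C * (s\<^sup>2 * s powr (- (1 + \<gamma>)))" by (simp only: mult.assoc)
  also have "s\<^sup>2 * s powr (- (1 + \<gamma>)) = s powr (1 - \<gamma>)"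
    using square_mult_powr[OF that, of "- (1 + \<gamma>)"] by simp
  finally show ?thesis .
qed

text \<open>The 5 is 2 from differentiating \<open>sdiff\<close> plus 3, a bound for
  \<open>1 + \<gamma>\<close>, from differentiating the power; both terms scale as
  \<open>s powr (- \<gamma>)\<close>.\<close>

lemma G_deriv_bound:
  assumes "\<gamma> > 0" "\<gamma> < 2" "s > 0"
  obtains D where "(G \<gamma> y has_real_derivative D) (at s)" "\<bar>D\<bar> \<le> 5 * C * s powr (- \<gamma>)"
proof -
  let ?D = "(h' (y + s) - h' (y - s)) * s powr (- (1 + \<gamma>)) + sdiff y s * (- (1 + \<gamma>) * s powr (- (1 + \<gamma>) - 1))"
  have "(G \<gamma> y has_real_derivative ?D) (at s)"
    unfolding G_def[abs_def] using assms
    by (auto intro!: derivative_eq_intros sdiff_deriv simp: mult_ac)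
  moreover have "\<bar>?D\<bar> \<le> 5 * C * s powr (- \<gamma>)"
  proof -
    have "\<bar>(h' (y + s) - h' (y - s)) * s powr (- (1 + \<gamma>))\<bar> \<le> 2 * C * s * s powr (- (1 + \<gamma>))"
      unfolding abs_mult using h'_lipschitz[of s y] assms by (intro mult_mono) auto
    also have "2 * C * s * s powr (- (1 + \<gamma>)) = 2 * C * (s * s powr (- (1 + \<gamma>)))" by (simp only: mult.assoc)
    also have "s * s powr (- (1 + \<gamma>)) = s powr (- \<gamma>)" using powr_mult_base[of s "- (1 + \<gamma>)"] assms by simp
    finally have 1: "\<bar>(h' (y + s) - h' (y - s)) * s powr (- (1 + \<gamma>))\<bar> \<le> 2 * C * s powr (- \<gamma>)" .
    have "\<bar>sdiff y s * (- (1 + \<gamma>) * s powr (- (1 + \<gamma>) - 1))\<bar> = \<bar>sdiff y s\<bar> * ((1 + \<gamma>) * s powr (- (1 + \<gamma>) - 1))"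
      using assms by (simp add: abs_mult)
    also have "\<dots> \<le> (C * s\<^sup>2) * (3 * s powr (- (1 + \<gamma>) - 1))"
      using sdiff_bound[of s y] assms C_nonneg by (intro mult_mono) auto
    also have "\<dots> = 3 * C * (s\<^sup>2 * s powr (- (1 + \<gamma>) - 1))" by (simp only: mult_ac)
    also have "s\<^sup>2 * s powr (- (1 + \<gamma>) - 1) = s powr (- \<gamma>)"
      using square_mult_powr[OF assms(3), of "- (1 + \<gamma>) - 1"] by simp
    finally show ?thesis using 1 by linarith
  qed
  ultimately show ?thesis using that by blast
qed

lemma G_integrable:
  assumes "1 < \<gamma>" "\<gamma> < 2"
  shows "set_integrable lborel {0<..} (G \<gamma> y)"
proof -
  have 1: "set_integrable lborel {0<..1} (G \<gamma> y)"
  proof (rule set_integrable_bound)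
    show "set_integrable lborel {0<..1} (\<lambda>s. C * s powr (1 - \<gamma>))"
      using powr_integral_from_0(1)[of "1 - \<gamma>" 1] assms by simp
    show "AE s in lborel. s \<in> {0<..1} \<longrightarrow> norm (G \<gamma> y s) \<le> norm (C * s powr (1 - \<gamma>))"
      using G_bound C_nonneg by (auto simp: abs_mult)
  qed (simp add: set_borel_measurable_def)
  have 2: "set_integrable lborel {1..} (G \<gamma> y)"
  proof (rule set_integrable_bound)
    show "set_integrable lborel {1..} (\<lambda>s. 4 * B * s powr (- (1 + \<gamma>)))"
      using powr_integrable_to_inf[of "- (1 + \<gamma>)" 1] assms by simp
    show "AE s in lborel. s \<in> {1..} \<longrightarrow> norm (G \<gamma> y s) \<le> norm (4 * B * s powr (- (1 + \<gamma>)))"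
    proof (rule AE_I2, rule impI)
      fix s :: real
      have "norm (G \<gamma> y s) = \<bar>sdiff y s\<bar> * s powr (- (1 + \<gamma>))" by (simp add: G_def abs_mult)
      also have "\<dots> \<le> 4 * B * s powr (- (1 + \<gamma>))" by (intro mult_right_mono sdiff_bound') simp
      finally show "norm (G \<gamma> y s) \<le> norm (4 * B * s powr (- (1 + \<gamma>)))" by simp
    qed
  qed (simp add: set_borel_measurable_def)
  have "{0<..1} \<union> {1..} = {0::real<..}" by auto
  then show ?thesis using set_integrable_Un[OF 1 2] by simp
qed

text \<open>The singularity \<open>s powr (1 - \<gamma>)\<close> is integrable because \<gamma> < 2.
  The bound serves both to show that the principal value exists and to discard the interval before
  the first cell of the Riemann sum.\<close>

lemma G_integral_near_0:
  assumes "1 < \<gamma>" "\<gamma> < 2" "\<epsilon> > 0"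
  shows "\<bar>(LINT s:{\<epsilon>..}|lborel. G \<gamma> y s) - (LINT s:{0<..}|lborel. G \<gamma> y s)\<bar> \<le> C / (2 - \<gamma>) * \<epsilon> powr (2 - \<gamma>)"
proof -
  note int = G_integrable[OF assms(1,2), of y]
  have i1: "set_integrable lborel {0<..<\<epsilon>} (G \<gamma> y)" by (rule set_integrable_subset[OF int]) auto
  have i2: "set_integrable lborel {\<epsilon>..} (G \<gamma> y)" by (rule set_integrable_subset[OF int]) (use assms in auto)
  have eq: "{0<..} = {0<..<\<epsilon>} \<union> {\<epsilon>..}" using assms by auto
  have "(LINT s:{0<..}|lborel. G \<gamma> y s) = (LINT s:{0<..<\<epsilon>}|lborel. G \<gamma> y s) + (LINT s:{\<epsilon>..}|lborel. G \<gamma> y s)"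
    unfolding eq by (rule set_integral_Un[OF _ i1 i2]) auto
  then have "\<bar>(LINT s:{\<epsilon>..}|lborel. G \<gamma> y s) - (LINT s:{0<..}|lborel. G \<gamma> y s)\<bar> = \<bar>LINT s:{0<..<\<epsilon>}|lborel. G \<gamma> y s\<bar>"
    by simp
  also have "\<dots> \<le> (LINT s:{0<..<\<epsilon>}|lborel. \<bar>G \<gamma> y s\<bar>)"
    using set_integral_norm_bound[OF i1] by simp
  also have "\<dots> \<le> (LINT s:{0<..\<epsilon>}|lborel. C * s powr (1 - \<gamma>))"
  proof -
    have "set_integrable lborel {0<..\<epsilon>} (\<lambda>s. s powr (1 - \<gamma>))"
      using powr_integral_from_0(1)[of "1 - \<gamma>" \<epsilon>] assms by simp
    then have j: "set_integrable lborel {0<..\<epsilon>} (\<lambda>s. C * s powr (1 - \<gamma>))" by simp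
    have b: "indicator {0<..<\<epsilon>} s *\<^sub>R \<bar>G \<gamma> y s\<bar> \<le> indicator {0<..\<epsilon>} s *\<^sub>R (C * s powr (1 - \<gamma>))" for s
      using G_bound[of s \<gamma> y] C_nonneg by (auto simp: indicator_def)
    show ?thesis
      using set_integrable_abs[OF i1] j b
      unfolding set_lebesgue_integral_def set_integrable_def by (intro integral_mono)
  qed
  also have "\<dots> = C / (2 - \<gamma>) * \<epsilon> powr (2 - \<gamma>)"
    using powr_integral_from_0(2)[of "1 - \<gamma>" \<epsilon>] assms by simp
  finally show ?thesis .
qed

text \<open>Left-endpoint rule with the derivative bound; \<open>s powr (- \<gamma>)\<close> is
  decreasing, so its value at \<open>r\<close> serves the entire cell.\<close>

lemma G_cell:
  assumes "1 < \<gamma>" "\<gamma> < 2" "0 < r" "0 < d"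
  shows "\<bar>(LINT s:{r..<r + d}|lborel. G \<gamma> y s) - d * G \<gamma> y r\<bar> \<le> 5 * C * r powr (- \<gamma>) * d\<^sup>2"
proof -
  have \<gamma>0: "\<gamma> > 0" using assms by simp
  let ?A = "{r..<r + d}"
  have i: "set_integrable lborel ?A (G \<gamma> y)"
    by (rule set_integrable_subset[OF G_integrable[OF assms(1,2)]]) (use assms in auto)
  have c: "set_integrable lborel ?A (\<lambda>_. k :: real)" for k
    using assms by (simp add: set_integrable_def)
  have ci: "(LINT s:?A|lborel. k) = k * d" for k :: real
    using assms by (simp add: set_lebesgue_integral_def)
  have pw: "\<bar>G \<gamma> y s - G \<gamma> y r\<bar> \<le> 5 * C * r powr (- \<gamma>) * d" if "s \<in> ?A" for s
  proof (cases "s = r")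
    case False
    then have "r < s" using that by simp
    have "\<exists>D. (G \<gamma> y has_real_derivative D) (at x) \<and> \<bar>D\<bar> \<le> 5 * C * x powr (- \<gamma>)" if "x > 0" for x
      using G_deriv_bound[OF \<gamma>0 assms(2) that] by metis
    then obtain D where D: "\<And>x. x > 0 \<Longrightarrow> (G \<gamma> y has_real_derivative D x) (at x) \<and> \<bar>D x\<bar> \<le> 5 * C * x powr (- \<gamma>)"
      by metis
    obtain z where z: "r < z" "z < s" "G \<gamma> y s - G \<gamma> y r = (s - r) * D z"
      using MVT2[OF \<open>r < s\<close>, of "G \<gamma> y" D] D assms by force
    have "\<bar>G \<gamma> y s - G \<gamma> y r\<bar> = (s - r) * \<bar>D z\<bar>" using z \<open>r < s\<close> by (simp add: abs_mult)
    also have "\<dots> \<le> d * (5 * C * r powr (- \<gamma>))"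
    proof (intro mult_mono)
      have "\<bar>D z\<bar> \<le> 5 * C * z powr (- \<gamma>)" using D[of z] z assms by auto
      also have "\<dots> \<le> 5 * C * r powr (- \<gamma>)"
        using z assms C_nonneg by (intro mult_left_mono powr_mono2') auto
      finally show "\<bar>D z\<bar> \<le> 5 * C * r powr (- \<gamma>)" .
    qed (use that assms in auto)
    finally show ?thesis by (simp add: mult_ac)
  qed (use C_nonneg assms in simp)
  have "(LINT s:?A|lborel. G \<gamma> y s) - d * G \<gamma> y r = (LINT s:?A|lborel. G \<gamma> y s - G \<gamma> y r)"
    using i c ci by (simp add: mult.commute)
  also have "\<bar>\<dots>\<bar> \<le> (LINT s:?A|lborel. \<bar>G \<gamma> y s - G \<gamma> y r\<bar>)"
    using set_integral_norm_bound[OF set_integral_diff(1)[OF i c[of "G \<gamma> y r"]]] by simp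
  also have "\<dots> \<le> (LINT s:?A|lborel. 5 * C * r powr (- \<gamma>) * d)"
    using i c pw by (intro set_integral_mono set_integrable_abs set_integral_diff(1))
  also have "\<dots> = 5 * C * r powr (- \<gamma>) * d\<^sup>2" by (simp only: ci power2_eq_square mult.assoc)
  finally show ?thesis .
qed

text \<open>Folding the two half lines turns the truncated integral into minus the integral of
  \<open>G\<close> over \<open>s \<ge> \<epsilon>\<close>, which converges as \<epsilon> tends to 0;
  so \<open>Lim\<close> denotes a genuine limit here.\<close>

lemma frac_Laplacian_eq:
  assumes "1 < \<gamma>" "\<gamma> < 2"
  shows "frac_Laplacian \<gamma> h y = - c_const \<gamma> * (LINT s:{0<..}|lborel. G \<gamma> y s)"
proof -
  have pm: "x powr (- 1 - \<gamma>) = inverse (x powr (1 + \<gamma>))" for x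
    using powr_minus[of x "1 + \<gamma>"] by simp
  have cut: "(LINT t:{t. \<bar>t - y\<bar> \<ge> \<epsilon>}|lborel. (h y - h t) / \<bar>t - y\<bar> powr (1 + \<gamma>)) = - (LINT s:{\<epsilon>..}|lborel. G \<gamma> y s)"
    if e: "\<epsilon> > 0" for \<epsilon>
  proof -
    let ?f = "\<lambda>t. (h y - h t) / \<bar>t - y\<bar> powr (1 + \<gamma>)"
    let ?p = "\<lambda>s. (h y - h (y + s)) * s powr (- (1 + \<gamma>))"
    let ?m = "\<lambda>s. (h y - h (y - s)) * s powr (- (1 + \<gamma>))"
    have dom: "set_integrable lborel {\<epsilon>..} (\<lambda>s. 2 * B * s powr (- (1 + \<gamma>)))"
      using powr_integrable_to_inf[of "- (1 + \<gamma>)" \<epsilon>] assms e by simp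
    have ip: "set_integrable lborel {\<epsilon>..} ?p" and im: "set_integrable lborel {\<epsilon>..} ?m"
    proof -
      have b: "\<bar>h y - h z\<bar> * s powr (- (1 + \<gamma>)) \<le> \<bar>2 * B * s powr (- (1 + \<gamma>))\<bar>" for z s
        using bound[of y] bound[of z] by (simp add: abs_mult) (intro mult_right_mono, auto)
      show "set_integrable lborel {\<epsilon>..} ?p" "set_integrable lborel {\<epsilon>..} ?m"
        by (rule set_integrable_bound[OF dom]; use b in \<open>simp add: set_borel_measurable_def abs_mult\<close>)+
    qed
    have "(LINT t:{y + \<epsilon>..}|lborel. ?f t) = (\<integral>s. indicator {y + \<epsilon>..} (y + 1 * s) *\<^sub>R ?f (y + 1 * s) \<partial>lborel)"
      unfolding set_lebesgue_integral_def by (subst lborel_integral_real_affine[where c = 1 and t = y]) auto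
    also have "\<dots> = (LINT s:{\<epsilon>..}|lborel. ?p s)"
      unfolding set_lebesgue_integral_def using e
      by (intro Bochner_Integration.integral_cong) (auto simp: indicator_def pm divide_inverse)
    finally have 1: "(LINT t:{y + \<epsilon>..}|lborel. ?f t) = (LINT s:{\<epsilon>..}|lborel. ?p s)" .
    have "(LINT t:{..y - \<epsilon>}|lborel. ?f t) = (\<integral>s. indicator {..y - \<epsilon>} (y + (-1) * s) *\<^sub>R ?f (y + (-1) * s) \<partial>lborel)"
      unfolding set_lebesgue_integral_def by (subst lborel_integral_real_affine[where c = "-1" and t = y]) auto
    also have "\<dots> = (LINT s:{\<epsilon>..}|lborel. ?m s)"
      unfolding set_lebesgue_integral_def using e
      by (intro Bochner_Integration.integral_cong) (auto simp: indicator_def pm divide_inverse)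
    finally have 2: "(LINT t:{..y - \<epsilon>}|lborel. ?f t) = (LINT s:{\<epsilon>..}|lborel. ?m s)" .
    have if1: "set_integrable lborel {y + \<epsilon>..} ?f"
    proof -
      have "integrable lborel (\<lambda>s. indicator {y + \<epsilon>..} (y + 1 * s) *\<^sub>R ?f (y + 1 * s))"
        using ip unfolding set_integrable_def
        by (rule Bochner_Integration.integrable_cong[THEN iffD1, rotated 2])
          (use e in \<open>auto simp: indicator_def pm divide_inverse\<close>)
      then show ?thesis unfolding set_integrable_def
        by (subst (asm) lborel_integrable_real_affine_iff) auto
    qed
    have if2: "set_integrable lborel {..y - \<epsilon>} ?f"
    proof -
      have "integrable lborel (\<lambda>s. indicator {..y - \<epsilon>} (y + (-1) * s) *\<^sub>R ?f (y + (-1) * s))"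
        using im unfolding set_integrable_def
        by (rule Bochner_Integration.integrable_cong[THEN iffD1, rotated 2])
          (use e in \<open>auto simp: indicator_def pm divide_inverse\<close>)
      then show ?thesis unfolding set_integrable_def
        by (subst (asm) lborel_integrable_real_affine_iff) auto
    qed
    have eq: "{t. \<bar>t - y\<bar> \<ge> \<epsilon>} = {y + \<epsilon>..} \<union> {..y - \<epsilon>}" by auto
    have "(LINT t:{t. \<bar>t - y\<bar> \<ge> \<epsilon>}|lborel. ?f t) = (LINT s:{\<epsilon>..}|lborel. ?p s) + (LINT s:{\<epsilon>..}|lborel. ?m s)"
      unfolding eq 1[symmetric] 2[symmetric] by (rule set_integral_Un[OF _ if1 if2]) (use e in auto)
    also have "\<dots> = (LINT s:{\<epsilon>..}|lborel. ?p s + ?m s)" by (rule set_integral_add(2)[OF ip im, symmetric])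
    also have "\<dots> = (LINT s:{\<epsilon>..}|lborel. - G \<gamma> y s)"
      by (intro set_lebesgue_integral_cong) (simp_all add: G_def sdiff_def left_diff_distrib distrib_right)
    also have "\<dots> = - (LINT s:{\<epsilon>..}|lborel. G \<gamma> y s)"
      by (intro set_integral_uminus set_integrable_subset[OF G_integrable[OF assms]]) (use e in auto)
    finally show ?thesis .
  qed
  let ?I = "LINT s:{0<..}|lborel. G \<gamma> y s"
  have ev: "eventually (\<lambda>\<epsilon>::real. \<epsilon> > 0) (at_right 0)" by (simp add: eventually_at_right_less)
  have "((\<lambda>\<epsilon>. C / (2 - \<gamma>) * \<epsilon> powr (2 - \<gamma>)) \<longlongrightarrow> C / (2 - \<gamma>) * 0) (at_right 0)"
  proof (intro tendsto_mult tendsto_const)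
    have "((\<lambda>\<epsilon>::real. \<epsilon> powr (2 - \<gamma>)) \<longlongrightarrow> 0 powr (2 - \<gamma>)) (at_right 0)"
      using assms by (intro tendsto_powr' tendsto_const tendsto_ident_at) (auto simp: eventually_at_filter)
    then show "((\<lambda>\<epsilon>::real. \<epsilon> powr (2 - \<gamma>)) \<longlongrightarrow> 0) (at_right 0)" by simp
  qed
  then have l0: "((\<lambda>\<epsilon>. C / (2 - \<gamma>) * \<epsilon> powr (2 - \<gamma>)) \<longlongrightarrow> 0) (at_right 0)" by simp
  have "((\<lambda>\<epsilon>. (LINT s:{\<epsilon>..}|lborel. G \<gamma> y s) - ?I) \<longlongrightarrow> 0) (at_right 0)"
  proof (rule Lim_null_comparison[OF _ l0])
    show "\<forall>\<^sub>F \<epsilon> in at_right 0. norm ((LINT s:{\<epsilon>..}|lborel. G \<gamma> y s) - ?I) \<le> C / (2 - \<gamma>) * \<epsilon> powr (2 - \<gamma>)"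
      using ev unfolding real_norm_def by eventually_elim (rule G_integral_near_0[OF assms])
  qed
  then have "((\<lambda>\<epsilon>. - (LINT s:{\<epsilon>..}|lborel. G \<gamma> y s)) \<longlongrightarrow> - ?I) (at_right 0)"
    by (intro tendsto_minus) (rule LIM_zero_cancel)
  then have "((\<lambda>\<epsilon>. LINT t:{t. \<bar>t - y\<bar> \<ge> \<epsilon>}|lborel. (h y - h t) / \<bar>t - y\<bar> powr (1 + \<gamma>)) \<longlongrightarrow> - ?I) (at_right 0)"
  proof (rule Lim_transform_eventually)
    show "\<forall>\<^sub>F \<epsilon> in at_right 0. - (LINT s:{\<epsilon>..}|lborel. G \<gamma> y s) =
        (LINT t:{t. \<bar>t - y\<bar> \<ge> \<epsilon>}|lborel. (h y - h t) / \<bar>t - y\<bar> powr (1 + \<gamma>))"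
      using ev by eventually_elim (rule cut[symmetric])
  qed
  then have "Lim (at_right 0) (\<lambda>\<epsilon>. LINT t:{t. \<bar>t - y\<bar> \<ge> \<epsilon>}|lborel. (h y - h t) / \<bar>t - y\<bar> powr (1 + \<gamma>)) = - ?I"
    by (rule tendsto_Lim[OF trivial_limit_at_right_real])
  then show ?thesis by (simp add: frac_Laplacian_def)
qed

section \<open>Riemann sum comparison of the lattice operator with the fractional Laplacian\<close>

text \<open>For \<open>d = 1 / N\<close> this is \<open>N powr \<gamma>\<close> times the lattice
  operator (\<open>avg\<close> minus identity), applied to \<open>h\<close> sampled with mesh
  \<open>d\<close> around an arbitrary real point \<open>y\<close>.\<close>

definition disc_lap :: "real \<Rightarrow> real \<Rightarrow> real \<Rightarrow> real" where
  "disc_lap \<gamma> d y = d powr (- \<gamma>) * (\<Sum>n. jump \<gamma> (int (Suc n)) * sdiff y (real (Suc n) * d))"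

text \<open>Up to \<open>c_const \<gamma>\<close>, \<open>disc_lap\<close> is the left-endpoint sum
  of \<open>G\<close> over cells of width \<open>d\<close> starting at \<open>d\<close>. The cell at
  \<open>k * d\<close> errs by \<open>5 * C * d powr (2 - \<gamma>) * k powr (- \<gamma>)\<close>,
  summable in \<open>k\<close> since \<gamma> > 1, and the missing interval next to 0 contributes
  \<open>C / (2 - \<gamma>) * d powr (2 - \<gamma>)\<close>. The plus sign is due to the discrete
  operator approximating minus \<open>frac_Laplacian\<close>. The bound is uniform in
  \<open>y\<close>.\<close>

lemma disc_lap_frac_Laplacian:
  assumes "1 < \<gamma>" "\<gamma> < 2" "d > 0"
  shows "\<bar>disc_lap \<gamma> d y + frac_Laplacian \<gamma> h y\<bar> \<le>
    c_const \<gamma> * (5 * (\<Sum>n. real (n + 1) powr (- \<gamma>)) + 1 / (2 - \<gamma>)) * C * d powr (2 - \<gamma>)"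
proof -
  have \<gamma>0: "\<gamma> > 0" using assms by simp
  let ?Z = "\<Sum>n. real (n + 1) powr (- \<gamma>)"
  have sZ: "summable (\<lambda>n. real (n + 1) powr (- \<gamma>))" using assms by (intro summable_shift_powr) auto
  let ?cell = "\<lambda>n. {real (Suc n) * d..<real (Suc n) * d + d}"
  let ?I = "\<lambda>n. LINT s:?cell n|lborel. G \<gamma> y s"
  let ?g = "\<lambda>n. d * G \<gamma> y (real (Suc n) * d)"
  have cells: "(\<Union>n. ?cell n) = {d..}"
  proof (intro equalityI subsetI)
    fix s assume "s \<in> (\<Union>n. ?cell n)"
    then obtain n where "real (Suc n) * d \<le> s" by auto
    moreover have "1 * d \<le> real (Suc n) * d" using assms by (intro mult_right_mono) auto
    ultimately show "s \<in> {d..}" by simp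
  next
    fix s assume s: "s \<in> {d..}"
    define m where "m = nat \<lfloor>s / d\<rfloor>"
    have "1 \<le> s / d" using s assms by simp
    then have m: "real m \<le> s / d" "s / d < real m + 1" "m \<ge> 1" unfolding m_def by linarith+
    then have "real m * d \<le> s" "s < real m * d + d" using assms by (auto simp: field_simps)
    then show "s \<in> (\<Union>n. ?cell n)" using m(3) by (intro UN_I[of "m - 1"]) auto
  qed
  have disj: "?cell i \<inter> ?cell j = {}" if "i \<noteq> j" for i j
  proof -
    have *: "?cell i \<inter> ?cell j = {}" if "i < j" for i j
    proof -
      have "real (Suc (Suc i)) * d \<le> real (Suc j) * d" using that assms by (intro mult_right_mono) auto
      then show ?thesis by (auto simp: algebra_simps)
    qed
    show ?thesis using *[of i j] *[of j i] that by (cases "i < j") auto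
  qed
  have iU: "set_integrable lborel (\<Union>n. ?cell n) (G \<gamma> y)"
    unfolding cells by (rule set_integrable_subset[OF G_integrable[OF assms(1,2)]]) (use assms in auto)
  have gdef: "?g n = d powr (- \<gamma>) * (real (Suc n) powr (- (1 + \<gamma>)) * sdiff y (real (Suc n) * d))" for n
  proof -
    have "d * d powr (- (1 + \<gamma>)) = d powr (- \<gamma>)" using powr_mult_base[of d "- (1 + \<gamma>)"] assms by simp
    moreover have "(real (Suc n) * d) powr (- (1 + \<gamma>)) = real (Suc n) powr (- (1 + \<gamma>)) * d powr (- (1 + \<gamma>))"
      using assms by (simp add: powr_mult)
    moreover have "d * (sdiff y (real (Suc n) * d) * (real (Suc n) powr (- (1 + \<gamma>)) * d powr (- (1 + \<gamma>)))) =
      (d * d powr (- (1 + \<gamma>))) * (real (Suc n) powr (- (1 + \<gamma>)) * sdiff y (real (Suc n) * d))"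
      by (simp only: mult_ac)
    ultimately show ?thesis unfolding G_def by (simp only:)
  qed
  have sg: "(\<lambda>n. c_const \<gamma> * ?g n) sums disc_lap \<gamma> d y"
  proof -
    have "summable (\<lambda>n. jump \<gamma> (int (Suc n)) * sdiff y (real (Suc n) * d))"
      using sdiff_bound' by (intro summable_jump_mult[OF \<gamma>0]) auto
    then have "(\<lambda>n. d powr (- \<gamma>) * (jump \<gamma> (int (Suc n)) * sdiff y (real (Suc n) * d))) sums disc_lap \<gamma> d y"
      unfolding disc_lap_def by (intro sums_mult summable_sums)
    then show ?thesis unfolding gdef jump_Suc by (simp add: mult_ac)
  qed
  have sg': "summable ?g"
    using sg c_const_pos[OF \<gamma>0] by (metis summable_cmult_iff sums_summable less_irrefl)
  have dI: "(LINT s:{d..}|lborel. G \<gamma> y s) = (\<Sum>n. ?I n)"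
    using lebesgue_integral_countable_add[of ?cell lborel "G \<gamma> y"] disj iU unfolding cells by auto
  have err: "\<bar>?I n - ?g n\<bar> \<le> 5 * C * d powr (2 - \<gamma>) * real (n + 1) powr (- \<gamma>)" for n
  proof -
    have "\<bar>?I n - ?g n\<bar> \<le> 5 * C * (real (Suc n) * d) powr (- \<gamma>) * d\<^sup>2"
      using assms by (intro G_cell) auto
    also have "(real (Suc n) * d) powr (- \<gamma>) = real (n + 1) powr (- \<gamma>) * d powr (- \<gamma>)"
      using assms by (subst powr_mult) auto
    also have "5 * C * (real (n + 1) powr (- \<gamma>) * d powr (- \<gamma>)) * d\<^sup>2 =
        5 * C * (d powr (- \<gamma>) * d\<^sup>2) * real (n + 1) powr (- \<gamma>)" by (simp add: mult_ac)
    also have "d powr (- \<gamma>) * d\<^sup>2 = d powr (2 - \<gamma>)"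
      using square_mult_powr[OF assms(3), of "- \<gamma>"] by (simp add: mult.commute)
    finally show ?thesis .
  qed
  have se: "summable (\<lambda>n. \<bar>?I n - ?g n\<bar>)"
    by (rule summable_comparison_test'[OF summable_mult[OF sZ, of "5 * C * d powr (2 - \<gamma>)"]]) (use err in auto)
  then have sI: "summable ?I" using summable_add[OF summable_rabs_cancel[OF se] sg'] by simp
  have "\<bar>(\<Sum>n. ?I n) - (\<Sum>n. ?g n)\<bar> = \<bar>\<Sum>n. ?I n - ?g n\<bar>" using suminf_diff[OF sI sg'] by simp
  also have "\<dots> \<le> (\<Sum>n. \<bar>?I n - ?g n\<bar>)" by (rule summable_rabs[OF se])
  also have "\<dots> \<le> (\<Sum>n. 5 * C * d powr (2 - \<gamma>) * real (n + 1) powr (- \<gamma>))"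
    by (intro suminf_le err se summable_mult sZ)
  also have "\<dots> = 5 * C * d powr (2 - \<gamma>) * ?Z" by (rule suminf_mult[OF sZ])
  finally have e1: "\<bar>(LINT s:{d..}|lborel. G \<gamma> y s) - (\<Sum>n. ?g n)\<bar> \<le> 5 * C * d powr (2 - \<gamma>) * ?Z"
    unfolding dI .
  note e2 = G_integral_near_0[OF assms, of y]
  have "(\<lambda>n. c_const \<gamma> * ?g n) sums (c_const \<gamma> * (\<Sum>n. ?g n))"
    using sg' by (intro sums_mult summable_sums)
  then have "disc_lap \<gamma> d y = c_const \<gamma> * (\<Sum>n. ?g n)" using sg sums_unique2 by blast
  then have "disc_lap \<gamma> d y + frac_Laplacian \<gamma> h y = c_const \<gamma> * ((\<Sum>n. ?g n) - (LINT s:{0<..}|lborel. G \<gamma> y s))"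
    by (simp add: frac_Laplacian_eq[OF assms(1,2)] algebra_simps)
  then have "\<bar>disc_lap \<gamma> d y + frac_Laplacian \<gamma> h y\<bar> = c_const \<gamma> * \<bar>(\<Sum>n. ?g n) - (LINT s:{0<..}|lborel. G \<gamma> y s)\<bar>"
    using c_const_pos[OF \<gamma>0] by (simp add: abs_mult)
  also have "\<dots> \<le> c_const \<gamma> * (5 * C * d powr (2 - \<gamma>) * ?Z + C / (2 - \<gamma>) * d powr (2 - \<gamma>))"
    using c_const_pos[OF \<gamma>0] e1 e2 by (intro mult_left_mono) linarith+
  also have "\<dots> = c_const \<gamma> * (5 * ?Z + 1 / (2 - \<gamma>)) * C * d powr (2 - \<gamma>)"
    by (simp add: algebra_simps)
  finally show ?thesis .
qed

end

section \<open>Mollified weak solutions\<close>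

lemma bounded_set_integrable_unit:
  fixes f :: "real \<Rightarrow> real"
  assumes [measurable]: "f \<in> borel_measurable borel" and "\<And>x. x \<in> {0..1} \<Longrightarrow> \<bar>f x\<bar> \<le> B"
  shows "set_integrable lborel {0..1} f"
proof (rule set_integrable_bound)
  show "set_integrable lborel {0..1::real} (\<lambda>_. B)" by (simp add: set_integrable_def)
  show "AE x in lborel. x \<in> {0..1} \<longrightarrow> norm (f x) \<le> norm B" using assms(2) by force
qed (simp add: set_borel_measurable_def)

lemma LINT_unit_const: "(LINT x:{0..1::real}|lborel. k :: real) = k"
  by (simp add: set_lebesgue_integral_def)

lemma LINT_unit_bound:
  fixes f :: "real \<Rightarrow> real"
  assumes "f \<in> borel_measurable borel" and "\<And>x. x \<in> {0..1} \<Longrightarrow> \<bar>f x\<bar> \<le> B"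
  shows "\<bar>LINT x:{0..1}|lborel. f x\<bar> \<le> B"
proof -
  have i: "set_integrable lborel {0..1} f" by (rule bounded_set_integrable_unit[OF assms])
  have "\<bar>LINT x:{0..1}|lborel. f x\<bar> \<le> (LINT x:{0..1}|lborel. \<bar>f x\<bar>)"
    using set_integral_norm_bound[OF i] by simp
  also have "\<dots> \<le> (LINT x:{0..1::real}|lborel. B)"
    by (intro set_integral_mono set_integrable_abs[OF i] bounded_set_integrable_unit[of _ "\<bar>B\<bar>"])
      (use assms(2) in auto)
  finally show ?thesis by (simp add: LINT_unit_const)
qed

lemma bounded_support_integrable:
  fixes f :: "real \<Rightarrow> real"
  assumes [measurable]: "f \<in> borel_measurable borel" and "\<And>x. \<bar>f x\<bar> \<le> B"
    and "\<And>x. x \<notin> {a..b} \<Longrightarrow> f x = 0"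
  shows "integrable lborel f"
proof (rule Bochner_Integration.integrable_bound[of lborel "\<lambda>x. B * indicator {a..b} x"])
  show "integrable lborel (\<lambda>x. B * indicator {a..b} x)"
    by (intro integrable_mult_right integrable_real_indicator) (auto simp: emeasure_lborel_Icc_eq)
  show "AE x in lborel. norm (f x) \<le> norm (B * indicator {a..b} x)"
  proof (rule AE_I2)
    fix x show "norm (f x) \<le> norm (B * indicator {a..b} x)"
      using assms(2)[of x] assms(3)[of x] by (cases "x \<in> {a..b}") auto
  qed
qed auto

text \<open>The terms are dominated by \<open>B\<close> times the summable kernel, so sum and
  integral may be exchanged.\<close>

lemma jump_sums_LINT:
  fixes F :: "nat \<Rightarrow> real \<Rightarrow> real"
  assumes \<gamma>: "\<gamma> > 0" and [measurable]: "\<And>n. F n \<in> borel_measurable borel"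
    and bd: "\<And>n x. x \<in> {0..1} \<Longrightarrow> \<bar>F n x\<bar> \<le> B"
  shows "(\<lambda>n. jump \<gamma> (int (Suc n)) * (LINT x:{0..1}|lborel. F n x)) sums
    (LINT x:{0..1}|lborel. (\<Sum>n. jump \<gamma> (int (Suc n)) * F n x))"
proof -
  let ?p = "\<lambda>n. jump \<gamma> (int (Suc n))"
  let ?f = "\<lambda>n x. indicator {0..1} x * (?p n * F n x)"
  have "\<bar>F 0 0\<bar> \<le> B" by (rule bd) simp
  then have B: "B \<ge> 0" by linarith
  have i: "integrable lborel (?f n)" for n
    using set_integrable_mult_right[OF bounded_set_integrable_unit[OF assms(2) bd], of "?p n" n]
    by (simp add: set_integrable_def del: of_nat_Suc)
  have b: "\<bar>?f n x\<bar> \<le> indicator {0..1} x * (?p n * B)" for n x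
    using bd[of x n] jump_nonneg[OF \<gamma>] by (auto simp: indicator_def abs_mult simp del: of_nat_Suc intro!: mult_left_mono)
  have sp: "summable (\<lambda>n. ?p n * B)" using summable_jump[OF \<gamma>] by (rule summable_mult2)
  have s1: "AE x in lborel. summable (\<lambda>n. norm (?f n x))"
  proof (rule AE_I2)
    fix x :: real
    show "summable (\<lambda>n. norm (?f n x))"
      by (rule summable_comparison_test'[OF summable_mult[OF sp, of "indicator {0..1} x"]]) (use b in \<open>simp del: of_nat_Suc\<close>)
  qed
  have s2: "summable (\<lambda>n. \<integral>x. norm (?f n x) \<partial>lborel)"
  proof (rule summable_comparison_test'[OF sp])
    fix n
    have "(\<integral>x. norm (?f n x) \<partial>lborel) \<le> (\<integral>x. indicator {0..1::real} x * (?p n * B) \<partial>lborel)"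
    proof (rule Bochner_Integration.integral_mono)
      show "integrable lborel (\<lambda>x. norm (?f n x))" by (intro integrable_norm i)
      show "integrable lborel (\<lambda>x. indicator {0..1::real} x * (?p n * B))" by simp
      show "norm (?f n x) \<le> indicator {0..1} x * (?p n * B)" for x unfolding real_norm_def by (rule b)
    qed
    then show "norm (\<integral>x. norm (?f n x) \<partial>lborel) \<le> ?p n * B" by (simp del: of_nat_Suc)
  qed
  have "(\<lambda>n. \<integral>x. ?f n x \<partial>lborel) sums (\<Sum>n. \<integral>x. ?f n x \<partial>lborel)"
    by (intro summable_sums summable_integral[OF i s1 s2])
  also have "(\<Sum>n. \<integral>x. ?f n x \<partial>lborel) = (\<integral>x. (\<Sum>n. ?f n x) \<partial>lborel)"
    by (rule integral_suminf[OF i s1 s2, symmetric])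
  also have "(\<integral>x. (\<Sum>n. ?f n x) \<partial>lborel) = (LINT x:{0..1}|lborel. (\<Sum>n. ?p n * F n x))"
    unfolding set_lebesgue_integral_def
    by (intro Bochner_Integration.integral_cong) (auto simp: indicator_def simp del: of_nat_Suc)
  also have "(\<lambda>n. \<integral>x. ?f n x \<partial>lborel) = (\<lambda>n. ?p n * (LINT x:{0..1}|lborel. F n x))"
  proof
    fix n
    have "(\<integral>x. ?f n x \<partial>lborel) = (LINT x:{0..1}|lborel. ?p n * F n x)"
      by (simp only: set_lebesgue_integral_def real_scaleR_def)
    then show "(\<integral>x. ?f n x \<partial>lborel) = ?p n * (LINT x:{0..1}|lborel. F n x)" by (simp del: of_nat_Suc)
  qed
  finally show ?thesis .
qed

section \<open>Discrete reservoir rates and the discretised weak formulation\<close>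

text \<open>Scaled weight of the one-sided lattice jumps longer than \<open>w\<close>: the discrete
  counterpart of \<open>r_minus\<close> at \<open>w\<close>, and of \<open>r_plus\<close> at
  \<open>1 - w\<close>.\<close>

definition tail :: "real \<Rightarrow> real \<Rightarrow> real \<Rightarrow> real" where
  "tail \<gamma> d w = d powr (- \<gamma>) * (\<Sum>n. jump \<gamma> (int (Suc n)) * (if w < real (Suc n) * d then 1 else 0))"

text \<open>Rounding \<open>w / d\<close> up to an integer lowers the tail, while passing from
  integral to sum raises it; the two errors have opposite signs and each is at most
  \<open>X powr (- (1 + \<gamma>))\<close>, so no factor 2 arises.\<close>

lemma tail_bound:
  assumes \<gamma>: "\<gamma> > 0" and d: "d > 0" and w: "w > 0"
  shows "\<bar>tail \<gamma> d w - c_const \<gamma> / \<gamma> * w powr (- \<gamma>)\<bar> \<le> c_const \<gamma> * d * w powr (- (1 + \<gamma>))"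
proof -
  define X where "X = w / d"
  have X: "X > 0" using d w by (simp add: X_def)
  \<comment> \<open>The least integer strictly above \<open>w / d\<close>, matching the strict
    inequality in \<open>tail\<close>.\<close>
  define m where "m = nat \<lfloor>X\<rfloor> + 1"
  have m: "m > 0" "X < real m" "real m \<le> X + 1" using X unfolding m_def by linarith+
  have iff: "w < real (Suc n) * d \<longleftrightarrow> m \<le> Suc n" for n
  proof -
    have "w < real (Suc n) * d \<longleftrightarrow> X < real (Suc n)" using d by (simp add: X_def field_simps)
    also have "\<dots> \<longleftrightarrow> m \<le> Suc n" using X unfolding m_def by linarith
    finally show ?thesis .
  qed
  let ?S = "\<Sum>i. real (i + m) powr (- (1 + \<gamma>))"
  have t: "tail \<gamma> d w = d powr (- \<gamma>) * (c_const \<gamma> * ?S)"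
    using sums_unique[OF jump_tail_sums[OF \<gamma> m(1)]] by (simp add: tail_def iff del: of_nat_Suc)
  have "real m powr (- (1 + \<gamma>)) \<le> X powr (- (1 + \<gamma>))"
    using X m \<gamma> by (intro powr_mono2') auto
  moreover have "0 \<le> X powr (- \<gamma>) - real m powr (- \<gamma>)"
    using X m \<gamma> by (simp add: powr_mono2')
  then have "0 \<le> X powr (- \<gamma>) / \<gamma> - real m powr (- \<gamma>) / \<gamma>"
    using \<gamma> by (simp flip: diff_divide_distrib)
  moreover have "X powr (- \<gamma>) / \<gamma> - real m powr (- \<gamma>) / \<gamma> \<le> X powr (- (1 + \<gamma>))"
  proof -
    have "X powr (- \<gamma>) - real m powr (- \<gamma>) \<le> \<gamma> * (real m - X) * X powr (- (1 + \<gamma>))"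
      using X m \<gamma> by (intro powr_neg_diff_bounds) auto
    also have "\<dots> \<le> \<gamma> * 1 * X powr (- (1 + \<gamma>))"
      using m \<gamma> by (intro mult_right_mono mult_left_mono) auto
    finally show ?thesis using \<gamma> by (simp add: field_simps)
  qed
  ultimately have "\<bar>?S - X powr (- \<gamma>) / \<gamma>\<bar> \<le> X powr (- (1 + \<gamma>))"
    using powr_tail_bounds[OF \<gamma> m(1)] by linarith
  then have "d powr (- \<gamma>) * c_const \<gamma> * \<bar>?S - X powr (- \<gamma>) / \<gamma>\<bar> \<le> d powr (- \<gamma>) * c_const \<gamma> * X powr (- (1 + \<gamma>))"
    using c_const_pos[OF \<gamma>] by (intro mult_left_mono) auto
  moreover have "d powr (- \<gamma>) * c_const \<gamma> * \<bar>?S - X powr (- \<gamma>) / \<gamma>\<bar> = \<bar>tail \<gamma> d w - c_const \<gamma> / \<gamma> * w powr (- \<gamma>)\<bar>"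
  proof -
    have e: "d powr (- \<gamma>) * X powr (- \<gamma>) = w powr (- \<gamma>)"
      using d w by (simp add: X_def powr_divide)
    have "d powr (- \<gamma>) * c_const \<gamma> * (?S - X powr (- \<gamma>) / \<gamma>) =
        tail \<gamma> d w - c_const \<gamma> / \<gamma> * (d powr (- \<gamma>) * X powr (- \<gamma>))"
      unfolding t by (simp add: right_diff_distrib)
    then have "\<bar>d powr (- \<gamma>) * c_const \<gamma> * (?S - X powr (- \<gamma>) / \<gamma>)\<bar> =
        \<bar>tail \<gamma> d w - c_const \<gamma> / \<gamma> * w powr (- \<gamma>)\<bar>"
      unfolding e by (rule arg_cong)
    then show ?thesis using c_const_pos[OF \<gamma>] by (simp add: abs_mult)
  qed
  moreover have "d powr (- \<gamma>) * X powr (- (1 + \<gamma>)) = d * w powr (- (1 + \<gamma>))"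
  proof -
    have "d powr (- \<gamma>) = d * d powr (- (1 + \<gamma>))" using powr_mult_base[of d "- (1 + \<gamma>)"] d by simp
    then show ?thesis using d w by (simp add: X_def powr_divide)
  qed
  ultimately show ?thesis by (simp add: mult_ac)
qed


lemma (in bounded_C2) sdiff_pair_measurable [measurable]: "(\<lambda>y. sdiff y s) \<in> borel_measurable borel"
  unfolding sdiff_def by measurable

lemma (in bounded_C2) disc_lap_measurable [measurable]: "disc_lap \<gamma> d \<in> borel_measurable borel"
  unfolding disc_lap_def[abs_def] by measurable

text \<open>\<open>4 * B\<close> for the second difference times the one-sided mass 1/2. The bound
  blows up as \<open>d\<close> tends to 0 and only secures integrability for fixed
  \<open>d\<close>.\<close>

lemma (in bounded_C2) disc_lap_bounded:
  assumes "\<gamma> > 0"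
  shows "\<bar>disc_lap \<gamma> d y\<bar> \<le> d powr (- \<gamma>) * (2 * B)"
proof -
  let ?t = "\<lambda>n. jump \<gamma> (int (Suc n)) * sdiff y (real (Suc n) * d)"
  have s: "summable (\<lambda>n. \<bar>?t n\<bar>)"
    using summable_jump_mult[OF assms, of "\<lambda>n. \<bar>sdiff y (real (Suc n) * d)\<bar>" "4 * B"]
      sdiff_bound' jump_nonneg[OF assms] by (simp add: abs_mult del: of_nat_Suc)
  have "\<bar>suminf ?t\<bar> \<le> (\<Sum>n. \<bar>?t n\<bar>)" by (rule summable_rabs[OF s])
  also have "\<dots> \<le> (\<Sum>n. jump \<gamma> (int (Suc n)) * (2 * (2 * B)))"
  proof (intro suminf_le s)
    show "summable (\<lambda>n. jump \<gamma> (int (Suc n)) * (2 * (2 * B)))"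
      using sums_jump[OF assms] by (rule sums_summable)
    show "\<bar>?t n\<bar> \<le> jump \<gamma> (int (Suc n)) * (2 * (2 * B))" for n
      using sdiff_bound'[of y "real (Suc n) * d"] jump_nonneg[OF assms]
      by (auto simp: abs_mult simp del: of_nat_Suc intro!: mult_left_mono)
  qed
  also have "\<dots> = 2 * B" using sums_jump[OF assms] by (rule sums_unique[symmetric])
  finally show ?thesis unfolding disc_lap_def by (simp add: abs_mult mult_left_mono)
qed

text \<open>A pointwise limit of the measurable functions \<open>- disc_lap\<close> along meshes
  tending to 0.\<close>

lemma (in bounded_C2) frac_Laplacian_measurable:
  assumes "1 < \<gamma>" "\<gamma> < 2"
  shows "frac_Laplacian \<gamma> h \<in> borel_measurable borel"
proof (rule borel_measurable_LIMSEQ_real)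
  let ?d = "\<lambda>n::nat. 1 / real (Suc n)"
  let ?K = "c_const \<gamma> * (5 * (\<Sum>n. real (n + 1) powr (- \<gamma>)) + 1 / (2 - \<gamma>)) * C"
  show "(\<lambda>n. - disc_lap \<gamma> (?d n) y) \<longlonglongrightarrow> frac_Laplacian \<gamma> h y" for y
  proof (rule LIM_zero_cancel, rule Lim_null_comparison)
    show "\<forall>\<^sub>F n in sequentially. norm (- disc_lap \<gamma> (?d n) y - frac_Laplacian \<gamma> h y) \<le> ?K * ?d n powr (2 - \<gamma>)"
    proof (rule always_eventually, rule allI)
      fix n
      have "norm (- disc_lap \<gamma> (?d n) y - frac_Laplacian \<gamma> h y) = \<bar>disc_lap \<gamma> (?d n) y + frac_Laplacian \<gamma> h y\<bar>"
        by (simp only: real_norm_def)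
      also have "\<dots> \<le> ?K * ?d n powr (2 - \<gamma>)"
        by (rule disc_lap_frac_Laplacian[OF assms]) simp
      finally show "norm (- disc_lap \<gamma> (?d n) y - frac_Laplacian \<gamma> h y) \<le> ?K * ?d n powr (2 - \<gamma>)" .
    qed
    have "(\<lambda>n. ?d n powr (2 - \<gamma>)) \<longlonglongrightarrow> 0 powr (2 - \<gamma>)"
      using LIMSEQ_inverse_real_of_nat assms
      by (intro tendsto_powr') (simp_all add: inverse_eq_divide)
    then have "(\<lambda>n. ?K * ?d n powr (2 - \<gamma>)) \<longlonglongrightarrow> ?K * 0"
      by (intro tendsto_mult tendsto_const) simp
    then show "(\<lambda>n. ?K * ?d n powr (2 - \<gamma>)) \<longlonglongrightarrow> 0" by simp
  qed
qed simp

text \<open>Inside the unit interval, moving the discrete operator onto \<open>h\<close> gives the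
  pairing of the solution with \<open>disc_lap\<close>; the mass of \<open>h\<close> pushed across
  an endpoint meets the constant values \<open>\<alpha>\<close> and \<open>\<beta>\<close> and
  produces the tails. Replacing \<open>disc_lap\<close> by minus the fractional Laplacian and the
  tails by \<open>r_minus\<close> and \<open>r_plus\<close> leaves the weak formulation for
  \<open>h\<close>, which is zero; the two replacements are the two errors. Support at distance
  \<open>r\<close> from the endpoints keeps the tail error bounded.\<close>

lemma (in bounded_C2) mollified_near_harmonic:
  assumes \<gamma>: "1 < \<gamma>" "\<gamma> < 2" and weak: "weak_solution \<gamma> \<alpha> \<beta> \<rho>" and hC: "h \<in> C2c"
    and supp: "\<And>w. h w \<noteq> 0 \<Longrightarrow> r \<le> w \<and> w \<le> 1 - r" and r: "0 < r" and d: "0 < d"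
  defines "\<rho>t \<equiv> \<lambda>y. \<rho> (max 0 (min 1 y))"
  defines "g \<equiv> \<lambda>z. \<integral>y. \<rho>t y * h (y - z) \<partial>lborel"
  shows "\<bar>d powr (- \<gamma>) * (\<Sum>n. jump \<gamma> (int (Suc n)) * (g (real (Suc n) * d) + g (- (real (Suc n) * d)) - 2 * g 0))\<bar>
    \<le> c_const \<gamma> * (5 * (\<Sum>n. real (n + 1) powr (- \<gamma>)) + 1 / (2 - \<gamma>)) * C * d powr (2 - \<gamma>)
      + 2 * B * c_const \<gamma> * d * r powr (- (1 + \<gamma>))"
proof -
  have \<gamma>0: "\<gamma> > 0" using \<gamma> by simp
  let ?p = "\<lambda>n. jump \<gamma> (int (Suc n))"
  let ?s = "\<lambda>n. real (Suc n) * d"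
  let ?K = "c_const \<gamma> * (5 * (\<Sum>n. real (n + 1) powr (- \<gamma>)) + 1 / (2 - \<gamma>)) * C * d powr (2 - \<gamma>)"
  note c = c_const_pos[OF \<gamma>0]
  have ws: "continuous_on {0..1} \<rho>" "\<And>x. x \<in> {0..1} \<Longrightarrow> 0 \<le> \<rho> x \<and> \<rho> x \<le> 1" "\<rho> 0 = \<alpha>" "\<rho> 1 = \<beta>"
    and wk: "- L2_prod \<rho> (frac_Laplacian \<gamma> h) + L2_prod (\<lambda>q. \<alpha> * r_minus \<gamma> q + \<beta> * r_plus \<gamma> q) h = 0"
    using weak hC unfolding weak_solution_def by (auto simp: Pi_iff)
  have \<alpha>\<beta>: "0 \<le> \<alpha>" "\<alpha> \<le> 1" "0 \<le> \<beta>" "\<beta> \<le> 1" using ws(2)[of 0] ws(2)[of 1] ws(3,4) by auto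
  have "continuous_on UNIV \<rho>t"
    unfolding \<rho>t_def by (rule continuous_on_compose2[OF ws(1)]) (auto intro!: continuous_intros)
  then have [measurable]: "\<rho>t \<in> borel_measurable borel" by (rule borel_measurable_continuous_onI)
  have \<rho>b: "0 \<le> \<rho>t y" "\<rho>t y \<le> 1" for y using ws(2) unfolding \<rho>t_def by auto
  have \<rho>in: "\<rho>t y = \<rho> y" if "y \<in> {0..1}" for y using that by (simp add: \<rho>t_def)
  have \<rho>l: "\<rho>t y = \<alpha>" if "y < 0" for y using that ws by (simp add: \<rho>t_def)
  have \<rho>r: "\<rho>t y = \<beta>" if "y > 1" for y using that ws by (simp add: \<rho>t_def)
  have h0: "h w = 0" if "w < 0 \<or> w > 1" for w using supp[of w] that r by fastforce
  have h01: "0 \<le> w" "w \<le> 1" if "h w \<noteq> 0" for w using supp[OF that] r by auto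

  have shift: "(\<integral>y. indicator A y * h (y - z) \<partial>lborel) = (LINT w:{0..1}|lborel. indicator A (w + z) * h w)"
    for A :: "real set" and z
  proof -
    have "(\<integral>y. indicator A y * h (y - z) \<partial>lborel) = (\<integral>w. indicator A (z + 1 * w) * h (z + 1 * w - z) \<partial>lborel)"
      by (subst lborel_integral_real_affine[where c = 1 and t = z]) auto
    also have "\<dots> = (LINT w:{0..1}|lborel. indicator A (w + z) * h w)"
      unfolding set_lebesgue_integral_def
      by (intro Bochner_Integration.integral_cong) (auto simp: indicator_def add.commute dest: h01)
    finally show ?thesis .
  qed
  have split: "g z = (LINT y:{0..1}|lborel. \<rho>t y * h (y - z)) +
      \<alpha> * (LINT w:{0..1}|lborel. indicator {..<0} (w + z) * h w) +
      \<beta> * (LINT w:{0..1}|lborel. indicator {1<..} (w + z) * h w)" for z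
  proof -
    have int: "integrable lborel (\<lambda>y. f y * h (y - z))"
      if [measurable]: "f \<in> borel_measurable borel" and "\<And>y. \<bar>f y\<bar> \<le> 1" for f :: "real \<Rightarrow> real"
    proof (rule bounded_support_integrable[where B = B and a = z and b = "z + 1"])
      show "\<bar>f y * h (y - z)\<bar> \<le> B" for y
        using mult_mono[OF that(2)[of y] bound[of "y - z"]] by (simp add: abs_mult)
      show "f y * h (y - z) = 0" if "y \<notin> {z..z + 1}" for y using h0[of "y - z"] that by auto
    qed simp
    have "g z = (\<integral>y. (indicator {0..1} y * \<rho>t y) * h (y - z) + \<alpha> * (indicator {..<0} y * h (y - z)) +
        \<beta> * (indicator {1<..} y * h (y - z)) \<partial>lborel)"
      unfolding g_def by (intro Bochner_Integration.integral_cong) (auto simp: indicator_def \<rho>l \<rho>r)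
    also have "\<dots> = (\<integral>y. (indicator {0..1} y * \<rho>t y) * h (y - z) \<partial>lborel) +
        \<alpha> * (\<integral>y. indicator {..<0} y * h (y - z) \<partial>lborel) + \<beta> * (\<integral>y. indicator {1<..} y * h (y - z) \<partial>lborel)"
    proof -
      have 1: "integrable lborel (\<lambda>y. (indicator {0..1} y * \<rho>t y) * h (y - z))"
        using \<rho>b by (intro int) (auto simp: indicator_def)
      have 2: "integrable lborel (\<lambda>y. indicator {..<0} y * h (y - z))"
        "integrable lborel (\<lambda>y. indicator {1<..} y * h (y - z))"
        by (intro int; simp add: indicator_def)+
      show ?thesis using 1 2 by simp
    qed
    finally show ?thesis unfolding shift by (simp add: set_lebesgue_integral_def mult.assoc)
  qed

  have iL: "set_integrable lborel {0..1} (\<lambda>y. \<rho>t y * h (y - z))" for z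
  proof (rule bounded_set_integrable_unit[where B = B])
    show "\<bar>\<rho>t y * h (y - z)\<bar> \<le> B" for y
      using mult_mono[of "\<bar>\<rho>t y\<bar>" 1 "\<bar>h (y - z)\<bar>" B] bound[of "y - z"] \<rho>b[of y] by (simp add: abs_mult)
  qed simp
  have zero: "(LINT w:{0..1}|lborel. indicator A (w + z) * h w) = 0"
    if "\<And>w. w \<in> {0..1} \<Longrightarrow> w + z \<notin> A" for A :: "real set" and z
    unfolding set_lebesgue_integral_def using that
    by (intro integral_eq_zero_AE AE_I2) (auto simp: indicator_def)
  let ?H1 = "\<lambda>n w. (if w < ?s n then 1 else 0) * h w"
  let ?H2 = "\<lambda>n w. (if 1 - w < ?s n then 1 else 0) * h w"
  let ?R = "\<lambda>n y. \<rho>t y * sdiff y (?s n)"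
  \<comment> \<open>A shift to the right can push \<open>h\<close> only beyond 1, a shift to the
    left only below 0, and the unshifted term stays inside.\<close>
  have second: "g (?s n) + g (- ?s n) - 2 * g 0 =
     (LINT y:{0..1}|lborel. ?R n y) + \<alpha> * (LINT w:{0..1}|lborel. ?H1 n w) + \<beta> * (LINT w:{0..1}|lborel. ?H2 n w)" for n
  proof -
    have s: "?s n > 0" using d by simp
    have "g (?s n) = (LINT y:{0..1}|lborel. \<rho>t y * h (y - ?s n)) + \<beta> * (LINT w:{0..1}|lborel. ?H2 n w)"
    proof -
      have "(LINT w:{0..1}|lborel. indicator {1<..} (w + ?s n) * h w) = (LINT w:{0..1}|lborel. ?H2 n w)"
        by (intro set_lebesgue_integral_cong) (auto simp: indicator_def)
      then show ?thesis using s unfolding split by (subst zero) (auto simp del: of_nat_Suc)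
    qed
    moreover have "g (- ?s n) = (LINT y:{0..1}|lborel. \<rho>t y * h (y + ?s n)) + \<alpha> * (LINT w:{0..1}|lborel. ?H1 n w)"
    proof -
      have e: "(LINT w:{0..1}|lborel. indicator {..<0} (w + - ?s n) * h w) = (LINT w:{0..1}|lborel. ?H1 n w)"
        by (intro set_lebesgue_integral_cong) (auto simp: indicator_def)
      have "(LINT w:{0..1}|lborel. indicator {1<..} (w + - ?s n) * h w) = 0"
        using s by (intro zero) auto
      then show ?thesis unfolding split e by (simp del: of_nat_Suc)
    qed
    moreover have "g 0 = (LINT y:{0..1}|lborel. \<rho>t y * h y)"
      unfolding split by (subst zero, simp, subst zero) auto
    moreover have "(LINT y:{0..1}|lborel. ?R n y) = (LINT y:{0..1}|lborel. \<rho>t y * h (y + ?s n)) +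
        (LINT y:{0..1}|lborel. \<rho>t y * h (y - ?s n)) - 2 * (LINT y:{0..1}|lborel. \<rho>t y * h y)"
    proof -
      have "(LINT y:{0..1}|lborel. ?R n y) =
        (LINT y:{0..1}|lborel. (\<rho>t y * h (y - - ?s n) + \<rho>t y * h (y - ?s n)) - 2 * (\<rho>t y * h (y - 0)))"
        by (intro set_lebesgue_integral_cong) (auto simp: sdiff_def algebra_simps)
      also have "\<dots> = (LINT y:{0..1}|lborel. \<rho>t y * h (y - - ?s n) + \<rho>t y * h (y - ?s n)) -
          (LINT y:{0..1}|lborel. 2 * (\<rho>t y * h (y - 0)))"
        by (intro set_integral_diff set_integral_add set_integrable_mult_right iL impI)
      also have "(LINT y:{0..1}|lborel. \<rho>t y * h (y - - ?s n) + \<rho>t y * h (y - ?s n)) =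
          (LINT y:{0..1}|lborel. \<rho>t y * h (y - - ?s n)) + (LINT y:{0..1}|lborel. \<rho>t y * h (y - ?s n))"
        by (intro set_integral_add iL)
      finally show ?thesis by (simp del: of_nat_Suc)
    qed
    ultimately show ?thesis by simp
  qed

  have "(\<lambda>n. ?p n * (LINT y:{0..1}|lborel. ?R n y)) sums (LINT y:{0..1}|lborel. (\<Sum>n. ?p n * ?R n y))"
  proof (rule jump_sums_LINT[OF \<gamma>0])
    show "\<bar>?R n y\<bar> \<le> 4 * B" for n y
      using mult_mono[of "\<bar>\<rho>t y\<bar>" 1 "\<bar>sdiff y (?s n)\<bar>" "4 * B"] sdiff_bound'[of y "?s n"] \<rho>b[of y] by (simp add: abs_mult)
  qed measurable
  moreover have H: "(\<lambda>n. ?p n * (LINT w:{0..1}|lborel. ?H1 n w)) sums (LINT w:{0..1}|lborel. (\<Sum>n. ?p n * ?H1 n w))"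
      "(\<lambda>n. ?p n * (LINT w:{0..1}|lborel. ?H2 n w)) sums (LINT w:{0..1}|lborel. (\<Sum>n. ?p n * ?H2 n w))"
    using bound B_nonneg by (intro jump_sums_LINT[OF \<gamma>0, where B = B]; simp)+
  ultimately have "(\<lambda>n. ?p n * (LINT y:{0..1}|lborel. ?R n y) + \<alpha> * (?p n * (LINT w:{0..1}|lborel. ?H1 n w)) +
        \<beta> * (?p n * (LINT w:{0..1}|lborel. ?H2 n w))) sums
     ((LINT y:{0..1}|lborel. (\<Sum>n. ?p n * ?R n y)) + \<alpha> * (LINT w:{0..1}|lborel. (\<Sum>n. ?p n * ?H1 n w)) +
        \<beta> * (LINT w:{0..1}|lborel. (\<Sum>n. ?p n * ?H2 n w)))"
    by (intro sums_add sums_mult)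
  then have total: "(\<Sum>n. ?p n * (g (?s n) + g (- ?s n) - 2 * g 0)) =
     (LINT y:{0..1}|lborel. (\<Sum>n. ?p n * ?R n y)) + \<alpha> * (LINT w:{0..1}|lborel. (\<Sum>n. ?p n * ?H1 n w)) +
        \<beta> * (LINT w:{0..1}|lborel. (\<Sum>n. ?p n * ?H2 n w))"
    unfolding second by (simp add: sums_iff algebra_simps del: of_nat_Suc)
  have s1: "d powr (- \<gamma>) * (LINT y:{0..1}|lborel. (\<Sum>n. ?p n * ?R n y)) = (LINT y:{0..1}|lborel. \<rho>t y * disc_lap \<gamma> d y)"
  proof -
    have "(\<Sum>n. ?p n * ?R n y) = \<rho>t y * (\<Sum>n. ?p n * sdiff y (?s n))" for y
      using suminf_mult[OF summable_jump_mult[OF \<gamma>0, of "\<lambda>n. sdiff y (?s n)" "4 * B"], of "\<rho>t y"] sdiff_bound'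
      by (simp add: mult_ac del: of_nat_Suc)
    then show ?thesis
      unfolding disc_lap_def set_integral_mult_right[symmetric] by (simp add: mult_ac del: of_nat_Suc)
  qed
  have s2: "d powr (- \<gamma>) * (LINT w:{0..1}|lborel. (\<Sum>n. ?p n * ((if f w < ?s n then 1 else 0) * h w))) =
      (LINT w:{0..1}|lborel. tail \<gamma> d (f w) * h w)" for f :: "real \<Rightarrow> real"
  proof -
    have "(\<Sum>n. ?p n * ((if f w < ?s n then 1 else 0) * h w)) = (\<Sum>n. ?p n * (if f w < ?s n then 1 else 0)) * h w" for w
      using suminf_mult2[OF summable_jump_mult[OF \<gamma>0, of "\<lambda>n. if f w < ?s n then 1 else 0" 1], of "h w"]
      by (simp add: mult.assoc del: of_nat_Suc)
    then show ?thesis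
      unfolding tail_def set_integral_mult_right[symmetric] by (simp add: mult_ac del: of_nat_Suc)
  qed
  have lhs: "d powr (- \<gamma>) * (\<Sum>n. ?p n * (g (?s n) + g (- ?s n) - 2 * g 0)) =
     (LINT y:{0..1}|lborel. \<rho>t y * disc_lap \<gamma> d y) + \<alpha> * (LINT w:{0..1}|lborel. tail \<gamma> d w * h w) +
     \<beta> * (LINT w:{0..1}|lborel. tail \<gamma> d (1 - w) * h w)"
    unfolding total s1[symmetric] s2[symmetric] by (simp add: algebra_simps)

  have [measurable]: "frac_Laplacian \<gamma> h \<in> borel_measurable borel" by (rule frac_Laplacian_measurable[OF \<gamma>])
  have [measurable]: "tail \<gamma> d \<in> borel_measurable borel" unfolding tail_def[abs_def] by measurable
  have lap: "\<bar>\<rho>t y * (disc_lap \<gamma> d y + frac_Laplacian \<gamma> h y)\<bar> \<le> ?K" for y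
    using mult_mono[of "\<bar>\<rho>t y\<bar>" 1 "\<bar>disc_lap \<gamma> d y + frac_Laplacian \<gamma> h y\<bar>" ?K]
      disc_lap_frac_Laplacian[OF \<gamma> d, of y] \<rho>b[of y] by (simp add: abs_mult)
  have iD: "set_integrable lborel {0..1} (\<lambda>y. \<rho>t y * disc_lap \<gamma> d y)"
  proof (rule bounded_set_integrable_unit[where B = "d powr (- \<gamma>) * (2 * B)"])
    show "\<bar>\<rho>t y * disc_lap \<gamma> d y\<bar> \<le> d powr (- \<gamma>) * (2 * B)" for y
      using mult_mono[of "\<bar>\<rho>t y\<bar>" 1 "\<bar>disc_lap \<gamma> d y\<bar>" "d powr (- \<gamma>) * (2 * B)"]
        disc_lap_bounded[OF \<gamma>0, of d y] \<rho>b[of y] by (simp add: abs_mult)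
  qed simp
  have iDF: "set_integrable lborel {0..1} (\<lambda>y. \<rho>t y * (disc_lap \<gamma> d y + frac_Laplacian \<gamma> h y))"
    using lap by (intro bounded_set_integrable_unit[where B = ?K]) auto
  have F: "(LINT y:{0..1}|lborel. \<rho>t y * frac_Laplacian \<gamma> h y) =
      (LINT y:{0..1}|lborel. \<rho>t y * (disc_lap \<gamma> d y + frac_Laplacian \<gamma> h y)) - (LINT y:{0..1}|lborel. \<rho>t y * disc_lap \<gamma> d y)"
    unfolding set_integral_diff(2)[OF iDF iD, symmetric]
    by (intro set_lebesgue_integral_cong) (auto simp: algebra_simps)
  have "L2_prod \<rho> (frac_Laplacian \<gamma> h) = (LINT y:{0..1}|lborel. \<rho>t y * frac_Laplacian \<gamma> h y)"
    unfolding L2_prod_def by (intro set_lebesgue_integral_cong) (auto simp: \<rho>in)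
  note F = this[unfolded F]

  let ?e1 = "\<lambda>w. (tail \<gamma> d w - r_minus \<gamma> w) * h w"
  let ?e2 = "\<lambda>w. (tail \<gamma> d (1 - w) - r_plus \<gamma> w) * h w"
  let ?k = "c_const \<gamma> * d * r powr (- (1 + \<gamma>))"
  have tb: "\<bar>tail \<gamma> d v - c_const \<gamma> / \<gamma> * v powr (- \<gamma>)\<bar> \<le> ?k" if "r \<le> v" for v
  proof -
    have "\<bar>tail \<gamma> d v - c_const \<gamma> / \<gamma> * v powr (- \<gamma>)\<bar> \<le> c_const \<gamma> * d * v powr (- (1 + \<gamma>))"
      using that r d \<gamma>0 by (intro tail_bound) auto
    also have "\<dots> \<le> ?k" using that r d c \<gamma>0 by (intro mult_left_mono powr_mono2') auto
    finally show ?thesis .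
  qed
  have k0: "0 \<le> ?k" using c d by simp
  have e1: "\<bar>?e1 w\<bar> \<le> ?k * B" for w
  proof (cases "h w = 0")
    case False
    then show ?thesis unfolding abs_mult r_minus_def using supp[OF False] tb[of w] bound[of w] k0 by (intro mult_mono) auto
  qed (use k0 B_nonneg in simp)
  have e2: "\<bar>?e2 w\<bar> \<le> ?k * B" for w
  proof (cases "h w = 0")
    case False
    then show ?thesis unfolding abs_mult r_plus_def using supp[OF False] tb[of "1 - w"] bound[of w] k0 by (intro mult_mono) auto
  qed (use k0 B_nonneg in simp)
  have [measurable]: "r_minus \<gamma> \<in> borel_measurable borel" "r_plus \<gamma> \<in> borel_measurable borel"
    unfolding r_minus_def[abs_def] r_plus_def[abs_def] by measurable
  have rb: "\<bar>c_const \<gamma> / \<gamma> * v powr (- \<gamma>)\<bar> \<le> c_const \<gamma> / \<gamma> * r powr (- \<gamma>)" if "r \<le> v" for v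
    using that r c \<gamma>0 by (auto simp: abs_mult intro!: mult_left_mono powr_mono2' divide_right_mono)
  let ?q = "c_const \<gamma> / \<gamma> * r powr (- \<gamma>)"
  have q0: "?q \<ge> 0" using c \<gamma>0 by simp
  have im: "set_integrable lborel {0..1} (\<lambda>w. r_minus \<gamma> w * h w)"
  proof (rule bounded_set_integrable_unit[where B = "?q * B"])
    show "\<bar>r_minus \<gamma> w * h w\<bar> \<le> ?q * B" for w
    proof (cases "h w = 0")
      case False
      then have "\<bar>r_minus \<gamma> w\<bar> \<le> ?q" unfolding r_minus_def using supp[OF False] by (intro rb) auto
      then have "\<bar>r_minus \<gamma> w\<bar> * \<bar>h w\<bar> \<le> ?q * B" using bound[of w] q0 by (intro mult_mono) auto
      then show ?thesis by (simp only: abs_mult)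
    qed (use mult_nonneg_nonneg[OF q0 B_nonneg] in simp)
  qed simp
  have ip: "set_integrable lborel {0..1} (\<lambda>w. r_plus \<gamma> w * h w)"
  proof (rule bounded_set_integrable_unit[where B = "?q * B"])
    show "\<bar>r_plus \<gamma> w * h w\<bar> \<le> ?q * B" for w
    proof (cases "h w = 0")
      case False
      then have "\<bar>r_plus \<gamma> w\<bar> \<le> ?q" unfolding r_plus_def using supp[OF False] by (intro rb) auto
      then have "\<bar>r_plus \<gamma> w\<bar> * \<bar>h w\<bar> \<le> ?q * B" using bound[of w] q0 by (intro mult_mono) auto
      then show ?thesis by (simp only: abs_mult)
    qed (use mult_nonneg_nonneg[OF q0 B_nonneg] in simp)
  qed simp
  have ie1: "set_integrable lborel {0..1} ?e1" and ie2: "set_integrable lborel {0..1} ?e2"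
    using e1 e2 by (intro bounded_set_integrable_unit[where B = "?k * B"]; simp)+
  have t1: "(LINT w:{0..1}|lborel. tail \<gamma> d w * h w) = (LINT w:{0..1}|lborel. ?e1 w) + (LINT w:{0..1}|lborel. r_minus \<gamma> w * h w)"
    unfolding set_integral_add(2)[OF ie1 im, symmetric] by (intro set_lebesgue_integral_cong) (auto simp: algebra_simps)
  have t2: "(LINT w:{0..1}|lborel. tail \<gamma> d (1 - w) * h w) = (LINT w:{0..1}|lborel. ?e2 w) + (LINT w:{0..1}|lborel. r_plus \<gamma> w * h w)"
    unfolding set_integral_add(2)[OF ie2 ip, symmetric] by (intro set_lebesgue_integral_cong) (auto simp: algebra_simps)
  have "L2_prod (\<lambda>q. \<alpha> * r_minus \<gamma> q + \<beta> * r_plus \<gamma> q) h =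
      (LINT w:{0..1}|lborel. \<alpha> * (r_minus \<gamma> w * h w) + \<beta> * (r_plus \<gamma> w * h w))"
    unfolding L2_prod_def by (intro set_lebesgue_integral_cong) (auto simp: algebra_simps)
  also have "\<dots> = \<alpha> * (LINT w:{0..1}|lborel. r_minus \<gamma> w * h w) + \<beta> * (LINT w:{0..1}|lborel. r_plus \<gamma> w * h w)"
    using im ip by simp
  finally have L: "L2_prod (\<lambda>q. \<alpha> * r_minus \<gamma> q + \<beta> * r_plus \<gamma> q) h =
    \<alpha> * (LINT w:{0..1}|lborel. r_minus \<gamma> w * h w) + \<beta> * (LINT w:{0..1}|lborel. r_plus \<gamma> w * h w)" .
  \<comment> \<open>The main terms add up to the left side of \<open>wk\<close>, so only the
    replacement errors remain.\<close>
  have "d powr (- \<gamma>) * (\<Sum>n. ?p n * (g (?s n) + g (- ?s n) - 2 * g 0)) =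
     (LINT y:{0..1}|lborel. \<rho>t y * (disc_lap \<gamma> d y + frac_Laplacian \<gamma> h y)) +
     (\<alpha> * (LINT w:{0..1}|lborel. ?e1 w) + \<beta> * (LINT w:{0..1}|lborel. ?e2 w))"
    using wk unfolding lhs t1 t2 L F by (simp add: distrib_left)
  moreover have "\<bar>LINT y:{0..1}|lborel. \<rho>t y * (disc_lap \<gamma> d y + frac_Laplacian \<gamma> h y)\<bar> \<le> ?K"
    using lap by (intro LINT_unit_bound) auto
  moreover have "\<bar>\<alpha> * (LINT w:{0..1}|lborel. ?e1 w)\<bar> \<le> 1 * (?k * B)"
    unfolding abs_mult using e1 \<alpha>\<beta> by (intro mult_mono LINT_unit_bound) auto
  moreover have "\<bar>\<beta> * (LINT w:{0..1}|lborel. ?e2 w)\<bar> \<le> 1 * (?k * B)"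
    unfolding abs_mult using e2 \<alpha>\<beta> by (intro mult_mono LINT_unit_bound) auto
  moreover have "2 * B * c_const \<gamma> * d * r powr (- (1 + \<gamma>)) = 1 * (?k * B) + 1 * (?k * B)" by simp
  ultimately show ?thesis by linarith
qed

section \<open>An explicit twice differentiable mollifier\<close>

lemma max0_power_deriv:
  "n \<ge> 1 \<Longrightarrow> ((\<lambda>u::real. (max 0 u) ^ Suc n) has_real_derivative (real (Suc n) * (max 0 u) ^ n)) (at u)"
proof -
  assume n: "n \<ge> 1"
  consider "u > 0" | "u < 0" | "u = 0" by linarith
  then show ?thesis
  proof cases
    case 1
    have "((\<lambda>u::real. u ^ Suc n) has_real_derivative (real (Suc n) * (max 0 u) ^ n)) (at u)"
      using DERIV_pow[of "Suc n" u] 1 by (simp add: max_def del: power_Suc)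
    then show ?thesis
      by (rule has_field_derivative_transform_within_open[where S = "{0<..}"]) (use 1 in \<open>auto simp: max_def\<close>)
  next
    case 2
    have "((\<lambda>u::real. 0) has_real_derivative (real (Suc n) * (max 0 u) ^ n)) (at u)"
      using 2 n by (cases n) (auto simp: max_def)
    then show ?thesis
      by (rule has_field_derivative_transform_within_open[where S = "{..<0}"]) (use 2 in \<open>auto simp: max_def\<close>)
  next
    case 3
    have "((\<lambda>h::real. (max 0 h) ^ n) \<longlongrightarrow> (max 0 0) ^ n) (at 0)"
      by (intro tendsto_intros)
    moreover have "(max 0 0) ^ n = (0::real)" using n by simp
    ultimately have "((\<lambda>h::real. (max 0 h) ^ n) \<longlongrightarrow> 0) (at 0)" by (simp only:)
    then have "((\<lambda>h::real. (max 0 h) ^ Suc n / h) \<longlongrightarrow> 0) (at 0)"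
      by (rule Lim_transform_eventually) (use n in \<open>auto simp: eventually_at_filter max_def\<close>)
    then show ?thesis using 3 n by (cases n) (auto simp: has_field_derivative_iff)
  qed
qed

text \<open>The kernel is the normalised cube of \<open>r\<^sup>2 - y\<^sup>2\<close> cut off at 0;
  the cube is the smallest integer power whose second derivative is continuous at the edge of the
  support.\<close>

lemma mollifier_exists:
  fixes r :: real
  assumes r: "r > 0"
  obtains k k' k'' C B where "bounded_C2 k k' k'' C B" "continuous_on UNIV k''" "\<And>y. 0 \<le> k y"
    "\<And>y. k y \<noteq> 0 \<Longrightarrow> \<bar>y\<bar> \<le> r" "integrable lborel k" "(\<integral>y. k y \<partial>lborel) = 1"
proof -
  define p where "p y = max 0 (r\<^sup>2 - y\<^sup>2)" for y
  define \<phi> where "\<phi> y = p y ^ 3" for y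
  have p0: "0 \<le> p y" "p y \<le> r\<^sup>2" for y by (auto simp: p_def)
  have psupp: "p y = 0" if "\<bar>y\<bar> \<ge> r" for y
    using that r power_mono[of r "\<bar>y\<bar>" 2] by (simp add: p_def max_def)
  have py: "p y * y\<^sup>2 \<le> r\<^sup>2 * r\<^sup>2" for y
  proof (cases "\<bar>y\<bar> \<ge> r")
    case False
    then have "\<bar>y\<bar>\<^sup>2 \<le> r\<^sup>2" by (intro power_mono) auto
    then show ?thesis using p0[of y] by (intro mult_mono) auto
  qed (simp add: psupp)
  have cont: "continuous_on UNIV p" unfolding p_def[abs_def] by (intro continuous_intros)
  have c\<phi>: "continuous_on UNIV \<phi>" unfolding \<phi>_def[abs_def] by (intro continuous_intros cont)
  then have [measurable]: "\<phi> \<in> borel_measurable borel" by (rule borel_measurable_continuous_onI)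
  have \<phi>0: "0 \<le> \<phi> y" for y using p0[of y] by (simp add: \<phi>_def)
  have \<phi>b: "\<phi> y \<le> (r\<^sup>2) ^ 3" for y unfolding \<phi>_def by (rule power_mono[OF p0(2,1)])
  have \<phi>s: "\<phi> y = 0" if "\<bar>y\<bar> \<ge> r" for y using psupp[OF that] by (simp add: \<phi>_def)
  have int: "integrable lborel \<phi>"
    by (rule bounded_support_integrable[where B = "(r\<^sup>2) ^ 3" and a = "-r" and b = r]) (use \<phi>0 \<phi>b \<phi>s in auto)
  define J where "J = (\<integral>y. \<phi> y \<partial>lborel)"
  \<comment> \<open>A lower bound that makes the total mass positive: on \<open>{0..r/2}\<close> one
    has \<open>p y \<ge> r\<^sup>2 / 2\<close>.\<close>
  have "(\<integral>y. (r\<^sup>2 / 2) ^ 3 * indicator {0..r/2} y \<partial>lborel) \<le> J"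
    unfolding J_def
  proof (rule Bochner_Integration.integral_mono[OF _ int])
    show "integrable lborel (\<lambda>y. (r\<^sup>2 / 2) ^ 3 * indicator {0..r/2} y)"
      by (intro integrable_mult_right integrable_real_indicator) (auto simp: emeasure_lborel_Icc_eq)
    show "(r\<^sup>2 / 2) ^ 3 * indicator {0..r/2} y \<le> \<phi> y" for y
    proof (cases "y \<in> {0..r/2}")
      case True
      then have "y\<^sup>2 \<le> (r/2)\<^sup>2" by (intro power_mono) auto
      then have "y\<^sup>2 \<le> r\<^sup>2 / 4" by (simp add: power_divide)
      then have "r\<^sup>2 / 2 \<le> r\<^sup>2 - y\<^sup>2" using zero_le_power2[of r] by linarith
      also have "\<dots> \<le> p y" by (simp add: p_def)
      finally have "r\<^sup>2 / 2 \<le> p y" .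
      then have "(r\<^sup>2 / 2) ^ 3 \<le> \<phi> y" unfolding \<phi>_def by (intro power_mono) auto
      then show ?thesis using True by simp
    qed (use \<phi>0 in simp)
  qed
  moreover have "(\<integral>y. (r\<^sup>2 / 2) ^ 3 * indicator {0..r/2} y \<partial>lborel) = (r\<^sup>2 / 2) ^ 3 * (r / 2)"
    using r by simp
  moreover have "(r\<^sup>2 / 2) ^ 3 * (r / 2) > 0" using r by simp
  ultimately have J: "J > 0" by linarith
  let ?k = "\<lambda>y. \<phi> y / J"
  let ?k' = "\<lambda>y. 3 * (p y)\<^sup>2 * (- 2 * y) / J"
  let ?k'' = "\<lambda>y. (24 * (p y * y\<^sup>2) - 6 * (p y)\<^sup>2) / J"
  have inner: "((\<lambda>y. r\<^sup>2 - y\<^sup>2) has_real_derivative (- 2 * y)) (at y)" for y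
    by (auto intro!: derivative_eq_intros)
  have d3: "(\<phi> has_real_derivative 3 * (p y)\<^sup>2 * (- 2 * y)) (at y)" for y
    using DERIV_chain2[OF max0_power_deriv[of 2] inner, of y]
    by (simp add: \<phi>_def[abs_def] p_def[abs_def] numeral_3_eq_3 numeral_2_eq_2 del: power_Suc)
  have d2: "((\<lambda>y. (p y)\<^sup>2) has_real_derivative 2 * p y * (- 2 * y)) (at y)" for y
    using DERIV_chain2[OF max0_power_deriv[of 1] inner, of y]
    by (simp add: p_def[abs_def] numeral_2_eq_2 del: power_Suc)
  show ?thesis
  proof
    show "bounded_C2 ?k ?k' ?k'' (30 * (r\<^sup>2 * r\<^sup>2) / J) ((r\<^sup>2) ^ 3 / J)"
    proof
      show "(?k has_real_derivative ?k' q) (at q)" for q by (intro DERIV_cdivide d3)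
      show "(?k' has_real_derivative ?k'' q) (at q)" for q
      proof -
        have "((\<lambda>y. (p y)\<^sup>2 * (- 6 * y)) has_real_derivative (2 * p q * (- 2 * q)) * (- 6 * q) + (- 6) * (p q)\<^sup>2) (at q)"
          by (rule DERIV_mult[OF d2]) (auto intro!: derivative_eq_intros)
        from DERIV_cdivide[OF this, of J] show ?thesis
          by (simp add: algebra_simps power2_eq_square)
      qed
      show "\<bar>?k q\<bar> \<le> (r\<^sup>2) ^ 3 / J" for q using \<phi>0[of q] \<phi>b[of q] J by (simp add: divide_right_mono)
      \<comment> \<open>The 30 is 24 + 6, as both \<open>p q * q\<^sup>2\<close> and
        \<open>(p q)\<^sup>2\<close> are at most \<open>r\<^sup>2 * r\<^sup>2\<close>.\<close>
      show "\<bar>?k'' q\<bar> \<le> 30 * (r\<^sup>2 * r\<^sup>2) / J" for q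
      proof -
        have "(p q)\<^sup>2 \<le> r\<^sup>2 * r\<^sup>2" unfolding power2_eq_square[of "p q"] using p0[of q] by (intro mult_mono) auto
        moreover have "0 \<le> p q * q\<^sup>2" "0 \<le> (p q)\<^sup>2" using p0[of q] by auto
        ultimately have "\<bar>24 * (p q * q\<^sup>2) - 6 * (p q)\<^sup>2\<bar> \<le> 30 * (r\<^sup>2 * r\<^sup>2)" using py[of q] by linarith
        then show ?thesis using J by (simp add: divide_right_mono)
      qed
    qed
    show "continuous_on UNIV ?k''" using J by (intro continuous_intros cont) auto
    show "0 \<le> ?k y" for y using \<phi>0 J by simp
    show "\<bar>y\<bar> \<le> r" if "?k y \<noteq> 0" for y using \<phi>s[of y] that by force
    show "integrable lborel ?k" using int by simp
    show "(\<integral>y. ?k y \<partial>lborel) = 1" using J by (simp add: J_def)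
  qed
qed

text \<open>Mollification evaluates the kernel at \<open>q - w\<close>; as a function of
  \<open>w\<close> this is the test function belonging to the point \<open>q\<close>.\<close>

lemma (in bounded_C2) reflected:
  "bounded_C2 (\<lambda>w. h (q - w)) (\<lambda>w. - h' (q - w)) (\<lambda>w. h'' (q - w)) C B"
proof
  show "((\<lambda>w. h (q - w)) has_real_derivative - h' (q - w)) (at w)" for w
  proof -
    have "((\<lambda>w. h (q - w)) has_real_derivative h' (q - w) * (-1)) (at w)"
      by (rule DERIV_chain2[OF deriv]) (auto intro!: derivative_eq_intros)
    then show ?thesis by simp
  qed
  show "((\<lambda>w. - h' (q - w)) has_real_derivative h'' (q - w)) (at w)" for w
  proof -
    have "((\<lambda>w. h' (q - w)) has_real_derivative h'' (q - w) * (-1)) (at w)"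
      by (rule DERIV_chain2[OF deriv2]) (auto intro!: derivative_eq_intros)
    from DERIV_minus[OF this] show ?thesis by simp
  qed
qed (use bound bound2 in auto)

lemma mollify_close:
  fixes \<rho> k :: "real \<Rightarrow> real"
  assumes [measurable]: "\<rho> \<in> borel_measurable borel" and \<rho>: "\<And>y. \<bar>\<rho> y\<bar> \<le> M"
    and k: "\<And>y. 0 \<le> k y" "\<And>y. k y \<noteq> 0 \<Longrightarrow> \<bar>y\<bar> \<le> r" "integrable lborel k" "(\<integral>y. k y \<partial>lborel) = 1"
    and near: "\<And>y. \<bar>q - y\<bar> \<le> r \<Longrightarrow> \<bar>\<rho> y - c\<bar> \<le> e"
  shows "\<bar>(\<integral>y. \<rho> y * k (q - y) \<partial>lborel) - c\<bar> \<le> e"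
proof -
  have i: "integrable lborel (\<lambda>y. k (q - y))" and i1: "(\<integral>y. k (q - y) \<partial>lborel) = 1"
    using lborel_integrable_real_affine[OF k(3), of "-1" q] lborel_integral_real_affine[of "-1" k q] k(4)
    by simp_all
  have i2: "integrable lborel (\<lambda>y. \<rho> y * k (q - y))"
  proof (rule Bochner_Integration.integrable_bound[OF integrable_mult_right[OF i, of M]])
    show "AE y in lborel. norm (\<rho> y * k (q - y)) \<le> norm (M * k (q - y))"
    proof (rule AE_I2)
      fix y
      have "\<bar>\<rho> y\<bar> * \<bar>k (q - y)\<bar> \<le> \<bar>M\<bar> * \<bar>k (q - y)\<bar>" using \<rho>[of y] by (intro mult_right_mono) auto
      then show "norm (\<rho> y * k (q - y)) \<le> norm (M * k (q - y))" by (simp add: abs_mult)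
    qed
  qed (use i in measurable)
  have i3: "integrable lborel (\<lambda>y. (\<rho> y - c) * k (q - y))"
    using Bochner_Integration.integrable_diff[OF i2 integrable_mult_right[OF i, of c]] by (simp add: left_diff_distrib)
  have "(\<integral>y. \<rho> y * k (q - y) \<partial>lborel) - c = (\<integral>y. \<rho> y * k (q - y) \<partial>lborel) - (\<integral>y. c * k (q - y) \<partial>lborel)"
    using i1 by simp
  also have "\<dots> = (\<integral>y. (\<rho> y - c) * k (q - y) \<partial>lborel)"
    using Bochner_Integration.integral_diff[OF i2 integrable_mult_right[OF i, of c]] by (simp add: left_diff_distrib)
  also have "\<bar>\<dots>\<bar> \<le> (\<integral>y. \<bar>(\<rho> y - c) * k (q - y)\<bar> \<partial>lborel)" by (rule integral_abs_bound)
  also have "\<dots> \<le> (\<integral>y. e * k (q - y) \<partial>lborel)"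
  proof (rule Bochner_Integration.integral_mono)
    show "\<bar>(\<rho> y - c) * k (q - y)\<bar> \<le> e * k (q - y)" for y
    proof (cases "k (q - y) = 0")
      case False
      then show ?thesis using near[of y] k(2)[OF False] k(1)[of "q - y"] by (simp add: abs_mult mult_right_mono)
    qed simp
  qed (use i i3 in auto)
  also have "\<dots> = e" using i1 by simp
  finally show ?thesis .
qed

section \<open>Convergence of the mean profile\<close>

text \<open>\<open>profile\<close> is compared with the mollified solution \<open>f\<close> on the
  sites \<open>S\<close> at distance at least \<open>2 * r\<close> from the ends. Off
  \<open>S\<close> there are three errors of size \<open>e\<close>: barrier, oscillation of the
  solution, mollification; the fourth comes from undoing the mollification at the end. The factor
  \<open>N powr \<gamma>\<close> of the maximum principle cancels the
  \<open>(1 / N) powr \<gamma>\<close> from rescaling the consistency error.\<close>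

lemma (in stationary_exclusion) profile_error:
  fixes \<rho> :: "real \<Rightarrow> real"
  assumes \<gamma>2: "\<gamma> < 2" and weak: "weak_solution \<gamma> a b \<rho>" and k: "bounded_C2 k k' k'' C B" "continuous_on UNIV k''" "\<And>y. 0 \<le> k y"
    "\<And>y. k y \<noteq> 0 \<Longrightarrow> \<bar>y\<bar> \<le> r" "integrable lborel k" "(\<integral>y. k y \<partial>lborel) = 1"
    and r: "0 < r" and e: "e > 0" and er: "(2 * r) powr ((\<gamma> - 1) / \<gamma>\<^sup>2) \<le> e"
    and uc: "\<And>y y'. \<bar>y - y'\<bar> \<le> 2 * r \<Longrightarrow> \<bar>\<rho> (max 0 (min 1 y)) - \<rho> (max 0 (min 1 y'))\<bar> \<le> e"
  shows "\<bar>profile x - \<rho> (max 0 (min 1 (real_of_int x / real N)))\<bar> \<le> 4 * e +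
    (c_const \<gamma> * (5 * (\<Sum>n. real (n + 1) powr (- \<gamma>)) + 1 / (2 - \<gamma>)) * C * (1 / real N) powr (2 - \<gamma>)
      + 2 * B * c_const \<gamma> * (1 / real N) * r powr (- (1 + \<gamma>))) / kill \<gamma>"
proof -
  define \<rho>t where "\<rho>t y = \<rho> (max 0 (min 1 y))" for y
  define F where "F q = (\<integral>y. \<rho>t y * k (q - y) \<partial>lborel)" for q
  define f where "f x = F (real_of_int x / real N)" for x
  let ?d = "1 / real N"
  let ?Err = "c_const \<gamma> * (5 * (\<Sum>n. real (n + 1) powr (- \<gamma>)) + 1 / (2 - \<gamma>)) * C * ?d powr (2 - \<gamma>)
      + 2 * B * c_const \<gamma> * ?d * r powr (- (1 + \<gamma>))"
  have d: "?d > 0" using N by simp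
  have ws: "continuous_on {0..1} \<rho>" "\<And>x. x \<in> {0..1} \<Longrightarrow> 0 \<le> \<rho> x \<and> \<rho> x \<le> 1" "\<rho> 0 = a" "\<rho> 1 = b"
    using weak unfolding weak_solution_def by (auto simp: Pi_iff)
  have "continuous_on UNIV \<rho>t"
    unfolding \<rho>t_def[abs_def] by (rule continuous_on_compose2[OF ws(1)]) (auto intro!: continuous_intros)
  then have meas: "\<rho>t \<in> borel_measurable borel" by (rule borel_measurable_continuous_onI)
  have \<rho>b: "\<bar>\<rho>t y\<bar> \<le> 1" for y using ws(2)[of "max 0 (min 1 y)"] by (simp add: \<rho>t_def)
  have close: "\<bar>F q - \<rho>t q\<bar> \<le> e" for q
    unfolding F_def
  proof (rule mollify_close[OF meas \<rho>b k(3-6)])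
    show "\<bar>\<rho>t y - \<rho>t q\<bar> \<le> e" if "\<bar>q - y\<bar> \<le> r" for y
      using uc[of y q] that r by (simp add: \<rho>t_def abs_minus_commute)
  qed
  have fb: "\<bar>f x\<bar> \<le> 1 + e" for x
    using close[of "real_of_int x / real N"] \<rho>b[of "real_of_int x / real N"] unfolding f_def by linarith
  \<comment> \<open>The margin \<open>2 * r\<close> puts the support of the kernel around such a
    site, of radius \<open>r\<close>, into \<open>{r..1 - r}\<close>.\<close>
  define S where "S = {x \<in> bulk N. 2 * r \<le> real_of_int x / real N \<and> real_of_int x / real N \<le> 1 - 2 * r}"
  have in_S: "\<bar>avg \<gamma> f x - f x\<bar> \<le> ?d powr \<gamma> * ?Err" if x: "x \<in> S" for x
  proof -
    define q where "q = real_of_int x / real N"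
    have q: "2 * r \<le> q" "q \<le> 1 - 2 * r" using x by (auto simp: S_def q_def)
    let ?h = "\<lambda>w. k (q - w)"
    interpret h: bounded_C2 ?h "\<lambda>w. - k' (q - w)" "\<lambda>w. k'' (q - w)" C B
      by (rule bounded_C2.reflected[OF k(1)])
    have sub: "closure {w. ?h w \<noteq> 0} \<subseteq> {q - r..q + r}"
    proof (rule closure_minimal)
      show "{w. ?h w \<noteq> 0} \<subseteq> {q - r..q + r}" using k(4) by fastforce
    qed simp
    then have cp: "compact (closure {w. ?h w \<noteq> 0})"
      by (meson bounded_closed_interval bounded_subset closed_closure compact_eq_bounded_closed)
    have "continuous_on UNIV (\<lambda>w. k'' (q - w))"
      by (rule continuous_on_compose2[OF k(2)]) (auto intro!: continuous_intros)
    then have hC: "?h \<in> C2c"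
      unfolding C2c_def using h.deriv h.deriv2 sub cp q r by fastforce
    \<comment> \<open>Since \<open>?h (y - z) = k (q + z - y)\<close>, the mollification at shift
      \<open>z\<close> is \<open>F (q + z)\<close>; shifts by multiples of \<open>1 / N\<close> are
      therefore lattice values of \<open>f\<close>.\<close>
    have "\<bar>?d powr (- \<gamma>) * (\<Sum>n. jump \<gamma> (int (Suc n)) *
        ((\<integral>y. \<rho> (max 0 (min 1 y)) * ?h (y - real (Suc n) * ?d) \<partial>lborel) +
         (\<integral>y. \<rho> (max 0 (min 1 y)) * ?h (y - - (real (Suc n) * ?d)) \<partial>lborel) -
         2 * (\<integral>y. \<rho> (max 0 (min 1 y)) * ?h (y - 0) \<partial>lborel)))\<bar> \<le> ?Err"
    proof (rule h.mollified_near_harmonic[OF \<gamma> \<gamma>2 weak hC _ r d])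
      show "r \<le> w \<and> w \<le> 1 - r" if "k (q - w) \<noteq> 0" for w using k(4)[OF that] q by linarith
    qed
    moreover have "(\<integral>y. \<rho> (max 0 (min 1 y)) * ?h (y - real (Suc n) * ?d) \<partial>lborel) = f (x + int (Suc n))" for n
      unfolding f_def F_def \<rho>t_def q_def by (simp add: add_divide_distrib algebra_simps)
    moreover have "(\<integral>y. \<rho> (max 0 (min 1 y)) * ?h (y - - (real (Suc n) * ?d)) \<partial>lborel) = f (x - int (Suc n))" for n
      unfolding f_def F_def \<rho>t_def q_def by (simp add: add_divide_distrib diff_divide_distrib algebra_simps)
    moreover have "(\<integral>y. \<rho> (max 0 (min 1 y)) * ?h (y - 0) \<partial>lborel) = f x"
      unfolding f_def F_def \<rho>t_def q_def by simp
    ultimately have "\<bar>?d powr (- \<gamma>) * (avg \<gamma> f x - f x)\<bar> \<le> ?Err"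
      using sums_unique[OF avg_minus_self[of \<gamma> f "1 + e" x, OF \<gamma>0 fb]] by (simp only:)
    then have "?d powr (- \<gamma>) * \<bar>avg \<gamma> f x - f x\<bar> \<le> ?Err" by (simp add: abs_mult)
    then have "?d powr \<gamma> * (?d powr (- \<gamma>) * \<bar>avg \<gamma> f x - f x\<bar>) \<le> ?d powr \<gamma> * ?Err"
      by (intro mult_left_mono) auto
    moreover have "?d powr \<gamma> * ?d powr (- \<gamma>) = 1" using N by (simp add: powr_add[symmetric])
    ultimately show ?thesis by (simp only: mult.assoc[symmetric] mult_1_left)
  qed
  have out: "\<bar>profile y - f y\<bar> \<le> 3 * e" if y: "y \<notin> S" for y
  proof -
    let ?q = "real_of_int y / real N"
    have f: "\<bar>f y - \<rho>t ?q\<bar> \<le> e" unfolding f_def by (rule close)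
    have be: "barrier \<gamma> N z \<le> e" if "real_of_int z / real N < 2 * r" for z
    proof (cases "z \<le> 0")
      case True
      then have "real_of_int z / real N \<le> 0" using N by (intro divide_nonpos_pos) auto
      then have "barrier \<gamma> N z = 0" by (simp add: barrier_def)
      then show ?thesis using e by simp
    next
      case False
      have "barrier \<gamma> N z \<le> (2 * r) powr ((\<gamma> - 1) / \<gamma>\<^sup>2)"
        unfolding barrier_def using that barrier_exponent[OF \<gamma>] r by (intro powr_mono2) auto
      then show ?thesis using er by linarith
    qed
    have sides: "profile y = a" if "y \<le> 0" for y using that by (simp add: profile_def)
    have sides': "profile y = b" if "y \<ge> int N" for y using that N by (simp add: profile_def)
    consider "?q < 2 * r" | "?q > 1 - 2 * r"
    proof -
      consider "y \<in> bulk N" | "y \<le> 0" | "y \<ge> int N" by (force simp: bulk_def)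
      then show ?thesis
      proof cases
        case 1
        then show ?thesis using y that unfolding S_def by force
      next
        case 2
        then have "?q \<le> 0" using N by (intro divide_nonpos_pos) auto
        then show ?thesis using that(1) r by linarith
      next
        case 3
        then have "?q \<ge> 1" using N by simp
        then show ?thesis using that(2) r by linarith
      qed
    qed
    then show ?thesis
    proof cases
      case 1
      have "\<bar>profile y - a\<bar> \<le> barrier \<gamma> N y"
        using a b by (intro harmonic_near_left[OF \<gamma> N profile_bounded profile_harmonic]) (auto simp: sides sides')
      then have "\<bar>profile y - a\<bar> \<le> e" using be[OF 1] by linarith
      moreover have "\<bar>\<rho>t ?q - a\<bar> \<le> e"
      proof (cases "?q \<le> 0")
        case True then show ?thesis using e ws by (simp add: \<rho>t_def)
      next
        case False
        then show ?thesis using uc[of ?q 0] 1 ws by (simp add: \<rho>t_def)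
      qed
      ultimately show ?thesis using f by linarith
    next
      case 2
      have "real_of_int (int N - y) / real N < 2 * r" using 2 N by (simp add: diff_divide_distrib)
      note be' = be[OF this]
      have "\<bar>profile y - b\<bar> \<le> barrier \<gamma> N (int N - y)"
        using a b by (intro harmonic_near_right[OF \<gamma> N profile_bounded profile_harmonic]) (auto simp: sides sides')
      then have "\<bar>profile y - b\<bar> \<le> e" using be' by linarith
      moreover have "\<bar>\<rho>t ?q - b\<bar> \<le> e"
      proof (cases "?q \<ge> 1")
        case True then show ?thesis using e ws by (simp add: \<rho>t_def)
      next
        case False
        then show ?thesis using uc[of ?q 1] 2 ws by (simp add: \<rho>t_def)
      qed
      ultimately show ?thesis using f by linarith
    qed
  qed
  have Err0: "0 \<le> ?d powr \<gamma> * ?Err"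
  proof -
    have "0 \<le> C" "0 \<le> B" using bounded_C2.C_nonneg[OF k(1)] bounded_C2.B_nonneg[OF k(1)] by auto
    moreover have "0 \<le> (\<Sum>n. real (n + 1) powr (- \<gamma>))"
      using summable_shift_powr[of "-\<gamma>" 1] \<gamma> by (intro suminf_nonneg) auto
    ultimately show ?thesis using c_const_pos[OF \<gamma>0] \<gamma>2 by (intro mult_nonneg_nonneg add_nonneg_nonneg) auto
  qed
  have SN: "S \<subseteq> bulk N" by (auto simp: S_def)
  have eq: "?d powr \<gamma> * ?Err * real N powr \<gamma> / kill \<gamma> = ?Err / kill \<gamma>"
  proof -
    have "?d powr \<gamma> * real N powr \<gamma> = 1" using N by (simp add: powr_divide)
    then have "(?d powr \<gamma> * real N powr \<gamma>) * ?Err / kill \<gamma> = ?Err / kill \<gamma>" by simp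
    then show ?thesis by (simp only: mult_ac)
  qed
  have pS: "avg \<gamma> profile x = profile x" if "x \<in> S" for x using profile_harmonic SN that by blast
  have "profile x - f x \<le> 3 * e + ?d powr \<gamma> * ?Err * real N powr \<gamma> / kill \<gamma>"
  proof (rule avg_max_principle[OF \<gamma>0 N SN Err0])
    show "\<bar>profile y - f y\<bar> \<le> 1 + (1 + e)" for y using profile_bounded[of y] fb[of y] by linarith
    show "profile y - f y - ?d powr \<gamma> * ?Err \<le> avg \<gamma> (\<lambda>y. profile y - f y) y" if "y \<in> S" for y
      using in_S[OF that] pS[OF that] avg_diff[OF \<gamma>0 profile_bounded fb] by (simp only: abs_le_iff) linarith
    show "profile y - f y \<le> 3 * e" if "y \<notin> S" for y using out[OF that] by linarith
  qed
  moreover have "f x - profile x \<le> 3 * e + ?d powr \<gamma> * ?Err * real N powr \<gamma> / kill \<gamma>"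
  proof (rule avg_max_principle[OF \<gamma>0 N SN Err0])
    show "\<bar>f y - profile y\<bar> \<le> 1 + (1 + e)" for y using profile_bounded[of y] fb[of y] by linarith
    show "f y - profile y - ?d powr \<gamma> * ?Err \<le> avg \<gamma> (\<lambda>y. f y - profile y) y" if "y \<in> S" for y
      using in_S[OF that] pS[OF that] avg_diff[OF \<gamma>0 fb profile_bounded] by (simp only: abs_le_iff) linarith
    show "f y - profile y \<le> 3 * e" if "y \<notin> S" for y using out[OF that] by linarith
  qed
  moreover have "\<bar>f x - \<rho>t (real_of_int x / real N)\<bar> \<le> e" unfolding f_def by (rule close)
  ultimately show ?thesis unfolding eq \<rho>t_def by linarith
qed


section \<open>The law of large numbers\<close>

text \<open>Induction over the cells: each left-endpoint cell errs by at most \<open>e / 2\<close>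
  times its width, by uniform continuity.\<close>

lemma riemann_sum_limit:
  fixes \<Phi> :: "real \<Rightarrow> real"
  assumes cont: "continuous_on {0..1} \<Phi>"
  shows "(\<lambda>N. (\<Sum>z<N. \<Phi> (real z / real N)) / real N) \<longlonglongrightarrow> (LINT q:{0..1}|lborel. \<Phi> q)"
proof (rule LIMSEQ_I)
  fix e :: real assume e: "e > 0"
  have L: "(LINT q:{0..1}|lborel. \<Phi> q) = integral {0..1} \<Phi>"
    by (rule set_borel_integral_eq_integral(2)[OF borel_integrable_atLeastAtMost'[OF cont]])
  have "uniformly_continuous_on {0..1} \<Phi>" by (rule compact_uniformly_continuous[OF cont]) simp
  then obtain \<delta> where \<delta>: "\<delta> > 0" "\<And>x y. x \<in> {0..1} \<Longrightarrow> y \<in> {0..1} \<Longrightarrow> \<bar>y - x\<bar> < \<delta> \<Longrightarrow> \<bar>\<Phi> y - \<Phi> x\<bar> < e / 2"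
    using e unfolding uniformly_continuous_on_def dist_real_def by (meson half_gt_zero)
  obtain N0 where N0: "1 / \<delta> < real N0" using reals_Archimedean2 by blast
  show "\<exists>no. \<forall>n\<ge>no. norm ((\<Sum>z<n. \<Phi> (real z / real n)) / real n - (LINT q:{0..1}|lborel. \<Phi> q)) < e"
  proof (intro exI allI impI)
    fix N assume N: "N \<ge> Suc N0"
    then have N1: "real N > 0" by simp
    have "1 / \<delta> < real N" using N N0 by simp
    then have h: "1 / real N < \<delta>" using N1 \<delta>(1) by (simp add: field_simps)
    have "\<bar>integral {0..real m / real N} \<Phi> - (\<Sum>z<m. \<Phi> (real z / real N)) / real N\<bar> \<le> real m / real N * (e / 2)"
      if "m \<le> N" for m
      using that
    proof (induction m)
      case (Suc m)
      let ?u = "real m / real N" and ?v = "real (Suc m) / real N"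
      have uv: "0 \<le> ?u" "?u \<le> ?v" "?v \<le> 1" "?v - ?u = 1 / real N"
        using Suc.prems N1 by (auto simp: divide_right_mono diff_divide_distrib[symmetric])
      have sub: "{?u..?v} \<subseteq> {0..1}" "{0..?v} \<subseteq> {0..1}" using uv by auto
      have c1: "continuous_on {?u..?v} \<Phi>" "continuous_on {0..?v} \<Phi>"
        using continuous_on_subset[OF cont] sub by auto
      have comb: "integral {0..?u} \<Phi> + integral {?u..?v} \<Phi> = integral {0..?v} \<Phi>"
        using uv c1 by (intro Henstock_Kurzweil_Integration.integral_combine integrable_continuous_interval) auto
      have "norm (integral {?u..?v} (\<lambda>t. \<Phi> t - \<Phi> ?u)) \<le> e / 2 * (?v - ?u)"
      proof (rule integral_bound)
        show "norm (\<Phi> t - \<Phi> ?u) \<le> e / 2" if "t \<in> {?u..?v}" for t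
        proof -
          have t: "?u \<le> t" "t \<le> ?v" using that by auto
          have "\<bar>\<Phi> t - \<Phi> ?u\<bar> < e / 2"
          proof (rule \<delta>(2))
            show "?u \<in> {0..1}" "t \<in> {0..1}" using t uv(1-3) unfolding atLeastAtMost_iff by linarith+
            show "\<bar>t - ?u\<bar> < \<delta>" using t uv(4) h by linarith
          qed
          then show ?thesis by simp
        qed
      qed (use uv c1 in \<open>auto intro!: continuous_intros\<close>)
      also have "integral {?u..?v} (\<lambda>t. \<Phi> t - \<Phi> ?u) = integral {?u..?v} \<Phi> - \<Phi> ?u * (1 / real N)"
        using c1 uv by (subst Henstock_Kurzweil_Integration.integral_diff) (auto intro: integrable_continuous_interval)
      finally have "\<bar>integral {?u..?v} \<Phi> - \<Phi> ?u / real N\<bar> \<le> e / 2 * (1 / real N)"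
        unfolding uv(4) by simp
      moreover have "\<bar>integral {0..?u} \<Phi> - (\<Sum>z<m. \<Phi> (real z / real N)) / real N\<bar> \<le> ?u * (e / 2)"
        using Suc by simp
      moreover have "?v * (e / 2) = ?u * (e / 2) + e / 2 * (1 / real N)"
        by (simp add: add_divide_distrib algebra_simps)
      moreover have "(\<Sum>z<Suc m. \<Phi> (real z / real N)) / real N = (\<Sum>z<m. \<Phi> (real z / real N)) / real N + \<Phi> ?u / real N"
        by (simp add: add_divide_distrib)
      ultimately show ?case unfolding comb[symmetric] by linarith
    qed simp
    from this[of N] have "\<bar>integral {0..1} \<Phi> - (\<Sum>z<N. \<Phi> (real z / real N)) / real N\<bar> \<le> e / 2" using N1 by simp
    then show "norm ((\<Sum>z<N. \<Phi> (real z / real N)) / real N - (LINT q:{0..1}|lborel. \<Phi> q)) < e"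
      unfolding L real_norm_def using e by linarith
  qed
qed

text \<open>The bulk lacks the endpoint term \<open>z = 0\<close> and is normalised by
  \<open>N - 1\<close>; both corrections vanish in the limit.\<close>

lemma riemann_bulk_limit:
  fixes \<Phi> :: "real \<Rightarrow> real"
  assumes cont: "continuous_on {0..1} \<Phi>"
  shows "(\<lambda>N. 1 / (real N - 1) * (\<Sum>z\<in>bulk N. \<Phi> (real_of_int z / real N))) \<longlonglongrightarrow> (LINT q:{0..1}|lborel. \<Phi> q)"
proof -
  let ?R = "\<lambda>N. (\<Sum>z<N. \<Phi> (real z / real N)) / real N"
  have eq: "real N / (real N - 1) * (?R N - \<Phi> 0 / real N) =
      1 / (real N - 1) * (\<Sum>z\<in>bulk N. \<Phi> (real_of_int z / real N))" if "N \<ge> 2" for N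
  proof -
    have "bij_betw int {1..<N} (bulk N)"
      by (rule bij_betwI[of _ _ _ nat]) (auto simp: bulk_def)
    from sum.reindex_bij_betw[OF this, of "\<lambda>z. \<Phi> (real_of_int z / real N)"]
    have "(\<Sum>z\<in>bulk N. \<Phi> (real_of_int z / real N)) = (\<Sum>z\<in>{1..<N}. \<Phi> (real z / real N))" by simp
    moreover have "{..<N} = insert 0 {1..<N}" using that by auto
    ultimately have "(\<Sum>z<N. \<Phi> (real z / real N)) = \<Phi> 0 + (\<Sum>z\<in>bulk N. \<Phi> (real_of_int z / real N))"
      by simp
    then show ?thesis using that by (simp add: field_simps)
  qed
  have "(\<lambda>N. real N / (real N - 1)) \<longlonglongrightarrow> 1" by real_asymp
  moreover have "(\<lambda>N. ?R N - \<Phi> 0 / real N) \<longlonglongrightarrow> (LINT q:{0..1}|lborel. \<Phi> q) - 0"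
    by (intro tendsto_diff riemann_sum_limit[OF cont]) real_asymp
  ultimately have "(\<lambda>N. real N / (real N - 1) * (?R N - \<Phi> 0 / real N)) \<longlonglongrightarrow> 1 * ((LINT q:{0..1}|lborel. \<Phi> q) - 0)"
    by (rule tendsto_mult)
  then have "(\<lambda>N. real N / (real N - 1) * (?R N - \<Phi> 0 / real N)) \<longlonglongrightarrow> (LINT q:{0..1}|lborel. \<Phi> q)" by simp
  then show ?thesis
    by (rule Lim_transform_eventually) (use eq in \<open>auto simp: eventually_sequentially\<close>)
qed

lemma mean_profile_uniform_limit:
  assumes \<gamma>12: "1 < \<gamma>" "\<gamma> < 2" and a: "0 < a" "a < 1" and b: "0 < b" "b < 1"
    and inv: "\<And>N. N \<ge> 2 \<Longrightarrow> invariant_measure \<gamma> a b N (\<mu> N)"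
    and weak: "weak_solution \<gamma> a b \<rho>" and e: "e > 0"
  shows "\<forall>\<^sub>F N in sequentially. \<forall>x\<in>bulk N.
    \<bar>measure_pmf.expectation (\<mu> N) (\<lambda>\<eta>. \<eta> x) - \<rho> (real_of_int x / real N)\<bar> \<le> e"
proof -
  \<comment> \<open>\<open>4 * e'\<close> from the comparison plus \<open>e'\<close> from the
    vanishing error term stays below \<open>e\<close>.\<close>
  define e' where "e' = e / 8"
  have e': "e' > 0" using e by (simp add: e'_def)
  have \<gamma>0: "\<gamma> > 0" using \<gamma>12 by simp
  let ?\<rho> = "\<lambda>y. \<rho> (max 0 (min 1 y))"
  have "continuous_on {0..1} \<rho>" using weak by (simp add: weak_solution_def)
  then have "uniformly_continuous_on {0..1} \<rho>" by (rule compact_uniformly_continuous) simp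
  then obtain \<delta> where \<delta>: "\<delta> > 0" "\<And>x y. x \<in> {0..1} \<Longrightarrow> y \<in> {0..1} \<Longrightarrow> \<bar>y - x\<bar> < \<delta> \<Longrightarrow> \<bar>\<rho> y - \<rho> x\<bar> < e'"
    using e' unfolding uniformly_continuous_on_def dist_real_def by meson
  define s where "s = (\<gamma> - 1) / \<gamma>\<^sup>2"
  have s: "s > 0" using barrier_exponent[OF \<gamma>12(1)] by (simp add: s_def)
  \<comment> \<open>The first bound keeps the oscillation of the solution over distance
    \<open>2 * r\<close> below \<open>e'\<close>, the second makes the barrier at distance
    \<open>2 * r\<close> at most \<open>e'\<close>. Neither involves \<open>N\<close>, so the kernel
    and its constants stay fixed as \<open>N\<close> grows.\<close>
  define r where "r = min (\<delta> / 4) (e' powr (1 / s) / 2)"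
  have r: "r > 0" using \<delta> e' by (simp add: r_def)
  have "(2 * r) powr s \<le> (e' powr (1 / s)) powr s"
    using r s by (intro powr_mono2) (auto simp: r_def)
  also have "\<dots> = e'" using e' s by (simp add: powr_powr)
  finally have er: "(2 * r) powr ((\<gamma> - 1) / \<gamma>\<^sup>2) \<le> e'" by (simp add: s_def)
  have uc: "\<bar>?\<rho> y - ?\<rho> y'\<bar> \<le> e'" if "\<bar>y - y'\<bar> \<le> 2 * r" for y y'
  proof -
    have "2 * r < \<delta>" using \<delta>(1) by (simp add: r_def)
    then have "\<bar>max 0 (min 1 y) - max 0 (min 1 y')\<bar> < \<delta>" using that by linarith
    then show ?thesis using \<delta>(2)[of "max 0 (min 1 y')" "max 0 (min 1 y)"] by simp
  qed
  obtain k k' k'' C B where k: "bounded_C2 k k' k'' C B" "continuous_on UNIV k''" "\<And>y. 0 \<le> k y"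
    "\<And>y. k y \<noteq> 0 \<Longrightarrow> \<bar>y\<bar> \<le> r" "integrable lborel k" "(\<integral>y. k y \<partial>lborel) = 1"
    using mollifier_exists[OF r] by metis
  let ?err = "\<lambda>N. (c_const \<gamma> * (5 * (\<Sum>n. real (n + 1) powr (- \<gamma>)) + 1 / (2 - \<gamma>)) * C * (1 / real N) powr (2 - \<gamma>)
      + 2 * B * c_const \<gamma> * (1 / real N) * r powr (- (1 + \<gamma>))) / kill \<gamma>"
  have p: "(\<lambda>N. (1 / real N) powr (2 - \<gamma>)) \<longlonglongrightarrow> 0"
  proof -
    have "(\<lambda>N. (1 / real N) powr (2 - \<gamma>)) \<longlonglongrightarrow> 0 powr (2 - \<gamma>)"
      using \<gamma>12 lim_1_over_n by (intro tendsto_powr') auto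
    then show ?thesis by simp
  qed
  have "?err \<longlonglongrightarrow> (c_const \<gamma> * (5 * (\<Sum>n. real (n + 1) powr (- \<gamma>)) + 1 / (2 - \<gamma>)) * C * 0
      + 2 * B * c_const \<gamma> * 0 * r powr (- (1 + \<gamma>))) / kill \<gamma>"
    using kill_pos[OF \<gamma>0] by (intro tendsto_intros p lim_1_over_n) auto
  then have "?err \<longlonglongrightarrow> 0" by simp
  then have "\<forall>\<^sub>F N in sequentially. ?err N < e'" using e' by (rule order_tendstoD(2))
  moreover have "\<forall>\<^sub>F N in sequentially. N \<ge> 2" by (rule eventually_ge_at_top)
  ultimately show ?thesis
  proof eventually_elim
    case (elim N)
    interpret stationary_exclusion \<gamma> a b N "\<mu> N"
      using elim \<gamma>12 a b inv by unfold_locales auto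
    show ?case
    proof
      fix x assume x: "x \<in> bulk N"
      have "\<bar>profile x - ?\<rho> (real_of_int x / real N)\<bar> \<le> 4 * e' + ?err N"
        by (rule profile_error[OF \<gamma>12(2) weak k r e' er uc])
      moreover have "profile x = measure_pmf.expectation (\<mu> N) (\<lambda>\<eta>. \<eta> x)"
        using x by (auto simp: profile_def bulk_def mean_def)
      moreover have "max 0 (min 1 (real_of_int x / real N)) = real_of_int x / real N"
        using x by (auto simp: bulk_def)
      ultimately have "\<bar>measure_pmf.expectation (\<mu> N) (\<lambda>\<eta>. \<eta> x) - \<rho> (real_of_int x / real N)\<bar> \<le> 4 * e' + ?err N"
        by (simp only:)
      then show "\<bar>measure_pmf.expectation (\<mu> N) (\<lambda>\<eta>. \<eta> x) - \<rho> (real_of_int x / real N)\<bar> \<le> e"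
        using elim(1) e e'_def by linarith
    qed
  qed
qed

lemma (in stationary_exclusion) empirical_deviation:
  assumes h: "\<And>x. x \<in> bulk N \<Longrightarrow> \<bar>h x\<bar> \<le> B" and e: "e > 0"
  shows "measure_pmf.prob \<mu> {\<eta>. e \<le> \<bar>(\<Sum>x\<in>bulk N. h x * \<eta> x) - (\<Sum>x\<in>bulk N. h x * mean x)\<bar>} \<le>
    B\<^sup>2 * (real N + total_rate * real N powr \<gamma> / kill \<gamma>) / e\<^sup>2"
proof -
  let ?X = "\<lambda>\<eta>. \<Sum>x\<in>bulk N. h x * \<eta> x"
  have EX: "E ?X = (\<Sum>x\<in>bulk N. h x * mean x)" by (simp add: mean_def)
  have "measure_pmf.prob \<mu> {\<eta> \<in> space (measure_pmf \<mu>). e \<le> \<bar>?X \<eta> - E ?X\<bar>} \<le> measure_pmf.variance \<mu> ?X / e\<^sup>2"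
    using e by (intro measure_pmf.Chebyshev_inequality) auto
  also have "\<dots> \<le> B\<^sup>2 * (real N + total_rate * real N powr \<gamma> / kill \<gamma>) / e\<^sup>2"
    unfolding EX using variance_le[OF h] e by (intro divide_right_mono) auto
  finally show ?thesis unfolding EX by simp
qed

theorem theorem2p2:
  fixes \<gamma> \<alpha> \<beta> :: real
    and \<mu> :: "nat \<Rightarrow> config pmf"
    and \<rho> H :: "real \<Rightarrow> real"
  assumes "1 < \<gamma>" "\<gamma> < 2"
    and "0 < \<alpha>" "\<alpha> < 1"
    and "0 < \<beta>" "\<beta> < 1"
    and "\<And>N. N \<ge> 2 \<Longrightarrow> invariant_measure \<gamma> \<alpha> \<beta> N (\<mu> N)"
    and "weak_solution \<gamma> \<alpha> \<beta> \<rho>"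
    and "continuous_on {0..1} H"
  shows "tendsto_in_prob \<mu>
           (\<lambda>N \<eta>. 1 / (real N - 1) * (\<Sum>z\<in>bulk N. H (real_of_int z / real N) * \<eta> z))
           (LINT q:{0..1}|lborel. H q * \<rho> q)"
  unfolding tendsto_in_prob_def
proof (intro allI impI)
  fix \<epsilon> :: real assume \<epsilon>: "\<epsilon> > 0"
  note \<gamma> = assms(1,2)
  let ?L = "LINT q:{0..1}|lborel. H q * \<rho> q"
  let ?X = "\<lambda>N \<eta>. 1 / (real N - 1) * (\<Sum>z\<in>bulk N. H (real_of_int z / real N) * \<eta> z)"
  let ?m = "\<lambda>N x. measure_pmf.expectation (\<mu> N) (\<lambda>\<eta>. \<eta> x)"
  have c\<rho>: "continuous_on {0..1} \<rho>" using assms(8) by (simp add: weak_solution_def)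
  have "compact (H ` {0..1})" by (rule compact_continuous_image[OF assms(9)]) simp
  then obtain B where B: "B > 0" "\<And>q. q \<in> {0..1} \<Longrightarrow> \<bar>H q\<bar> \<le> B"
    using compact_imp_bounded bounded_pos by (metis imageI real_norm_def)
  have Hb: "\<bar>H (real_of_int z / real N)\<bar> \<le> B" if "z \<in> bulk N" for z N
    using that by (intro B(2)) (auto simp: bulk_def)
  have card: "real (card (bulk N)) = real N - 1" if "N \<ge> 2" for N using that by (simp add: bulk_def)
  have "(\<lambda>N. 1 / (real N - 1) * (\<Sum>z\<in>bulk N. H (real_of_int z / real N) * \<rho> (real_of_int z / real N))) \<longlonglongrightarrow> ?L"
    by (rule riemann_bulk_limit) (intro continuous_intros assms(9) c\<rho>)
  then have ev1: "\<forall>\<^sub>F N in sequentially.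
      \<bar>1 / (real N - 1) * (\<Sum>z\<in>bulk N. H (real_of_int z / real N) * \<rho> (real_of_int z / real N)) - ?L\<bar> < \<epsilon> / 4"
    using \<epsilon> by (auto dest!: tendstoD[where e = "\<epsilon> / 4"] simp: dist_real_def)
  \<comment> \<open>With weights bounded by \<open>B\<close>, this precision on the means costs
    \<epsilon> / 4 in the average.\<close>
  have ev2: "\<forall>\<^sub>F N in sequentially. \<forall>x\<in>bulk N. \<bar>?m N x - \<rho> (real_of_int x / real N)\<bar> \<le> \<epsilon> / (4 * B)"
    by (rule mean_profile_uniform_limit) (use assms \<epsilon> B in auto)
  have ev3: "\<forall>\<^sub>F N in sequentially. N \<ge> (2::nat)" by (rule eventually_ge_at_top)
  \<comment> \<open>\<open>total_rate\<close> depends only on \<gamma>, so one constant serves every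
    \<open>N\<close>; the absolute value in \<open>K\<close> makes it nonnegative before the locale
    is entered.\<close>
  define T where "T = stationary_exclusion.total_rate \<gamma>"
  define K where "K = \<bar>T\<bar> / kill \<gamma>"
  \<comment> \<open>The 16 is \<open>2\<^sup>2\<close> from \<open>N - 1 \<ge> N / 2\<close> times
    \<open>2\<^sup>2\<close> from the fluctuation threshold \<epsilon> / 2.\<close>
  let ?bd = "\<lambda>N. 16 * B\<^sup>2 / \<epsilon>\<^sup>2 * (1 / real N + K * real N powr (\<gamma> - 2))"
  have "\<forall>\<^sub>F N in sequentially. norm (measure_pmf.prob (\<mu> N) {\<eta>. \<bar>?X N \<eta> - ?L\<bar> > \<epsilon>}) \<le> ?bd N"
    using ev1 ev2 ev3
  proof eventually_elim
    case (elim N)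
    interpret stationary_exclusion \<gamma> \<alpha> \<beta> N "\<mu> N"
      using elim assms by unfold_locales auto
    have N1: "real N - 1 > 0" using elim by simp
    let ?h = "\<lambda>z. H (real_of_int z / real N) / (real N - 1)"
    let ?M = "\<Sum>z\<in>bulk N. ?h z * mean z"
    have X: "?X N \<eta> = (\<Sum>z\<in>bulk N. ?h z * \<eta> z)" for \<eta>
      by (simp add: sum_divide_distrib)
    have "\<bar>?M - 1 / (real N - 1) * (\<Sum>z\<in>bulk N. H (real_of_int z / real N) * \<rho> (real_of_int z / real N))\<bar> =
        1 / (real N - 1) * \<bar>\<Sum>z\<in>bulk N. H (real_of_int z / real N) * (mean z - \<rho> (real_of_int z / real N))\<bar>"
    proof -
      have "?M - 1 / (real N - 1) * (\<Sum>z\<in>bulk N. H (real_of_int z / real N) * \<rho> (real_of_int z / real N)) =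
        1 / (real N - 1) * (\<Sum>z\<in>bulk N. H (real_of_int z / real N) * (mean z - \<rho> (real_of_int z / real N)))"
        by (simp add: sum_divide_distrib right_diff_distrib sum_subtractf diff_divide_distrib)
      then show ?thesis using N1 by (simp only: abs_mult) simp
    qed
    also have "\<dots> \<le> 1 / (real N - 1) * (\<Sum>z\<in>bulk N. B * (\<epsilon> / (4 * B)))"
    proof (intro mult_left_mono order_trans[OF sum_abs] sum_mono)
      fix z assume z: "z \<in> bulk N"
      show "\<bar>H (real_of_int z / real N) * (mean z - \<rho> (real_of_int z / real N))\<bar> \<le> B * (\<epsilon> / (4 * B))"
        unfolding abs_mult using Hb[OF z] elim(2) z B by (intro mult_mono) (auto simp: mean_def)
    qed (use N1 in simp)
    also have "\<dots> = \<epsilon> / 4" using card[OF elim(3)] N1 B by simp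
    \<comment> \<open>\<epsilon> / 4 from the means and \<epsilon> / 4 from the Riemann sum leave
      \<epsilon> / 2 for the fluctuations.\<close>
    finally have M: "\<bar>?M - ?L\<bar> \<le> \<epsilon> / 2" using elim(1) by linarith
    have "measure_pmf.prob (\<mu> N) {\<eta>. \<bar>?X N \<eta> - ?L\<bar> > \<epsilon>} \<le>
        measure_pmf.prob (\<mu> N) {\<eta>. \<epsilon> / 2 \<le> \<bar>(\<Sum>z\<in>bulk N. ?h z * \<eta> z) - ?M\<bar>}"
      unfolding X
    proof (intro measure_pmf.finite_measure_mono subsetI)
      fix \<eta> assume "\<eta> \<in> {\<eta>. \<bar>(\<Sum>z\<in>bulk N. ?h z * \<eta> z) - ?L\<bar> > \<epsilon>}"
      then have "\<bar>(\<Sum>z\<in>bulk N. ?h z * \<eta> z) - ?L\<bar> > \<epsilon>" by (simp only: mem_Collect_eq)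
      then have "\<epsilon> / 2 \<le> \<bar>(\<Sum>z\<in>bulk N. ?h z * \<eta> z) - ?M\<bar>" using M by linarith
      then show "\<eta> \<in> {\<eta>. \<epsilon> / 2 \<le> \<bar>(\<Sum>z\<in>bulk N. ?h z * \<eta> z) - ?M\<bar>}" by (simp only: mem_Collect_eq)
    qed simp
    also have "\<dots> \<le> (B / (real N - 1))\<^sup>2 * (real N + total_rate * real N powr \<gamma> / kill \<gamma>) / (\<epsilon> / 2)\<^sup>2"
      using Hb N1 \<epsilon> by (intro empirical_deviation) (auto simp: divide_right_mono)
    also have "\<dots> \<le> (2 * B / real N)\<^sup>2 * (real N + K * real N powr \<gamma>) / (\<epsilon> / 2)\<^sup>2"
    proof (intro divide_right_mono mult_mono)
      have "B / (real N - 1) \<le> B / (real N / 2)" using B elim by (intro divide_left_mono) auto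
      then show "(B / (real N - 1))\<^sup>2 \<le> (2 * B / real N)\<^sup>2" using B N1 by (intro power_mono) (auto simp: mult.commute)
      have "total_rate * real N powr \<gamma> / kill \<gamma> \<le> K * real N powr \<gamma>"
        using kill_pos[OF \<gamma>0] by (simp add: K_def T_def divide_right_mono mult_right_mono)
      then show "real N + total_rate * real N powr \<gamma> / kill \<gamma> \<le> real N + K * real N powr \<gamma>" by simp
      have "total_rate \<ge> 0" unfolding total_rate_def
        using c_const_pos[OF \<gamma>0] summable_shift_powr[of "-\<gamma>" 1] \<gamma> by (intro mult_nonneg_nonneg suminf_nonneg) auto
      then show "0 \<le> real N + total_rate * real N powr \<gamma> / kill \<gamma>" using kill_pos[OF \<gamma>0] by simp
    qed auto
    also have "\<dots> = ?bd N"
    proof -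
      have "real N powr \<gamma> = (real N)\<^sup>2 * real N powr (\<gamma> - 2)"
        using square_mult_powr[of "real N" "\<gamma> - 2"] elim by simp
      then have "(2 * B / real N)\<^sup>2 * (real N + K * real N powr \<gamma>) / (\<epsilon> / 2)\<^sup>2 =
          16 * B\<^sup>2 / \<epsilon>\<^sup>2 * ((real N + K * ((real N)\<^sup>2 * real N powr (\<gamma> - 2))) / (real N)\<^sup>2)"
        by (simp add: power_divide power_mult_distrib mult_ac)
      also have "(real N + K * ((real N)\<^sup>2 * real N powr (\<gamma> - 2))) / (real N)\<^sup>2 =
          1 / real N + K * real N powr (\<gamma> - 2)"
        using elim(3) by (simp add: power2_eq_square add_divide_distrib)
      finally show ?thesis .
    qed
    finally show ?case by simp
  qed
  moreover have "?bd \<longlonglongrightarrow> 0"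
  proof -
    have "(\<lambda>N. real N powr (\<gamma> - 2)) \<longlonglongrightarrow> 0"
      using \<gamma> by (intro tendsto_neg_powr filterlim_real_sequentially) auto
    then have "?bd \<longlonglongrightarrow> 16 * B\<^sup>2 / \<epsilon>\<^sup>2 * (0 + K * 0)"
      by (intro tendsto_intros lim_1_over_n)
    then show ?thesis by simp
  qed
  ultimately show "(\<lambda>N. measure_pmf.prob (\<mu> N) {\<eta>. \<bar>?X N \<eta> - ?L\<bar> > \<epsilon>}) \<longlonglongrightarrow> 0"
    by (rule Lim_null_comparison)
qed

end
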